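(* Let $0<\alpha<\beta<\infty$ and $w\in\mathcal W_{\alpha,\beta}$. For every bounded measurable functional $F:\mathcal N_{\mathbb R}\to\mathbb R$, \[ \mathbb E_w^{0,!}[F(X_w)] = \int_0^\infty \mathbb E_{M_w}^{iy,!}\left[F(p_\#M_w)\right]\,\nu_w(\mathrm dy), \] where $\mathbb E_w^{0,!}$ is expectation under the reduced Palm distribution of $X_w$ at the origin, $\mathbb E_{M_w}^{iy,!}[F(p_\#M_w)]=\int_{\mathcal N_{\mathbb H}}F(p_\#\xi)\,\mathsf P_{w,y}^{!}(\mathrm d\xi)$, and $\nu_w$ is the probability measure \[ \nu_w(\mathrm dy)=\frac{w(y)y^{-2}\,\mathrm dy}{\int_0^\infty w(u)u^{-2}\,\mathrm du}. \]
   Context: $\mathbb H=\{x+iy:x\in\mathbb R,\ y>0\}$ with planar Lebesgue measure $\mathrm dA$. $\mathcal N_{\mathbb R}$, $\mathcal N_{\mathbb H}$ denote the spaces of locally finite simple counting measures on $\mathbb R$, $\mathbb H$, with the Borel $\sigma$-fields of the vague topology. A point process is determinantal with kernel $K$ relative to $\mathrm dA$ if for every $k\ge1$ its $k$-th factorial moment measure has density $\det[K(z_i,z_j)]_{i,j=1}^k$ with respect to $\mathrm dA^{\otimes k}$. $Z_{\mathbb H}$ denotes the determinantal point process on $\mathbb H$ (Hardy--Szegő zero process) with kernel $K_{\mathbb H}(z,\zeta)=-\frac{1}{\pi(z-\overline\zeta)^2}$ relative to $\mathrm dA$. $\mathcal W_{\alpha,\beta}$ is the set of Borel functions $w:(0,\infty)\to[0,1]$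 with $w(y)=0$ for $y\notin[\alpha,\beta]$ and $\int_\alpha^\beta w(y)\,\mathrm dy>0$. $M_w$ is obtained from $Z_{\mathbb H}$ by independently retaining each point $z=x+iy$ with probability $w(y)$. $p:\mathbb H\to\mathbb R$ is $p(x+iy)=x$, and $X_w=p_\#M_w=\sum_{z\in M_w}\delta_{\operatorname{Re}z}$. $X_w$ is a stationary, locally finite, simple point process on $\mathbb R$ with intensity $\lambda_w=\frac1{4\pi}\int_0^\infty w(y)y^{-2}\,\mathrm dy$. With $\theta_x$ denoting translation by $-x$, the reduced Palm distribution $\mathbb P_w^{0,!}$ of $X_w$ at the origin (a probability measure on $\mathcal N_{\mathbb R}$, with expectation $\mathbb E_w^{0,!}$, the canonical configuration under it again being written $X_w$) is characterized by $\mathbb E\sum_{x\in X_w}\mathbf 1_B(x)F(\theta_x(X_w-\delta_x))=|B|\lambda_w\,\mathbb E_w^{0,!}[F(X_w)]$ for all bounded Borel $B\subset\mathbb R$ with $|B|>0$ and bounded measurable $F:\mathcal N_{\mathbb R}\to\mathbb R$. For $y>0$, $\mathsf P_{w,y}^{!}$ is the determinantal law on $\mathcal N_{\mathbb H}$ with kernel $\widehat K_{w,y}^{!}(z,\zeta)=\sqrt{w(\operatorname{Im}z)}\,K_{\mathbb H}^{iy,!}(z,\zeta)\sqrt{w(\operatorname{Im}\zeta)}$, where $K_{\mathbb H}^{iy,!}(z,\zeta)=K_{\mathbb H}(z,\zeta)-\frac{K_{\mathbb H}(z,iy)K_{\mathbb H}(iy,\zeta)}{K_{\mathbb H}(iy,iy)}$.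 This is a height-indexed version of the reduced Palm law of $M_w$ at $iy$. For each $y$, $p_\#\xi\in\mathcal N_{\mathbb R}$ for $\mathsf P_{w,y}^{!}$-almost every $\xi$; $F(p_\#\xi)$ is set to $0$ when $p_\#\xi\notin\mathcal N_{\mathbb R}$. *)

theory Defs
  imports "HOL-Probability.Probability" "Jordan_Normal_Form.Determinant"
begin

section \<open>Locally finite simple counting measures and the vague topology\<close>

text \<open>
  The state space \<open>E\<close> is a Borel subset of the ambient type (the real line is \<open>UNIV\<close>); measures on it
  live on \<open>restrict_space borel E\<close>.  For a set of points \<open>S\<close>, \<open>point_measure_on E S\<close> is the sum of
  the Dirac measures \<open>\<delta>\<^sub>s\<close>, \<open>s \<in> S\<close>, i.e. it maps \<open>A\<close> to the number of points of \<open>S\<close> in \<open>A\<close>.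
\<close>

definition point_measure_on :: "'a::topological_space set \<Rightarrow> 'a set \<Rightarrow> 'a measure" where
  "point_measure_on E S = distr (count_space S) (restrict_space borel E) (\<lambda>x. x)"

lemma emeasure_point_measure_on:
  assumes "S \<subseteq> E" "A \<in> sets (restrict_space borel E)"
  shows "emeasure (point_measure_on E S) A = emeasure (count_space S) (S \<inter> A)"
  using assms unfolding point_measure_on_def
  by (subst emeasure_distr) (auto simp: space_restrict_space Int_commute)

definition simple_configs :: "'a::topological_space set \<Rightarrow> 'a measure set" where
  "simple_configs E =
     {point_measure_on E S | S. S \<subseteq> E \<and> (\<forall>C. compact C \<and> C \<subseteq> E \<longrightarrow> finite (S \<inter> C))}"

definition atoms :: "'a measure \<Rightarrow> 'a set" where
  "atoms \<mu> = {x \<in> space \<mu>. emeasure \<mu> {x} \<noteq> 0}"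

definition compactly_supported :: "'a::topological_space set \<Rightarrow> ('a \<Rightarrow> real) set" where
  "compactly_supported E =
     {f. continuous_on E f \<and> (\<exists>C. compact C \<and> C \<subseteq> E \<and> (\<forall>x\<in>E - C. f x = 0))}"

text \<open>The coarsest topology making \<open>\<mu> \<mapsto> \<integral> f d\<mu>\<close> continuous for all compactly supported continuous \<open>f\<close>.\<close>

definition vague_topology :: "'a::topological_space set \<Rightarrow> 'a measure topology" where
  "vague_topology E = topology_generated_by
     {{\<mu> \<in> simple_configs E. (\<integral>x. f x \<partial>\<mu>) \<in> U} | f U. f \<in> compactly_supported E \<and> open U}"

definition config_space :: "'a::topological_space set \<Rightarrow> 'a measure measure" where
  "config_space E = sigma (simple_configs E) {U. openin (vague_topology E) U}"

lemma openin_vague_subset: "openin (vague_topology E) U \<Longrightarrow> U \<subseteq> simple_configs E"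
  using openin_subset[of "vague_topology E" U] by (auto simp: vague_topology_def)

lemma space_config_space [simp]: "space (config_space E) = simple_configs E"
  unfolding config_space_def by (rule space_measure_of) (auto dest: openin_vague_subset)

lemma sets_config_space:
  "sets (config_space E) = sigma_sets (simple_configs E) {U. openin (vague_topology E) U}"
  unfolding config_space_def by (rule sets_measure_of) (auto dest: openin_vague_subset)

section \<open>Determinantal point processes on the upper half-plane\<close>

definition upper_half_plane :: "complex set" where
  "upper_half_plane = {z. Im z > 0}"

definition dA :: "complex measure" where
  "dA = restrict_space lborel upper_half_plane"

abbreviation dA_power :: "nat \<Rightarrow> (nat \<Rightarrow> complex) measure" where
  "dA_power k \<equiv> PiM {..<k} (\<lambda>_. dA)"

abbreviation "N_R \<equiv> config_space (UNIV :: real set)"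
abbreviation "N_H \<equiv> config_space upper_half_plane"

text \<open>
  The expected number of \<open>k\<close>-tuples of pairwise distinct points of the configuration that lie in
  the set \<open>B\<close> of \<open>k\<close>-tuples.
\<close>

definition factorial_moment_measure ::
  "complex measure measure \<Rightarrow> nat \<Rightarrow> (nat \<Rightarrow> complex) set \<Rightarrow> ennreal" where
  "factorial_moment_measure P k B =
     (\<integral>\<^sup>+\<xi>. emeasure (count_space UNIV) {z \<in> B. inj_on z {..<k} \<and> (\<forall>i<k. z i \<in> atoms \<xi>)} \<partial>P)"

definition kernel_det :: "(complex \<Rightarrow> complex \<Rightarrow> complex) \<Rightarrow> nat \<Rightarrow> (nat \<Rightarrow> complex) \<Rightarrow> complex" where
  "kernel_det K k z = Determinant.det (Matrix.mat k k (\<lambda>(i, j). K (z i) (z j)))"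

text \<open>
  The determinants are complex numbers; being the density of a (nonnegative) measure includes that
  they are almost everywhere real and nonnegative.
\<close>

definition determinantal_law :: "(complex \<Rightarrow> complex \<Rightarrow> complex) \<Rightarrow> complex measure measure \<Rightarrow> bool" where
  "determinantal_law K P \<longleftrightarrow>
     prob_space P \<and> sets P = sets N_H \<and>
     (\<forall>k\<ge>1.
        (\<lambda>z. kernel_det K k z) \<in> borel_measurable (dA_power k) \<and>
        (AE z in dA_power k. kernel_det K k z \<in> \<real> \<and> 0 \<le> Re (kernel_det K k z)) \<and>
        (\<forall>B \<in> sets (dA_power k).
           factorial_moment_measure P k B =
             (\<integral>\<^sup>+z\<in>B. ennreal (Re (kernel_det K k z)) \<partial>dA_power k)))"

definition K_H :: "complex \<Rightarrow> complex \<Rightarrow> complex" where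
  "K_H z \<zeta> = - 1 / (of_real pi * (z - cnj \<zeta>)\<^sup>2)"

definition palm_kernel ::
  "(complex \<Rightarrow> complex \<Rightarrow> complex) \<Rightarrow> complex \<Rightarrow> complex \<Rightarrow> complex \<Rightarrow> complex" where
  "palm_kernel K a z \<zeta> = K z \<zeta> - K z a * K a \<zeta> / K a a"

definition thinned_palm_kernel :: "(real \<Rightarrow> real) \<Rightarrow> real \<Rightarrow> complex \<Rightarrow> complex \<Rightarrow> complex" where
  "thinned_palm_kernel w y z \<zeta> =
     of_real (sqrt (w (Im z))) * palm_kernel K_H (\<i> * of_real y) z \<zeta> * of_real (sqrt (w (Im \<zeta>)))"

section \<open>Thinning and projection\<close>

text \<open>Only the values of a weight on \<open>(0, \<infinity>)\<close> are relevant.\<close>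

definition weights :: "real \<Rightarrow> real \<Rightarrow> (real \<Rightarrow> real) set" where
  "weights \<alpha> \<beta> =
     {w. w \<in> borel_measurable (restrict_space borel {0<..}) \<and>
         (\<forall>y>0. 0 \<le> w y \<and> w y \<le> 1) \<and>
         (\<forall>y>0. y \<notin> {\<alpha>..\<beta>} \<longrightarrow> w y = 0) \<and>
         (LINT y:{\<alpha>..\<beta>}|lborel. w y) > 0}"

text \<open>
  Given the configuration \<open>\<xi>\<close>, toss independent coins, the one at the point \<open>z\<close> of \<open>\<xi>\<close> showing \<open>True\<close>
  with probability \<open>q z\<close>, and keep the points whose coin shows \<open>True\<close>.
\<close>

definition thin_kernel :: "(complex \<Rightarrow> real) \<Rightarrow> complex measure \<Rightarrow> complex measure measure" where
  "thin_kernel q \<xi> =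
     distr (PiM (atoms \<xi>) (\<lambda>z. measure_pmf (bernoulli_pmf (q z)))) N_H
       (\<lambda>b. point_measure_on upper_half_plane {z \<in> atoms \<xi>. b z})"

text \<open>The law of \<open>M\<^sub>w\<close>, given the law \<open>PZ\<close> of the Hardy-Szego zero process.\<close>

definition law_M :: "(real \<Rightarrow> real) \<Rightarrow> complex measure measure \<Rightarrow> complex measure measure" where
  "law_M w PZ = PZ \<bind> thin_kernel (\<lambda>z. w (Im z))"

definition proj_Re :: "complex measure \<Rightarrow> real measure" where
  "proj_Re \<xi> = distr \<xi> borel Re"

text \<open>
  The law of \<open>X\<^sub>w\<close>.  For almost every configuration of \<open>M\<^sub>w\<close> the projection is locally finite and
  simple; on the exceptional null set the empty configuration is used.
\<close>

definition law_X :: "(real \<Rightarrow> real) \<Rightarrow> complex measure measure \<Rightarrow> real measure measure" where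
  "law_X w PZ = distr (law_M w PZ) N_R
     (\<lambda>\<xi>. if proj_Re \<xi> \<in> simple_configs UNIV then proj_Re \<xi> else null_measure borel)"

text \<open>The value \<open>F (p\<^sub># \<xi>)\<close>, with the convention that it is 0 if the projection is not in \<open>simple_configs UNIV\<close>.\<close>

definition on_proj :: "(real measure \<Rightarrow> real) \<Rightarrow> complex measure \<Rightarrow> real" where
  "on_proj F \<xi> = (if proj_Re \<xi> \<in> simple_configs UNIV then F (proj_Re \<xi>) else 0)"

section \<open>Reduced Palm distribution at the origin\<close>

definition shift :: "real \<Rightarrow> real measure \<Rightarrow> real measure" where
  "shift x \<mu> = distr \<mu> borel (\<lambda>t. t - x)"

definition bounded_functional :: "(real measure \<Rightarrow> real) \<Rightarrow> bool" where
  "bounded_functional F \<longleftrightarrow>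
     F \<in> borel_measurable N_R \<and> bounded (F ` simple_configs UNIV)"

text \<open>
  \<open>Q\<close> is the reduced Palm distribution at the origin of the stationary law \<open>P\<close> of intensity \<open>l\<close>.
  The sum is finite, because \<open>B\<close> is bounded.
\<close>

definition reduced_palm ::
  "real measure measure \<Rightarrow> real \<Rightarrow> real measure measure \<Rightarrow> bool" where
  "reduced_palm P l Q \<longleftrightarrow>
     prob_space Q \<and> sets Q = sets N_R \<and>
     (\<forall>B F. B \<in> sets borel \<and> bounded B \<and> measure lborel B > 0 \<and> bounded_functional F \<longrightarrow>
        (\<integral>\<mu>. (\<Sum>x\<in>atoms \<mu> \<inter> B. F (shift x (diff_measure \<mu> (return borel x)))) \<partial>P) =
          measure lborel B * l * (\<integral>\<mu>. F \<mu> \<partial>Q))"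

definition intensity :: "(real \<Rightarrow> real) \<Rightarrow> real" where
  "intensity w = 1 / (4 * pi) * (LINT y:{0<..}|lborel. w y / y\<^sup>2)"

definition height_law :: "(real \<Rightarrow> real) \<Rightarrow> real measure" where
  "height_law w = density (restrict_space lborel {0<..})
     (\<lambda>y. ennreal ((w y / y\<^sup>2) / (LINT u:{0<..}|lborel. w u / u\<^sup>2)))"

end

theory Submission
  imports Defs
begin

text \<open>
  A law on configurations is determined by its void probabilities \<open>P(\<xi>(A) = 0)\<close>, and for locally
  bounded moments these are the alternating series \<open>\<Sum>\<^sub>k (-1)\<^sup>k / k! M\<^sub>k(A\<^sup>k)\<close> of factorial moments.
  Thinning multiplies the \<open>k\<close>-point density of the zero process by \<open>w(Im z\<^sub>1) \<cdots> w(Im z\<^sub>k)\<close>, and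
  Schur complementation splits the \<open>(k + 1)\<close>-point determinant into \<open>K(a, a)\<close> and the \<open>k\<close>-point
  determinant of the Palm kernel at \<open>a\<close>.  Moving the point \<open>a = x + \<i> y\<close> to \<open>\<i> y\<close> by translation
  invariance, the Campbell measure of the projected process, tested on a void event, becomes the
  integral over \<open>y\<close> of the void probabilities of the projected height-\<open>y\<close> Palm laws with weight
  \<open>w(y) K(\<i> y, \<i> y) = w(y) / (4 \<pi> y\<^sup>2)\<close>.  The series may be exchanged with the integrals because
  Hadamard's inequality bounds the \<open>k\<close>-point density by a \<open>k\<close>-th power.
\<close>

section \<open>Configuration spaces\<close>

text \<open>\<open>Palm_M\<close> is one law for each height y, with nothing said about how it
  varies with y, so even measurability of the inner integral has to be derived. The alternating
  series provides it: its terms are parameter integrals of explicit functions of y, so the void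
  probabilities are measurable in y, and through a generating pi-system so is the family of
  projected laws. The series lemma \<open>alternating_expectation\<close> is used for a single void
  probability, for the expected number of points over [0, 1] whose reduced configuration is void,
  and for the integral of void probabilities over y; the last two agree because their series agree
  term by term. The support of w in [\<alpha>, \<beta>] with \<alpha> > 0 replaces the preimage of a
  bounded set under Re, which is not relatively compact in the half-plane, by a bounded strip away
  from the boundary. This makes projections locally finite and bounds the diagonal of the kernel by
  1 / (4 pi \<alpha>^2); multiplied by the area of the strip, this is the base of the powers in the
  moment bounds. In the Palm identity B = [0, 1] has length one, so the intensity is the only
  constant that survives.\<close>

lemma sets_point_measure_on [simp, measurable_cong]:
  "sets (point_measure_on E S) = sets (restrict_space borel E)"
  by (simp add: point_measure_on_def)

lemma space_point_measure_on [simp]: "space (point_measure_on E S) = E"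
  by (simp add: point_measure_on_def space_restrict_space)

lemma nn_integral_point_measure_on:
  assumes "S \<subseteq> E" "f \<in> borel_measurable (restrict_space borel E)"
  shows "(\<integral>\<^sup>+x. f x \<partial>point_measure_on E S) = (\<integral>\<^sup>+x. f x \<partial>count_space S)"
  using assms unfolding point_measure_on_def
  by (subst nn_integral_distr) (auto simp: space_restrict_space)

lemma integral_point_measure_on:
  fixes f :: "'a::topological_space \<Rightarrow> real"
  assumes "S \<subseteq> E" "f \<in> borel_measurable (restrict_space borel E)"
  shows "(\<integral>x. f x \<partial>point_measure_on E S) = (\<integral>x. f x \<partial>count_space S)"
  using assms unfolding point_measure_on_def
  by (subst integral_distr) (auto simp: space_restrict_space)

lemma atoms_point_measure_on [simp]:
  fixes S :: "'a::t1_space set"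
  assumes "S \<subseteq> E"
  shows "atoms (point_measure_on E S) = S"
proof -
  have "emeasure (point_measure_on E S) {x} = emeasure (count_space S) (S \<inter> {x})" if "x \<in> E" for x
    using assms that by (intro emeasure_point_measure_on) (auto simp: sets_restrict_space_iff sets_restrict_space)
  then show ?thesis
    using assms by (auto simp: atoms_def emeasure_count_space split: if_splits)
qed

lemma simple_configsE:
  fixes \<xi> :: "'a::t1_space measure"
  assumes "\<xi> \<in> simple_configs E"
  shows "atoms \<xi> \<subseteq> E" and "\<xi> = point_measure_on E (atoms \<xi>)"
    and "compact C \<Longrightarrow> C \<subseteq> E \<Longrightarrow> finite (atoms \<xi> \<inter> C)"
    and "space \<xi> = E" and "sets \<xi> = sets (restrict_space borel E)"
  using assms unfolding simple_configs_def by auto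

lemma point_measure_on_in_simple_configs:
  "S \<subseteq> E \<Longrightarrow> (\<And>C. compact C \<Longrightarrow> C \<subseteq> E \<Longrightarrow> finite (S \<inter> C)) \<Longrightarrow>
    point_measure_on E S \<in> simple_configs E"
  unfolding simple_configs_def by blast

lemma emeasure_simple_configs:
  fixes \<xi> :: "'a::t1_space measure"
  assumes "\<xi> \<in> simple_configs E" "A \<in> sets (restrict_space borel E)"
  shows "emeasure \<xi> A = emeasure (count_space UNIV) (atoms \<xi> \<inter> A)"
proof -
  have "emeasure \<xi> A = emeasure (count_space (atoms \<xi>)) (atoms \<xi> \<inter> A)"
    by (metis assms emeasure_point_measure_on simple_configsE(1,2))
  then show ?thesis by (simp add: emeasure_count_space)
qed

lemma emeasure_simple_configs_compact:
  fixes \<xi> :: "'a::t1_space measure"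
  assumes "\<xi> \<in> simple_configs E" "A \<in> sets (restrict_space borel E)" "A \<subseteq> C" "compact C" "C \<subseteq> E"
  shows "finite (atoms \<xi> \<inter> A)" "emeasure \<xi> A = of_nat (card (atoms \<xi> \<inter> A))"
proof -
  show "finite (atoms \<xi> \<inter> A)"
    using simple_configsE(3)[OF assms(1,4,5)] by (rule rev_finite_subset) (use assms(3) in auto)
  then show "emeasure \<xi> A = of_nat (card (atoms \<xi> \<inter> A))"
    using assms by (simp add: emeasure_simple_configs emeasure_count_space)
qed

lemma nn_integral_simple_configs:
  fixes \<xi> :: "'a::t1_space measure"
  assumes "\<xi> \<in> simple_configs E" "f \<in> borel_measurable (restrict_space borel E)"
  shows "(\<integral>\<^sup>+x. f x \<partial>\<xi>) = (\<integral>\<^sup>+x. f x \<partial>count_space (atoms \<xi>))"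
  by (metis assms nn_integral_point_measure_on simple_configsE(1,2))

text \<open>Countability makes \<open>count_space\<close> over the atoms sigma-finite, which allows
  Tonelli between sums over atoms or tuples and other integrals.\<close>

lemma countable_atoms:
  fixes \<xi> :: "'a::euclidean_space measure"
  assumes "\<xi> \<in> simple_configs E" "open E"
  shows "countable (atoms \<xi>)"
proof -
  obtain C :: "nat \<Rightarrow> 'a set" where C: "\<And>n. compact (C n)" "\<And>n. C n \<subseteq> E" "\<Union>(range C) = E"
    using open_Union_compact_subsets[OF \<open>open E\<close>] by metis
  have "atoms \<xi> = (\<Union>n. atoms \<xi> \<inter> C n)"
    using C(3) simple_configsE(1)[OF assms(1)] by blast
  also have "countable \<dots>"
    using simple_configsE(3)[OF assms(1)] C by (intro countable_UN) (auto intro: countable_finite)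
  finally show ?thesis .
qed

section \<open>Measurability of counts and of integrals against a configuration\<close>

lemma measurable_config_integral:
  assumes "f \<in> compactly_supported E"
  shows "(\<lambda>\<xi>. \<integral>x. f x \<partial>\<xi>) \<in> borel_measurable (config_space E)"
proof (rule borel_measurableI)
  fix U :: "real set" assume "open U"
  then have "openin (vague_topology E) {\<mu> \<in> simple_configs E. (\<integral>x. f x \<partial>\<mu>) \<in> U}"
    using assms unfolding vague_topology_def openin_topology_generated_by_iff
    by (intro generate_topology_on.Basis) blast
  then show "(\<lambda>\<xi>. \<integral>x. f x \<partial>\<xi>) -` U \<inter> space (config_space E) \<in> sets (config_space E)"
    unfolding sets_config_space space_config_space
    by (intro sigma_sets.Basic) (auto simp: vimage_def Int_def conj_commute)
qed

text \<open>The vague topology sees continuous functions only, so the indicator of C is approximated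
  from above by bump functions \<open>f n\<close> that all vanish off one compact neighbourhood
  \<open>D\<close> of C inside E. A configuration has finite mass on \<open>D\<close>, so dominated
  convergence applies to each one.\<close>

lemma measurable_config_emeasure_compact:
  fixes E :: "'a::euclidean_space set"
  assumes "open E" "compact C" "C \<subseteq> E"
  shows "(\<lambda>\<xi>. emeasure \<xi> C) \<in> borel_measurable (config_space E)"
\<comment> \<open>\<open>infdist\<close> to the empty set is 0 by convention, so the bump functions
  below would not shrink to its indicator.\<close>
proof (cases "C = {}")
  case False
  obtain e where e: "e > 0" "{x. infdist x C \<le> e} \<subseteq> E"
    using compact_in_open_separated[OF False assms(2,1,3)] by metis
  define D where "D = {x. infdist x C \<le> e}"
  have D: "compact D" "D \<subseteq> E" "C \<subseteq> D"
    unfolding D_def using e assms(2) False compact_infdist_le by (auto intro: less_imp_le)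
  \<comment> \<open>The slope is (n + 1) / e rather than n / e so that already \<open>f 0\<close>
    vanishes at distance e from C.\<close>
  define f where "f n x = max 0 (1 - (real n + 1) / e * infdist x C)" for n :: nat and x
  have f_cont: "continuous_on A (f n)" for n A
    unfolding f_def by (intro continuous_intros)
  have f_out: "f n x = 0" if "x \<notin> D" for n x
  proof -
    have "infdist x C > e" using that by (simp add: D_def)
    then have "(real n + 1) / e * infdist x C \<ge> (real n + 1) / e * e"
      using e(1) by (intro mult_left_mono) auto
    moreover have "(real n + 1) / e * e \<ge> 1" using e(1) by simp
    ultimately show ?thesis by (simp add: f_def)
  qed
  have f_bd: "0 \<le> f n x" "f n x \<le> indicator D x" for n x
  proof -
    have "f n x \<le> 1" using e(1) by (auto simp: f_def infdist_nonneg)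
    then show "f n x \<le> indicator D x" using f_out[of x n] by (auto split: split_indicator)
  qed (auto simp: f_def)
  have f_cs: "f n \<in> compactly_supported E" for n
    unfolding compactly_supported_def using D f_cont[of E n] f_out[of _ n] by (auto intro!: exI[of _ D])
  have f_lim: "(\<lambda>n. f n x) \<longlonglongrightarrow> indicator C x" for x
  proof (cases "x \<in> C")
    case True
    then show ?thesis by (simp add: f_def)
  next
    case False
    then have pos: "infdist x C > 0"
      using assms(2) \<open>C \<noteq> {}\<close> by (simp add: compact_imp_closed infdist_pos_not_in_closed)
    obtain N :: nat where N: "real N > e / infdist x C" using reals_Archimedean2 by blast
    have "f n x = 0" if "n \<ge> N" for n
    proof -
      have "(real n + 1) * infdist x C > e"
      proof -
        have "e < real N * infdist x C" using N pos by (simp add: field_simps)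
        also have "\<dots> \<le> (real n + 1) * infdist x C" using that pos by (intro mult_right_mono) auto
        finally show ?thesis .
      qed
      then show ?thesis using e(1) by (auto simp: f_def max_def field_simps)
    qed
    then have "eventually (\<lambda>n. f n x = indicator C x) sequentially"
      using False by (auto simp: eventually_sequentially)
    then show ?thesis by (rule tendsto_eventually)
  qed
  have sets: "D \<in> sets (restrict_space borel E)" "C \<in> sets (restrict_space borel E)"
    using D assms by (auto simp: sets_restrict_space_iff compact_imp_closed \<open>open E\<close>)
  have lim: "(\<lambda>n. \<integral>x. f n x \<partial>\<xi>) \<longlonglongrightarrow> measure \<xi> C" and fin: "emeasure \<xi> C = ennreal (measure \<xi> C)"
    if xi: "\<xi> \<in> simple_configs E" for \<xi>
  proof -
    note [simp] = simple_configsE(4,5)[OF xi]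
    have [measurable]: "f n \<in> borel_measurable \<xi>" for n
      using borel_measurable_continuous_onI[OF f_cont[of UNIV n]]
      by (simp add: measurable_cong_sets[OF simple_configsE(5)[OF xi] refl] measurable_restrict_space1)
    have fD: "emeasure \<xi> D < \<infinity>" "emeasure \<xi> C < \<infinity>"
      using emeasure_simple_configs_compact(2)[OF xi sets(1), of D] emeasure_simple_configs_compact(2)[OF xi sets(2), of C] D assms
      by (simp_all add: less_top[symmetric])
    then show "emeasure \<xi> C = ennreal (measure \<xi> C)"
      by (simp add: emeasure_eq_ennreal_measure)
    have "(\<lambda>n. \<integral>x. f n x \<partial>\<xi>) \<longlonglongrightarrow> (\<integral>x. indicator C x \<partial>\<xi>)"
    proof (rule integral_dominated_convergence[where w = "indicator D"])
      show "integrable \<xi> (indicator D :: _ \<Rightarrow> real)"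
        using fD sets by (intro integrable_real_indicator) auto
      show "indicator C \<in> borel_measurable \<xi>"
        using sets by (intro borel_measurable_indicator) simp
    qed (use f_lim f_bd in auto)
    then show "(\<lambda>n. \<integral>x. f n x \<partial>\<xi>) \<longlonglongrightarrow> measure \<xi> C"
      using sets assms by (simp add: Int_absorb1 Int_absorb2)
  qed
  have "(\<lambda>\<xi>. measure \<xi> C) \<in> borel_measurable (config_space E)"
    using lim by (intro borel_measurable_LIMSEQ_real[OF _ measurable_config_integral[OF f_cs]]) auto
  then have "(\<lambda>\<xi>. ennreal (measure \<xi> C)) \<in> borel_measurable (config_space E)" by measurable
  then show ?thesis
    by (rule measurable_cong[THEN iffD1, rotated]) (use fin in auto)
qed simp

text \<open>Complements in the Dynkin argument need finite masses, so the count is first cut to one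
  compact \<open>C n\<close> of an exhaustion of E; a monotone limit then removes the cut.\<close>

lemma measurable_config_emeasure:
  fixes E :: "'a::euclidean_space set"
  assumes "open E" "A \<in> sets (restrict_space borel E)"
  shows "(\<lambda>\<xi>. emeasure \<xi> A) \<in> borel_measurable (config_space E)"
proof -
  obtain C :: "nat \<Rightarrow> 'a set" where C: "\<And>n. compact (C n)" "\<And>n. C n \<subseteq> E"
      "\<And>n. C n \<subseteq> interior (C (Suc n))" "\<Union>(range C) = E"
    using open_Union_compact_subsets[OF \<open>open E\<close>] by metis
  have AE: "A \<in> sets borel" "A \<subseteq> E"
    using assms by (auto simp: sets_restrict_space_iff)
  have inc: "incseq C"
    using C(3) interior_subset by (intro incseq_SucI) blast
  have Cb [measurable]: "C n \<in> sets borel" for n using C(1) by (simp add: borel_compact)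
  have sE: "B \<in> sets (restrict_space borel E)" if "B \<in> sets borel" "B \<subseteq> E" for B
    using that assms(1) by (auto simp: sets_restrict_space_iff)
  have *: "(\<lambda>\<xi>. emeasure \<xi> (B \<inter> C n)) \<in> borel_measurable (config_space E)"
    if "B \<in> sets borel" for B n
  proof -
    have "Int_stable {S :: 'a set. closed S}" "{S :: 'a set. closed S} \<subseteq> Pow UNIV"
      by (auto simp: Int_stable_def)
    moreover have "B \<in> sigma_sets UNIV {S :: 'a set. closed S}"
      using that by (simp add: borel_eq_closed)
    ultimately show ?thesis
    proof (induction B rule: sigma_sets_induct_disjoint)
      case (basic A)
      then show ?case
        using C by (intro measurable_config_emeasure_compact assms)
          (auto simp: closed_Int_compact)
    next
      case empty
      then show ?case by simp
    next
      case (compl A)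
      then have A [measurable]: "A \<in> sets borel"
        by (simp add: borel_eq_closed)
      have "emeasure \<xi> ((UNIV - A) \<inter> C n) = emeasure \<xi> (C n) - emeasure \<xi> (A \<inter> C n)"
        if xi: "\<xi> \<in> simple_configs E" for \<xi>
      proof -
        have "emeasure \<xi> (A \<inter> C n) \<noteq> \<infinity>"
          using emeasure_simple_configs_compact(2)[OF xi sE, of "A \<inter> C n" "C n"] C
          by (auto simp: le_infI2)
        moreover have "(UNIV - A) \<inter> C n = C n - (A \<inter> C n)" by auto
        ultimately show ?thesis
          using C by (simp add: simple_configsE(5)[OF xi] sE le_infI2 emeasure_Diff)
      qed
      moreover have "(\<lambda>\<xi>. emeasure \<xi> (C n) - emeasure \<xi> (A \<inter> C n)) \<in> borel_measurable (config_space E)"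
        using compl.IH measurable_config_emeasure_compact[OF assms(1) C(1,2)] by measurable
      ultimately show ?case by (subst measurable_cong) auto
    next
      case (union A)
      then have A [measurable]: "A i \<in> sets borel" for i
        using union by (auto simp: borel_eq_closed)
      have "emeasure \<xi> ((\<Union>i. A i) \<inter> C n) = (\<Sum>i. emeasure \<xi> (A i \<inter> C n))"
        if xi: "\<xi> \<in> simple_configs E" for \<xi>
      proof -
        have "(\<Union>i. A i) \<inter> C n = (\<Union>i. A i \<inter> C n)" by auto
        moreover have "disjoint_family (\<lambda>i. A i \<inter> C n)"
          using union.hyps by (auto simp: disjoint_family_on_def)
        ultimately show ?thesis
          using C by (simp add: suminf_emeasure simple_configsE(5)[OF xi] image_subset_iff sE le_infI2)
      qed
      moreover have "(\<lambda>\<xi>. (\<Sum>i. emeasure \<xi> (A i \<inter> C n))) \<in> borel_measurable (config_space E)"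
        using union.IH by measurable
      ultimately show ?case by (subst measurable_cong) auto
    qed
  qed
  have "emeasure \<xi> A = (SUP n. emeasure \<xi> (A \<inter> C n))" if xi: "\<xi> \<in> simple_configs E" for \<xi>
  proof -
    have "A = (\<Union>n. A \<inter> C n)" using C(4) AE by auto
    moreover have "incseq (\<lambda>n. A \<inter> C n)" using inc by (auto simp: incseq_def)
    moreover have "A \<inter> C n \<in> sets (restrict_space borel E)" for n
      by (intro sE) (use AE in auto)
    ultimately show ?thesis
      by (metis SUP_emeasure_incseq image_subset_iff simple_configsE(5)[OF xi])
  qed
  then show ?thesis
    using *[OF AE(1)] by (subst measurable_cong[where g = "\<lambda>\<xi>. SUP n. emeasure \<xi> (A \<inter> C n)"]) auto
qed

text \<open>Configurations may have infinite mass, so \<open>\<kappa>\<close> is only a locally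
  finite kernel: the Dynkin step on product sets is again cut to compacts and the cut removed by a
  supremum. The parameter space M will contain points already chosen, so that sums over several
  points can be iterated.\<close>

lemma nn_integral_config_measurable:
  fixes E :: "'a::euclidean_space set"
  assumes "open E" and \<kappa>: "\<kappa> \<in> measurable M (config_space E)"
    and g: "g \<in> borel_measurable (M \<Otimes>\<^sub>M restrict_space borel E)"
  shows "(\<lambda>\<omega>. \<integral>\<^sup>+x. g (\<omega>, x) \<partial>\<kappa> \<omega>) \<in> borel_measurable M"
proof -
  let ?B = "restrict_space borel E"
  obtain C :: "nat \<Rightarrow> 'a set" where C: "\<And>n. compact (C n)" "\<And>n. C n \<subseteq> E"
      "\<And>n. C n \<subseteq> interior (C (Suc n))" "\<Union>(range C) = E"
    using open_Union_compact_subsets[OF \<open>open E\<close>] by metis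
  have inc: "incseq C"
    using C(3) interior_subset by (intro incseq_SucI) blast
  have Cs [measurable]: "C n \<in> sets ?B" for n
    using C assms(1) by (auto simp: sets_restrict_space_iff borel_compact)
  have ks: "\<kappa> \<omega> \<in> simple_configs E" if "\<omega> \<in> space M" for \<omega>
    using measurable_space[OF \<kappa> that] by simp
  note ksets = simple_configsE(5)[OF ks]
  have Bsp: "space ?B = E" by (simp add: space_restrict_space)
  have em: "(\<lambda>\<omega>. emeasure (\<kappa> \<omega>) A) \<in> borel_measurable M" if "A \<in> sets ?B" for A
    using measurable_compose[OF \<kappa> measurable_config_emeasure[OF assms(1) that]] .
  have sec: "Pair \<omega> -` Q \<in> sets ?B" if "Q \<in> sets (M \<Otimes>\<^sub>M ?B)" for \<omega> Q
    using that by (rule sets_Pair1)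
  have *: "(\<lambda>\<omega>. emeasure (\<kappa> \<omega>) (Pair \<omega> -` Q \<inter> C n)) \<in> borel_measurable M"
    if "Q \<in> sets (M \<Otimes>\<^sub>M ?B)" for Q n
    using Int_stable_pair_measure_generator pair_measure_closed that[unfolded sets_pair_measure]
  proof (induction Q rule: sigma_sets_induct_disjoint)
    case (basic Q)
    then obtain a b where Q: "Q = a \<times> b" "a \<in> sets M" "b \<in> sets ?B" by auto
    have "emeasure (\<kappa> \<omega>) (Pair \<omega> -` Q \<inter> C n) = indicator a \<omega> * emeasure (\<kappa> \<omega>) (b \<inter> C n)" for \<omega>
      by (auto simp: Q split: split_indicator)
    then show ?case using Q em[of "b \<inter> C n"] by simp
  next
    case empty
    then show ?case by simp
  next
    case (compl Q)
    then have Q: "Q \<in> sets (M \<Otimes>\<^sub>M ?B)" by (simp add: sets_pair_measure)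
    have "emeasure (\<kappa> \<omega>) (Pair \<omega> -` (space M \<times> space ?B - Q) \<inter> C n) =
        emeasure (\<kappa> \<omega>) (C n) - emeasure (\<kappa> \<omega>) (Pair \<omega> -` Q \<inter> C n)" if w: "\<omega> \<in> space M" for \<omega>
    proof -
      have "emeasure (\<kappa> \<omega>) (Pair \<omega> -` Q \<inter> C n) \<noteq> \<infinity>"
        using emeasure_simple_configs_compact(2)[OF ks[OF w], of "Pair \<omega> -` Q \<inter> C n" "C n"] C sec[OF Q] by auto
      moreover have "Pair \<omega> -` (space M \<times> space ?B - Q) \<inter> C n = C n - (Pair \<omega> -` Q \<inter> C n)"
        using w C(2) by (auto simp: Bsp)
      ultimately show ?thesis
        using sec[OF Q] by (simp add: ksets[OF w] emeasure_Diff)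
    qed
    moreover have "(\<lambda>\<omega>. emeasure (\<kappa> \<omega>) (C n) - emeasure (\<kappa> \<omega>) (Pair \<omega> -` Q \<inter> C n)) \<in> borel_measurable M"
      using compl.IH em[OF Cs] by measurable
    ultimately show ?case by (subst measurable_cong) auto
  next
    case (union Q)
    then have Q: "Q i \<in> sets (M \<Otimes>\<^sub>M ?B)" for i by (auto simp: sets_pair_measure)
    have "emeasure (\<kappa> \<omega>) (Pair \<omega> -` (\<Union>i. Q i) \<inter> C n) =
        (\<Sum>i. emeasure (\<kappa> \<omega>) (Pair \<omega> -` Q i \<inter> C n))" if w: "\<omega> \<in> space M" for \<omega>
    proof -
      have "Pair \<omega> -` (\<Union>i. Q i) \<inter> C n = (\<Union>i. Pair \<omega> -` Q i \<inter> C n)" by auto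
      moreover have "disjoint_family (\<lambda>i. Pair \<omega> -` Q i \<inter> C n)"
        using union.hyps(1) by (fastforce simp: disjoint_family_on_def)
      ultimately show ?thesis
        using sec[OF Q] by (simp add: suminf_emeasure ksets[OF w] image_subset_iff)
    qed
    moreover have "(\<lambda>\<omega>. (\<Sum>i. emeasure (\<kappa> \<omega>) (Pair \<omega> -` Q i \<inter> C n))) \<in> borel_measurable M"
      using union.IH by measurable
    ultimately show ?case by (subst measurable_cong) auto
  qed
  have **: "(\<lambda>\<omega>. emeasure (\<kappa> \<omega>) (Pair \<omega> -` Q)) \<in> borel_measurable M"
    if Q: "Q \<in> sets (M \<Otimes>\<^sub>M ?B)" for Q
  proof -
    have "emeasure (\<kappa> \<omega>) (Pair \<omega> -` Q) = (SUP n. emeasure (\<kappa> \<omega>) (Pair \<omega> -` Q \<inter> C n))"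
      if w: "\<omega> \<in> space M" for \<omega>
    proof -
      have "Pair \<omega> -` Q \<subseteq> E" using sets.sets_into_space[OF sec[OF Q]] by (simp add: Bsp)
      then have "Pair \<omega> -` Q = (\<Union>n. Pair \<omega> -` Q \<inter> C n)" using C(4) by auto
      moreover have "incseq (\<lambda>n. Pair \<omega> -` Q \<inter> C n)" using inc by (auto simp: incseq_def)
      moreover have "Pair \<omega> -` Q \<inter> C n \<in> sets ?B" for n
        using sec[OF Q] by auto
      ultimately show ?thesis
        by (metis SUP_emeasure_incseq image_subset_iff ksets[OF w])
    qed
    then show ?thesis
      using *[OF Q] by (subst measurable_cong[where g = "\<lambda>\<omega>. SUP n. emeasure (\<kappa> \<omega>) (Pair \<omega> -` Q \<inter> C n)"]) auto
  qed
  have secm: "(\<lambda>x. u (\<omega>, x)) \<in> borel_measurable (\<kappa> \<omega>)"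
    if "u \<in> borel_measurable (M \<Otimes>\<^sub>M ?B)" "\<omega> \<in> space M" for u :: "'b \<times> 'a \<Rightarrow> ennreal" and \<omega>
    using that by (subst measurable_cong_sets[OF ksets refl]) auto
  show ?thesis
    using g
  proof (induction g rule: borel_measurable_induct)
    case (cong f g)
    have "(\<integral>\<^sup>+x. f (\<omega>, x) \<partial>\<kappa> \<omega>) = (\<integral>\<^sup>+x. g (\<omega>, x) \<partial>\<kappa> \<omega>)" if "\<omega> \<in> space M" for \<omega>
      using that cong(3) simple_configsE(4)[OF ks]
      by (intro nn_integral_cong) (auto simp: space_pair_measure Bsp)
    then show ?case using cong(4) by (subst measurable_cong[symmetric]) auto
  next
    case (set A)
    have "(\<integral>\<^sup>+x. indicator A (\<omega>, x) \<partial>\<kappa> \<omega>) = emeasure (\<kappa> \<omega>) (Pair \<omega> -` A)" if "\<omega> \<in> space M" for \<omega>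
    proof -
      have "(\<integral>\<^sup>+x. indicator A (\<omega>, x) \<partial>\<kappa> \<omega>) = (\<integral>\<^sup>+x. indicator (Pair \<omega> -` A) x \<partial>\<kappa> \<omega>)"
        by (simp add: indicator_def)
      then show ?thesis using sec[OF set] by (simp add: ksets[OF that])
    qed
    then show ?case using **[OF set] by (subst measurable_cong) auto
  next
    case (mult u c)
    have "(\<integral>\<^sup>+x. c * u (\<omega>, x) \<partial>\<kappa> \<omega>) = c * (\<integral>\<^sup>+x. u (\<omega>, x) \<partial>\<kappa> \<omega>)" if "\<omega> \<in> space M" for \<omega>
      using secm[OF mult(2) that] by (rule nn_integral_cmult)
    then show ?case using mult by (subst measurable_cong[where g = "\<lambda>\<omega>. c * (\<integral>\<^sup>+x. u (\<omega>, x) \<partial>\<kappa> \<omega>)"]) auto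
  next
    case (add u v)
    have "(\<integral>\<^sup>+x. v (\<omega>, x) + u (\<omega>, x) \<partial>\<kappa> \<omega>) = (\<integral>\<^sup>+x. v (\<omega>, x) \<partial>\<kappa> \<omega>) + (\<integral>\<^sup>+x. u (\<omega>, x) \<partial>\<kappa> \<omega>)"
      if "\<omega> \<in> space M" for \<omega>
      using secm[OF add(1) that] secm[OF add(3) that] by (intro nn_integral_add) auto
    then show ?case
      using add by (subst measurable_cong[where g = "\<lambda>\<omega>. (\<integral>\<^sup>+x. v (\<omega>, x) \<partial>\<kappa> \<omega>) + (\<integral>\<^sup>+x. u (\<omega>, x) \<partial>\<kappa> \<omega>)"]) auto
  next
    case (seq U)
    have "(\<integral>\<^sup>+x. (SUP i. U i) (\<omega>, x) \<partial>\<kappa> \<omega>) = (SUP i. \<integral>\<^sup>+x. U i (\<omega>, x) \<partial>\<kappa> \<omega>)"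
      if "\<omega> \<in> space M" for \<omega>
      unfolding SUP_apply
      using secm[OF seq(1) that] seq(3)
      by (intro nn_integral_monotone_convergence_SUP) (auto simp: incseq_def le_fun_def)
    then show ?case
      using seq by (subst measurable_cong[where g = "\<lambda>\<omega>. SUP i. \<integral>\<^sup>+x. U i (\<omega>, x) \<partial>\<kappa> \<omega>"]) auto
  qed
qed

section \<open>Void events generate the Borel sets of the vague topology\<close>

lemma emeasure_simple_configs_eq_0:
  fixes \<xi> :: "'a::t1_space measure"
  assumes "\<xi> \<in> simple_configs E" "A \<in> sets borel" "A \<subseteq> E"
  shows "emeasure \<xi> A = 0 \<longleftrightarrow> atoms \<xi> \<inter> A = {}"
proof -
  have "A \<in> sets (restrict_space borel E)"
    using assms unfolding sets_restrict_space by (auto intro!: image_eqI[where x = A])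
  then show ?thesis
    by (simp add: emeasure_simple_configs[OF assms(1)] emeasure_count_space_eq_0)
qed

text \<open>Test sets lie in a compact subset of E, so a configuration has finitely many points in
  each of them. The choice A = {} makes the whole space an event of the family.\<close>

definition void_events :: "'a::topological_space set \<Rightarrow> 'a measure set set" where
  "void_events E = {{\<xi> \<in> simple_configs E. emeasure \<xi> A = 0} | A.
     A \<in> sets borel \<and> (\<exists>C. compact C \<and> C \<subseteq> E \<and> A \<subseteq> C)}"

lemma void_events_subset: "void_events E \<subseteq> Pow (simple_configs E)"
  by (auto simp: void_events_def)

text \<open>Being void on A and on B is being void on A \<union> B, and this union again lies in a
  compact subset of E.\<close>

lemma Int_stable_void_events: "Int_stable (void_events (E :: 'a::t2_space set))"
proof (rule Int_stableI)
  fix a b assume "a \<in> void_events E" "b \<in> void_events E"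
  then obtain A C B D where A: "a = {\<xi> \<in> simple_configs E. emeasure \<xi> A = 0}" "A \<in> sets borel"
      "compact C" "C \<subseteq> E" "A \<subseteq> C"
    and B: "b = {\<xi> \<in> simple_configs E. emeasure \<xi> B = 0}" "B \<in> sets borel"
      "compact D" "D \<subseteq> E" "B \<subseteq> D"
    unfolding void_events_def by blast
  have "emeasure \<xi> (A \<union> B) = 0 \<longleftrightarrow> emeasure \<xi> A = 0 \<and> emeasure \<xi> B = 0"
    if xi: "\<xi> \<in> simple_configs E" for \<xi>
    using A B by (simp add: emeasure_simple_configs_eq_0[OF xi] subset_trans[OF A(5,4)] subset_trans[OF B(5,4)] Int_Un_distrib)
  then have "a \<inter> b = {\<xi> \<in> simple_configs E. emeasure \<xi> (A \<union> B) = 0}"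
    using A(1) B(1) by auto
  moreover have "compact (C \<union> D)" "C \<union> D \<subseteq> E" "A \<union> B \<subseteq> C \<union> D"
    using A B by auto
  ultimately show "a \<inter> b \<in> void_events E"
    using A(2) B(2) unfolding void_events_def by blast
qed

text \<open>The cells are disjointed balls around a dense sequence. Once finitely many balls cover a
  compact C, every later cell has those balls removed and therefore misses C.\<close>

lemma small_cells:
  fixes d :: real
  assumes "d > 0"
  obtains D :: "nat \<Rightarrow> 'a::euclidean_space set" where
    "\<And>j. D j \<in> sets borel" "disjoint_family D" "(\<Union>j. D j) = UNIV"
    "\<And>j x y. x \<in> D j \<Longrightarrow> y \<in> D j \<Longrightarrow> dist x y < d"
    "\<And>C. compact C \<Longrightarrow> \<exists>J. \<forall>j\<ge>J. C \<inter> D j = {}"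
proof -
  obtain Q :: "'a set" where Q: "countable Q" "\<And>X. open X \<Longrightarrow> X \<noteq> {} \<Longrightarrow> \<exists>q\<in>Q. q \<in> X"
    using countable_dense_setE by blast
  then have ne: "Q \<noteq> {}" using open_UNIV by blast
  define q where "q = from_nat_into Q"
  have rq: "range q = Q" using range_from_nat_into[OF ne Q(1)] by (simp add: q_def)
  define B where "B j = ball (q j) (d / 2)" for j
  have cov: "\<exists>j. x \<in> B j" for x
  proof -
    obtain p where "p \<in> Q" "p \<in> ball x (d/2)" using Q(2)[of "ball x (d/2)"] assms by auto
    then show ?thesis using rq by (auto simp: B_def dist_commute)
  qed
  show thesis
  proof (rule that[of "disjointed B"])
    show "disjointed B j \<in> sets borel" for j
    proof -
      have "range B \<subseteq> sets borel" by (auto simp: B_def)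
      then show ?thesis using sets.range_disjointed_sets by blast
    qed
    show "disjoint_family (disjointed B)" by (rule disjoint_family_disjointed)
    show "(\<Union>j. disjointed B j) = UNIV" using cov by (auto simp: UN_disjointed_eq)
    show "dist x y < d" if "x \<in> disjointed B j" "y \<in> disjointed B j" for j x y
    proof -
      have "dist (q j) x < d / 2" "dist (q j) y < d / 2"
        using that disjointed_subset[of B j] by (auto simp: B_def)
      then show ?thesis by (metis dist_commute dist_triangle_half_r)
    qed
    show "\<exists>J. \<forall>j\<ge>J. C \<inter> disjointed B j = {}" if cC: "compact C" for C
    proof -
      have "C \<subseteq> (\<Union>j\<in>UNIV. B j)" using cov by auto
      then obtain F where F: "finite F" "C \<subseteq> (\<Union>j\<in>F. B j)"
        using compactE_image[OF cC, of UNIV B] by (auto simp: B_def)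
      obtain J where J: "\<And>j. j \<in> F \<Longrightarrow> j < J" using F(1) by (meson finite_nat_set_iff_bounded)
      have "C \<inter> disjointed B j = {}" if "j \<ge> J" for j
        using F(2) J that by (fastforce simp: disjointed_def)
      then show ?thesis by blast
    qed
  qed
qed

text \<open>Counts are recovered from emptiness alone: \<open>c n\<close> is the number of occupied
  cells at mesh 1 / (n + 1). It never exceeds the count and equals it once the mesh is below the
  smallest distance between two points. That threshold depends on the configuration, hence the
  supremum over n.\<close>

lemma emeasure_measurable_void_events:
  fixes E :: "'a::euclidean_space set"
  assumes "open E" "A \<in> sets borel" "A \<subseteq> C" "compact C" "C \<subseteq> E"
  shows "(\<lambda>\<xi>. emeasure \<xi> A) \<in> borel_measurable (sigma (simple_configs E) (void_events E))"
    (is "_ \<in> borel_measurable ?\<Sigma>")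
proof -
  have "\<forall>n. \<exists>D :: nat \<Rightarrow> 'a set. (\<forall>j. D j \<in> sets borel) \<and> disjoint_family D \<and> (\<Union>j. D j) = UNIV \<and>
      (\<forall>j x y. x \<in> D j \<longrightarrow> y \<in> D j \<longrightarrow> dist x y < inverse (real (Suc n)))"
    using small_cells[of "inverse (real (Suc n))" for n] by (metis inverse_positive_iff_positive of_nat_0_less_iff zero_less_Suc)
  then obtain D :: "nat \<Rightarrow> nat \<Rightarrow> 'a set" where D: "\<And>n j. D n j \<in> sets borel" "\<And>n. disjoint_family (D n)"
      "\<And>n. (\<Union>j. D n j) = UNIV"
      "\<And>n j x y. x \<in> D n j \<Longrightarrow> y \<in> D n j \<Longrightarrow> dist x y < inverse (real (Suc n))"
    by metis
  have sE: "A \<inter> D n j \<in> sets (restrict_space borel E)" "A \<in> sets (restrict_space borel E)" for n j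
    using assms D(1)[of n j] by (auto simp: sets_restrict_space_iff)
  have "{\<xi> \<in> simple_configs E. emeasure \<xi> (A \<inter> D n j) = 0} \<in> void_events E" for n j
    unfolding void_events_def using assms D(1)[of n j] by blast
  then have "{\<xi> \<in> simple_configs E. emeasure \<xi> (A \<inter> D n j) = 0} \<in> sets ?\<Sigma>" for n j
    by (simp add: sets_measure_of[OF void_events_subset] sigma_sets.Basic)
  moreover have "{\<xi> \<in> space ?\<Sigma>. emeasure \<xi> (A \<inter> D n j) = 0} = {\<xi> \<in> simple_configs E. emeasure \<xi> (A \<inter> D n j) = 0}" for n j
    by (simp add: space_measure_of[OF void_events_subset])
  ultimately have [measurable]: "Measurable.pred ?\<Sigma> (\<lambda>\<xi>. emeasure \<xi> (A \<inter> D n j) = 0)" for n j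
    by (simp add: pred_def)
  define c where "c n \<xi> = (\<Sum>j. if emeasure \<xi> (A \<inter> D n j) = 0 then 0 else 1 :: ennreal)" for n and \<xi> :: "'a measure"
  have "emeasure \<xi> A = (SUP n. c n \<xi>)" if xi: "\<xi> \<in> simple_configs E" for \<xi>
  proof -
    define S where "S = atoms \<xi> \<inter> A"
    have fS: "finite S"
      using emeasure_simple_configs_compact(1)[OF xi sE(2) assms(3-5)] by (simp add: S_def)
    have card: "emeasure \<xi> (A \<inter> D n j) = of_nat (card (S \<inter> D n j))" for n j
      using emeasure_simple_configs_compact(2)[OF xi sE(1)[of n j], of C] assms
      by (auto simp: S_def Int_assoc)
    have sum: "emeasure \<xi> A = (\<Sum>j. emeasure \<xi> (A \<inter> D n j))" for n
    proof -
      have "A = (\<Union>j. A \<inter> D n j)" using D(3)[of n] by auto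
      moreover have "disjoint_family (\<lambda>j. A \<inter> D n j)" using D(2)[of n] by (auto simp: disjoint_family_on_def)
      moreover have "range (\<lambda>j. A \<inter> D n j) \<subseteq> sets \<xi>"
        using sE(1)[of n] by (simp add: image_subset_iff simple_configsE(5)[OF xi])
      ultimately show ?thesis
        using suminf_emeasure[of "\<lambda>j. A \<inter> D n j" \<xi>] by presburger
    qed
    have le: "c n \<xi> \<le> emeasure \<xi> A" for n
      unfolding sum[of n] c_def
    proof (intro suminf_le)
      fix j
      show "(if emeasure \<xi> (A \<inter> D n j) = 0 then 0 else 1) \<le> emeasure \<xi> (A \<inter> D n j)"
        by (cases "card (S \<inter> D n j)") (auto simp: card)
    qed auto
    \<comment> \<open>The inserted 1 keeps \<open>Min\<close> away from the empty set when there is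
      at most one point.\<close>
    define e where "e = Min (insert 1 ((\<lambda>(x, y). dist x y) ` {p \<in> S \<times> S. fst p \<noteq> snd p}))"
    have fin: "finite (insert 1 ((\<lambda>(x, y). dist x y) ` {p \<in> S \<times> S. fst p \<noteq> snd p}))"
      using fS by (intro finite.insertI finite_imageI) (auto intro: finite_subset[of _ "S \<times> S"])
    have e: "e > 0" "\<And>x y. x \<in> S \<Longrightarrow> y \<in> S \<Longrightarrow> x \<noteq> y \<Longrightarrow> e \<le> dist x y"
      unfolding e_def using fin by (auto simp: Min_gr_iff intro!: Min_le)
    obtain n where n: "inverse (real (Suc n)) < e" using reals_Archimedean[OF e(1)] by blast
    have "card (S \<inter> D n j) \<le> 1" for j
    proof -
      have "x = y" if "x \<in> S \<inter> D n j" "y \<in> S \<inter> D n j" for x y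
        using that e(2)[of x y] D(4)[of x n j y] n by force
      then show ?thesis by (metis One_nat_def card_le_Suc0_iff_eq finite_Int fS)
    qed
    then have "emeasure \<xi> (A \<inter> D n j) = (if emeasure \<xi> (A \<inter> D n j) = 0 then 0 else 1)" for j
      unfolding card by (metis One_nat_def le_Suc_eq le_zero_eq of_nat_0 of_nat_1)
    then have "c n \<xi> = emeasure \<xi> A"
      unfolding sum[of n] c_def by (intro arg_cong[where f = suminf]) (auto simp: fun_eq_iff)
    then show ?thesis
      by (intro antisym SUP_least le) (metis SUP_upper UNIV_I)
  qed
  moreover have "(\<lambda>\<xi>. SUP n. c n \<xi>) \<in> borel_measurable ?\<Sigma>"
    unfolding c_def by measurable
  ultimately show ?thesis
    by (subst measurable_cong) (auto simp: space_measure_of[OF void_events_subset])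
qed

lemma integral_simple_configs:
  fixes \<xi> :: "'a::t1_space measure" and f :: "'a \<Rightarrow> real"
  assumes "\<xi> \<in> simple_configs E" "f \<in> borel_measurable (restrict_space borel E)"
    "compact C" "C \<subseteq> E" "\<And>x. x \<in> E - C \<Longrightarrow> f x = 0"
  shows "(\<integral>x. f x \<partial>\<xi>) = (\<Sum>x\<in>atoms \<xi> \<inter> C. f x)"
proof -
  note S = simple_configsE[OF assms(1)]
  have fin: "finite (atoms \<xi> \<inter> C)" using S(3) assms(3,4) by blast
  have sub: "{a \<in> atoms \<xi>. f a \<noteq> 0} \<subseteq> atoms \<xi> \<inter> C"
    using S(1) assms(5) by blast
  have "(\<integral>x. f x \<partial>\<xi>) = (\<integral>x. f x \<partial>count_space (atoms \<xi>))"
    by (metis S(1,2) assms(2) integral_point_measure_on)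
  also have "\<dots> = (\<Sum>a | a \<in> atoms \<xi> \<and> f a \<noteq> 0. f a)"
    by (rule lebesgue_integral_count_space_finite_support) (rule finite_subset[OF sub fin])
  also have "\<dots> = (\<Sum>x\<in>atoms \<xi> \<inter> C. f x)"
    using fin sub by (intro sum.mono_neutral_left) auto
  finally show ?thesis .
qed

text \<open>Vaguely open sets are arbitrary unions of basic ones, and a sigma-algebra reaches them
  only through a countable base. The sets \<open>V F\<close>, which prescribe finitely many cell
  counts, are countably many because \<open>F\<close> is a finite set of tuples of natural numbers.
  They refine every open set, since prescribed counts on fine cells determine the integral of f up
  to the oscillation of f on a cell.\<close>

lemma openin_vague_void_events:
  fixes E :: "'a::euclidean_space set"
  assumes "open E" "openin (vague_topology E) U"
  shows "U \<in> sigma_sets (simple_configs E) (void_events E)"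
proof -
  let ?\<Sigma> = "sigma (simple_configs E) (void_events E)"
  obtain C :: "nat \<Rightarrow> 'a set" where C: "\<And>n. compact (C n)" "\<And>n. C n \<subseteq> E"
      "\<And>K. compact K \<Longrightarrow> K \<subseteq> E \<Longrightarrow> \<exists>N. \<forall>n\<ge>N. K \<subseteq> C n"
    using open_Union_compact_subsets[OF \<open>open E\<close>] by metis
  have "\<forall>n. \<exists>D :: nat \<Rightarrow> 'a set. (\<forall>j. D j \<in> sets borel) \<and> disjoint_family D \<and> (\<Union>j. D j) = UNIV \<and>
      (\<forall>j x y. x \<in> D j \<longrightarrow> y \<in> D j \<longrightarrow> dist x y < inverse (real (Suc n))) \<and>
      (\<forall>C. compact C \<longrightarrow> (\<exists>J. \<forall>j\<ge>J. C \<inter> D j = {}))"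
    using small_cells[of "inverse (real (Suc n))" for n] by (metis inverse_positive_iff_positive of_nat_0_less_iff zero_less_Suc)
  then obtain D :: "nat \<Rightarrow> nat \<Rightarrow> 'a set" where D: "\<And>n j. D n j \<in> sets borel" "\<And>n. disjoint_family (D n)"
      "\<And>n. (\<Union>j. D n j) = UNIV"
      "\<And>n j x y. x \<in> D n j \<Longrightarrow> y \<in> D n j \<Longrightarrow> dist x y < inverse (real (Suc n))"
      "\<And>n C. compact C \<Longrightarrow> \<exists>J. \<forall>j\<ge>J. C \<inter> D n j = {}"
    by metis
  have cell: "C m \<inter> D n j \<in> sets borel" for m n j
    using C(1) D(1) by (auto simp: borel_compact)
  define V where "V F = {\<xi> \<in> simple_configs E. \<forall>(m, n, j, k)\<in>F. emeasure \<xi> (C m \<inter> D n j) = of_nat k}"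
    for F :: "(nat \<times> nat \<times> nat \<times> nat) set"
  have Vset: "V F \<in> sets ?\<Sigma>" if "finite F" for F
  proof -
    have em [measurable]: "(\<lambda>\<xi>. emeasure \<xi> (C m \<inter> D n j)) \<in> borel_measurable ?\<Sigma>" for m n j
      using emeasure_measurable_void_events[OF assms(1) cell, of m n j "C m"] C by auto
    have "{\<xi> \<in> space ?\<Sigma>. \<forall>p\<in>F. (case p of (m, n, j, k) \<Rightarrow> emeasure \<xi> (C m \<inter> D n j) = of_nat k)} \<in> sets ?\<Sigma>"
      using that by (intro sets.sets_Collect_finite_All) (auto split: prod.splits)
    also have "{\<xi> \<in> space ?\<Sigma>. \<forall>p\<in>F. (case p of (m, n, j, k) \<Rightarrow> emeasure \<xi> (C m \<inter> D n j) = of_nat k)} = V F"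
      by (auto simp: V_def space_measure_of[OF void_events_subset])
    finally show ?thesis .
  qed
  have basic: "\<exists>F. finite F \<and> \<mu> \<in> V F \<and> V F \<subseteq> {\<mu> \<in> simple_configs E. (\<integral>x. f x \<partial>\<mu>) \<in> W}"
    if f: "f \<in> compactly_supported E" and W: "open W" and mu: "\<mu> \<in> simple_configs E" "(\<integral>x. f x \<partial>\<mu>) \<in> W"
    for f and W :: "real set" and \<mu>
  proof -
    from f obtain K where K: "continuous_on E f" "compact K" "K \<subseteq> E" "\<And>x. x \<in> E - K \<Longrightarrow> f x = 0"
      unfolding compactly_supported_def by blast
    obtain m where m: "K \<subseteq> C m" using C(3)[OF K(2,3)] by blast
    obtain e where e: "e > 0" "ball (\<integral>x. f x \<partial>\<mu>) e \<subseteq> W" using W mu(2) openE by blast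
    \<comment> \<open>Both \<mu> and any \<xi> in \<open>V F\<close> differ from the common Riemann
      sum by at most e' times the number of points in \<open>C m\<close>, so their integrals differ
      by less than e. The + 1 covers the case of no points.\<close>
    define e' where "e' = e / (2 * (real (card (atoms \<mu> \<inter> C m)) + 1))"
    have e': "e' > 0" using e(1) by (simp add: e'_def add_nonneg_pos)
    have "uniformly_continuous_on (C m) f"
      using K(1) C by (intro compact_uniformly_continuous) (auto intro: continuous_on_subset)
    then obtain d where d: "d > 0" "\<And>x y. x \<in> C m \<Longrightarrow> y \<in> C m \<Longrightarrow> dist x y < d \<Longrightarrow> dist (f x) (f y) < e'"
      using e' unfolding uniformly_continuous_on_def by metis
    obtain n where n: "inverse (real (Suc n)) < d" using reals_Archimedean[OF d(1)] by blast
    obtain J where J: "\<And>j. j \<ge> J \<Longrightarrow> C m \<inter> D n j = {}" using D(5)[OF C(1)] by metis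
    define N where "N j = card (atoms \<mu> \<inter> (C m \<inter> D n j))" for j
    \<comment> \<open>Arbitrary if the cell is empty; it is compared with f x only for an atom x in
      the cell, and otherwise its coefficient \<open>N j\<close> is 0.\<close>
    define p where "p j = (SOME x. x \<in> C m \<inter> D n j)" for j
    define F where "F = (\<lambda>j. (m, n, j, N j)) ` {..<J}"
    have fin: "finite (atoms \<xi> \<inter> (C m \<inter> D n j))"
      and card: "emeasure \<xi> (C m \<inter> D n j) = of_nat (card (atoms \<xi> \<inter> (C m \<inter> D n j)))"
      if "\<xi> \<in> simple_configs E" for \<xi> j
      using emeasure_simple_configs_compact[OF that, of "C m \<inter> D n j" "C m"] C cell[of m n j] assms(1)
      by (auto simp: sets_restrict_space_iff)
    have fm: "f \<in> borel_measurable (restrict_space borel E)"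
      using K(1) by (rule borel_measurable_continuous_on_restrict)
    have part: "atoms \<xi> \<inter> C m = (\<Union>j<J. atoms \<xi> \<inter> (C m \<inter> D n j))" for \<xi> :: "'a measure"
    proof -
      have "x \<in> (\<Union>j<J. D n j)" if "x \<in> C m" for x
      proof -
        obtain j where j: "x \<in> D n j" using D(3)[of n] by blast
        then have "j < J" using J[of j] that by (meson disjoint_iff not_less)
        then show ?thesis using j by blast
      qed
      then show ?thesis by blast
    qed
    have disj: "(atoms \<xi> \<inter> (C m \<inter> D n i)) \<inter> (atoms \<xi> \<inter> (C m \<inter> D n j)) = {}" if "i \<noteq> j" for \<xi> i j
      using D(2)[of n] that by (auto simp: disjoint_family_on_def)
    have approx: "\<bar>(\<integral>x. f x \<partial>\<xi>) - (\<Sum>j<J. real (N j) * f (p j))\<bar> \<le> e' * (\<Sum>j<J. real (N j))"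
      if xi: "\<xi> \<in> V F" for \<xi>
    proof -
      have xs: "\<xi> \<in> simple_configs E" using xi by (simp add: V_def)
      have cN: "card (atoms \<xi> \<inter> (C m \<inter> D n j)) = N j" if "j < J" for j
        using xi that card[OF xs, of j] by (auto simp: V_def F_def)
      have "(\<integral>x. f x \<partial>\<xi>) = (\<Sum>x\<in>atoms \<xi> \<inter> C m. f x)"
        using K m C by (intro integral_simple_configs[OF xs fm]) auto
      also have "\<dots> = (\<Sum>j<J. \<Sum>x\<in>atoms \<xi> \<inter> (C m \<inter> D n j). f x)"
        unfolding part using fin[OF xs] disj by (intro sum.UNION_disjoint) auto
      finally have "\<bar>(\<integral>x. f x \<partial>\<xi>) - (\<Sum>j<J. real (N j) * f (p j))\<bar> =
          \<bar>\<Sum>j<J. \<Sum>x\<in>atoms \<xi> \<inter> (C m \<inter> D n j). f x - f (p j)\<bar>"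
        by (simp add: sum_subtractf cN)
      also have "\<dots> \<le> (\<Sum>j<J. \<Sum>x\<in>atoms \<xi> \<inter> (C m \<inter> D n j). \<bar>f x - f (p j)\<bar>)"
        by (rule order_trans[OF sum_abs], rule sum_mono, rule sum_abs)
      also have "\<dots> \<le> (\<Sum>j<J. \<Sum>x\<in>atoms \<xi> \<inter> (C m \<inter> D n j). e')"
      proof (intro sum_mono)
        fix j x assume x: "x \<in> atoms \<xi> \<inter> (C m \<inter> D n j)"
        then have "p j \<in> C m \<inter> D n j" unfolding p_def by (metis IntD2 someI)
        then show "\<bar>f x - f (p j)\<bar> \<le> e'"
          using x d(2)[of x "p j"] D(4)[of x n j "p j"] n by (auto simp: dist_real_def)
      qed
      also have "\<dots> = e' * (\<Sum>j<J. real (N j))"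
        by (simp add: cN sum_distrib_left mult.commute)
      finally show ?thesis .
    qed
    have muV: "\<mu> \<in> V F"
      using mu(1) card[OF mu(1)] by (auto simp: V_def F_def N_def)
    have "(\<integral>x. f x \<partial>\<xi>) \<in> W" if xi: "\<xi> \<in> V F" for \<xi>
    proof -
      have "card (atoms \<mu> \<inter> C m) = (\<Sum>j<J. N j)"
        unfolding part N_def using fin[OF mu(1)] disj by (intro card_UN_disjoint) auto
      then have "2 * (e' * (\<Sum>j<J. real (N j))) < e"
        using e(1) by (simp add: e'_def field_simps flip: of_nat_sum)
      then have "\<bar>(\<integral>x. f x \<partial>\<mu>) - (\<integral>x. f x \<partial>\<xi>)\<bar> < e"
        using approx[OF xi] approx[OF muV] by linarith
      then show ?thesis using e(2) by (auto simp: dist_real_def)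
    qed
    moreover have "finite F" by (simp add: F_def)
    moreover have "V F \<subseteq> simple_configs E" by (auto simp: V_def)
    ultimately show ?thesis using muV by blast
  qed
  have "generate_topology_on {{\<mu> \<in> simple_configs E. (\<integral>x. f x \<partial>\<mu>) \<in> U} | f U. f \<in> compactly_supported E \<and> open U} U"
    using assms(2) by (simp add: vague_topology_def openin_topology_generated_by_iff)
  then have *: "\<forall>\<mu>\<in>U. \<exists>F. finite F \<and> \<mu> \<in> V F \<and> V F \<subseteq> U"
  proof induction
    case (Int a b)
    show ?case
    proof
      fix \<mu> assume "\<mu> \<in> a \<inter> b"
      then obtain F G where "finite F" "\<mu> \<in> V F" "V F \<subseteq> a" "finite G" "\<mu> \<in> V G" "V G \<subseteq> b"
        using Int.IH by blast
      moreover have "V (F \<union> G) = V F \<inter> V G" unfolding V_def ball_Un by blast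
      ultimately show "\<exists>F. finite F \<and> \<mu> \<in> V F \<and> V F \<subseteq> a \<inter> b" by (intro exI[of _ "F \<union> G"]) auto
    qed
  next
    case (UN K)
    show ?case
    proof
      fix \<mu> assume "\<mu> \<in> \<Union>K"
      then obtain k where k: "k \<in> K" "\<mu> \<in> k" by (rule UnionE)
      then obtain F where "finite F" "\<mu> \<in> V F" "V F \<subseteq> k" using UN.IH by metis
      then show "\<exists>F. finite F \<and> \<mu> \<in> V F \<and> V F \<subseteq> \<Union>K"
        using Union_upper[OF k(1)] by (intro exI[of _ F]) auto
    qed
  next
    case (Basis s)
    then obtain f W where "s = {\<mu> \<in> simple_configs E. (\<integral>x. f x \<partial>\<mu>) \<in> W}" "f \<in> compactly_supported E" "open W"
      by auto
    then show ?case using basic[of f W] by simp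
  qed simp
  have "U = (\<Union>F\<in>{F. finite F \<and> V F \<subseteq> U}. V F)"
    using * by blast
  also have "\<dots> \<in> sets ?\<Sigma>"
  proof (rule sets.countable_UN')
    show "countable {F. finite F \<and> V F \<subseteq> U}"
      by (rule countable_subset[OF _ countable_Collect_finite]) blast
  qed (use Vset in auto)
  finally show ?thesis by (simp add: sets_measure_of[OF void_events_subset])
qed

text \<open>This is the measurable form of Renyi's theorem that void probabilities determine a
  simple point process. It lets laws be compared, and maps into \<open>config_space E\<close> be
  tested, on void events only.\<close>

theorem sets_config_space_void_events:
  fixes E :: "'a::euclidean_space set"
  assumes "open E"
  shows "sets (config_space E) = sigma_sets (simple_configs E) (void_events E)"
proof
  show "sets (config_space E) \<subseteq> sigma_sets (simple_configs E) (void_events E)"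
    unfolding sets_config_space
    using openin_vague_void_events[OF assms] by (intro sigma_sets_mono) auto
  have "void_events E \<subseteq> sets (config_space E)"
  proof
    fix a assume "a \<in> void_events E"
    then obtain A where A: "a = {\<xi> \<in> simple_configs E. emeasure \<xi> A = 0}" "A \<in> sets borel" "A \<subseteq> E"
      unfolding void_events_def by blast
    then have "(\<lambda>\<xi>. emeasure \<xi> A) \<in> borel_measurable (config_space E)"
      using assms by (intro measurable_config_emeasure) (auto simp: sets_restrict_space_iff)
    then have "{\<xi> \<in> space (config_space E). emeasure \<xi> A = 0} \<in> sets (config_space E)"
      by measurable
    then show "a \<in> sets (config_space E)" using A by simp
  qed
  then show "sigma_sets (simple_configs E) (void_events E) \<subseteq> sets (config_space E)"
    using sets.sigma_sets_subset[of "void_events E" "config_space E"] by simp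
qed

section \<open>Measurability of sums over tuples of atoms\<close>

lemma nn_integral_PiE_Suc:
  fixes S :: "'a::euclidean_space set" and f :: "(nat \<Rightarrow> 'a) \<Rightarrow> ennreal"
  assumes "countable S"
  shows "(\<integral>\<^sup>+z. f z \<partial>count_space (PiE {..<Suc k} (\<lambda>_. S))) =
    (\<integral>\<^sup>+z. (\<integral>\<^sup>+a. f (z(k := a)) \<partial>count_space S) \<partial>count_space (PiE {..<k} (\<lambda>_. S)))"
proof -
  have bij: "bij_betw (\<lambda>(z, a). z(k := a)) (PiE {..<k} (\<lambda>_. S) \<times> S) (PiE {..<Suc k} (\<lambda>_. S))"
    unfolding bij_betw_def
  proof
    show "inj_on (\<lambda>(z, a). z(k := a)) (PiE {..<k} (\<lambda>_. S) \<times> S)"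
    proof (rule inj_onI, clarify)
      fix z a z' a'
      assume "z \<in> PiE {..<k} (\<lambda>_. S)" "a \<in> S" "z' \<in> PiE {..<k} (\<lambda>_. S)" "a' \<in> S" "z(k := a) = z'(k := a')"
      then show "z = z' \<and> a = a'"
        using inj_onD[OF inj_combinator[of k "{..<k}" "\<lambda>_. S"], of "(a, z)" "(a', z')"] by simp
    qed
    have "PiE {..<Suc k} (\<lambda>_. S) = (\<lambda>(a, z). z(k := a)) ` (S \<times> PiE {..<k} (\<lambda>_. S))"
      unfolding lessThan_Suc by (rule PiE_insert_eq)
    then show "(\<lambda>(z, a). z(k := a)) ` (PiE {..<k} (\<lambda>_. S) \<times> S) = PiE {..<Suc k} (\<lambda>_. S)"
      by (auto simp: image_iff)
  qed
  have "(\<integral>\<^sup>+z. f z \<partial>count_space (PiE {..<Suc k} (\<lambda>_. S))) =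
      (\<integral>\<^sup>+p. f (case p of (z, a) \<Rightarrow> z(k := a)) \<partial>count_space (PiE {..<k} (\<lambda>_. S) \<times> S))"
    by (rule nn_integral_bij_count_space[OF bij, symmetric])
  also have "\<dots> = (\<integral>\<^sup>+p. f (case p of (z, a) \<Rightarrow> z(k := a)) \<partial>(count_space (PiE {..<k} (\<lambda>_. S)) \<Otimes>\<^sub>M count_space S))"
    using assms by (subst pair_measure_countable) (auto intro: countable_PiE)
  also have "\<dots> = (\<integral>\<^sup>+z. (\<integral>\<^sup>+a. f (z(k := a)) \<partial>count_space S) \<partial>count_space (PiE {..<k} (\<lambda>_. S)))"
    using assms by (subst sigma_finite_measure.nn_integral_fst[symmetric])
      (auto simp: pair_measure_countable countable_PiE sigma_finite_measure_count_space_countable)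
  finally show ?thesis .
qed

text \<open>Peeling off the last coordinate leaves a sum over shorter tuples of an integral against
  \<xi>, in which \<xi> and the earlier points are parameters. The induction therefore has to admit
  integrands that depend on \<xi> as well as on the tuple.\<close>

lemma measurable_tuple_sum:
  fixes E :: "'a::euclidean_space set" and f :: "'a measure \<times> (nat \<Rightarrow> 'a) \<Rightarrow> ennreal"
  assumes "open E" "f \<in> borel_measurable (config_space E \<Otimes>\<^sub>M PiM {..<k} (\<lambda>_. restrict_space borel E))"
  shows "(\<lambda>\<xi>. \<integral>\<^sup>+z. f (\<xi>, z) \<partial>count_space (PiE {..<k} (\<lambda>_. atoms \<xi>))) \<in> borel_measurable (config_space E)"
  using assms(2)
proof (induction k arbitrary: f)
  case 0
  have "(\<lambda>\<xi>. f (\<xi>, \<lambda>x. undefined)) \<in> borel_measurable (config_space E)"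
    by (rule measurable_compose[OF _ 0]) (auto intro!: measurable_Pair simp: space_PiM)
  then show ?case by (simp add: nn_integral_count_space_finite)
next
  case (Suc k)
  let ?B = "restrict_space borel E"
  let ?M = "config_space E \<Otimes>\<^sub>M PiM {..<k} (\<lambda>_. ?B)"
  define g where "g = (\<lambda>\<omega>. \<integral>\<^sup>+a. f (fst \<omega>, (snd \<omega>)(k := a)) \<partial>fst \<omega>)"
  have fm: "(\<lambda>p. f (fst (fst p), (snd (fst p))(k := snd p))) \<in> borel_measurable (?M \<Otimes>\<^sub>M ?B)"
  proof (rule measurable_compose[OF _ Suc.prems])
    have "(\<lambda>p. (snd (fst p))(k := snd p)) \<in> measurable (?M \<Otimes>\<^sub>M ?B) (PiM (insert k {..<k}) (\<lambda>_. ?B))"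
      by measurable
    then show "(\<lambda>p. (fst (fst p), (snd (fst p))(k := snd p))) \<in>
        measurable (?M \<Otimes>\<^sub>M ?B) (config_space E \<Otimes>\<^sub>M PiM {..<Suc k} (\<lambda>_. ?B))"
      unfolding lessThan_Suc by (intro measurable_Pair) auto
  qed
  have "g \<in> borel_measurable ?M"
    unfolding g_def using nn_integral_config_measurable[OF assms(1) measurable_fst fm] by simp
  from Suc.IH[OF this]
  have "(\<lambda>\<xi>. \<integral>\<^sup>+z. g (\<xi>, z) \<partial>count_space (PiE {..<k} (\<lambda>_. atoms \<xi>))) \<in> borel_measurable (config_space E)" .
  moreover have "(\<integral>\<^sup>+z. g (\<xi>, z) \<partial>count_space (PiE {..<k} (\<lambda>_. atoms \<xi>))) =
      (\<integral>\<^sup>+z. f (\<xi>, z) \<partial>count_space (PiE {..<Suc k} (\<lambda>_. atoms \<xi>)))" if xi: "\<xi> \<in> simple_configs E" for \<xi>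
  proof -
    have "g (\<xi>, z) = (\<integral>\<^sup>+a. f (\<xi>, z(k := a)) \<partial>count_space (atoms \<xi>))" if z: "z \<in> PiE {..<k} (\<lambda>_. atoms \<xi>)" for z
    proof -
      have "(\<xi>, z) \<in> space ?M"
        using xi z simple_configsE(1)[OF xi] by (auto simp: space_pair_measure space_PiM PiE_iff space_restrict_space)
      then have "(\<lambda>a. f (\<xi>, z(k := a))) \<in> borel_measurable ?B"
        using measurable_compose[OF measurable_Pair1' fm, of "(\<xi>, z)"] by simp
      then show ?thesis
        unfolding g_def by (simp add: nn_integral_simple_configs[OF xi])
    qed
    then show ?thesis
      by (subst nn_integral_PiE_Suc[OF countable_atoms[OF xi assms(1)]]) (auto intro!: nn_integral_cong)
  qed
  ultimately show ?case
    by (rule measurable_cong[THEN iffD1, rotated]) simp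
qed

section \<open>Positive semidefinite kernels\<close>

text \<open>Membership in the nonnegative reals includes being real. Over the complex numbers this
  forces Hermitian symmetry, which is therefore a lemma and not a clause.\<close>

definition psd_kernel_on :: "complex set \<Rightarrow> (complex \<Rightarrow> complex \<Rightarrow> complex) \<Rightarrow> bool" where
  "psd_kernel_on D K \<longleftrightarrow> (\<forall>(n::nat) z c. (\<forall>i<n. z i \<in> D) \<longrightarrow>
     (\<Sum>i<n. \<Sum>j<n. cnj (c i) * K (z i) (z j) * c j) \<in> \<real>\<^sub>\<ge>\<^sub>0)"

lemma psd_kernel_onD:
  fixes n :: nat
  shows "psd_kernel_on D K \<Longrightarrow> (\<And>i. i < n \<Longrightarrow> z i \<in> D) \<Longrightarrow>
    (\<Sum>i<n. \<Sum>j<n. cnj (c i) * K (z i) (z j) * c j) \<in> \<real>\<^sub>\<ge>\<^sub>0"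
  unfolding psd_kernel_on_def by blast

lemma psd_kernel_on_diag:
  assumes "psd_kernel_on D K" "a \<in> D"
  shows "K a a \<in> \<real>\<^sub>\<ge>\<^sub>0"
  using psd_kernel_onD[OF assms(1), of "Suc 0" "\<lambda>_. a" "\<lambda>_. 1"] assms(2) by simp

lemma psd_kernel_on_pair:
  assumes "psd_kernel_on D K" "a \<in> D" "b \<in> D"
  shows "cnj c * K a a * c + cnj c * K a b * d + (cnj d * K b a * c + cnj d * K b b * d) \<in> \<real>\<^sub>\<ge>\<^sub>0"
  using psd_kernel_onD[OF assms(1), of "Suc (Suc 0)" "\<lambda>i. if i = 0 then a else b" "\<lambda>i. if i = 0 then c else d"] assms(2,3)
  by (simp add: numeral_2_eq_2 add.assoc)

text \<open>Polarization: the form is real at the coefficients (1, 1), which compares imaginary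
  parts, and at (1, i), which compares real parts.\<close>

lemma psd_kernel_on_hermitian:
  assumes "psd_kernel_on D K" "a \<in> D" "b \<in> D"
  shows "K b a = cnj (K a b)"
proof -
  have "Im (K a a) = 0" "Im (K b b) = 0"
    using psd_kernel_on_diag[OF assms(1)] assms(2,3) by (auto simp: complex_nonneg_Reals_iff)
  moreover have "Im (K a b) + Im (K b a) = 0"
    using psd_kernel_on_pair[OF assms, of 1 1] calculation by (simp add: complex_nonneg_Reals_iff)
  moreover have "Re (K a b) - Re (K b a) = 0"
    using psd_kernel_on_pair[OF assms, of 1 \<i>] calculation by (simp add: complex_nonneg_Reals_iff)
  ultimately show ?thesis by (simp add: complex_eq_iff)
qed

text \<open>When the diagonal entry at a is 0, the form has no quadratic term in the coefficient at
  a, so a nonzero mixed term K a z could be used to make it negative.\<close>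

lemma psd_kernel_on_zero:
  assumes "psd_kernel_on D K" "a \<in> D" "z \<in> D" "K a a = 0"
  shows "K a z = 0"
proof (rule ccontr)
  assume nz: "K a z \<noteq> 0"
  have sq: "cnj (K a z) * K a z = of_real ((cmod (K a z))\<^sup>2)"
    by (subst complex_norm_square) (rule mult.commute)
  \<comment> \<open>Chosen so that the form takes the value K z z - 2 (K z z + 1), which is
    negative.\<close>
  define t where "t = (Re (K z z) + 1) / (cmod (K a z))\<^sup>2"
  have "cnj 1 * K z z * 1 + cnj 1 * K z a * (- of_real t * K a z) +
      (cnj (- of_real t * K a z) * K a z * 1 + cnj (- of_real t * K a z) * K a a * (- of_real t * K a z)) \<in> \<real>\<^sub>\<ge>\<^sub>0"
    by (rule psd_kernel_on_pair[OF assms(1,3,2)])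
  moreover have "K z a = cnj (K a z)" by (rule psd_kernel_on_hermitian[OF assms(1,2,3)])
  ultimately have "K z z - 2 * of_real t * (cnj (K a z) * K a z) \<in> \<real>\<^sub>\<ge>\<^sub>0"
    using assms(4) by (simp add: algebra_simps)
  then have "K z z - of_real (2 * (t * (cmod (K a z))\<^sup>2)) \<in> \<real>\<^sub>\<ge>\<^sub>0"
    unfolding sq by (simp add: mult.assoc)
  then have "Re (K z z) \<ge> 2 * (t * (cmod (K a z))\<^sup>2)" by (simp add: complex_nonneg_Reals_iff)
  moreover have "t * (cmod (K a z))\<^sup>2 = Re (K z z) + 1" using nz by (simp add: t_def)
  moreover have "Re (K z z) \<ge> 0"
    using psd_kernel_on_diag[OF assms(1,3)] by (simp add: complex_nonneg_Reals_iff)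
  ultimately show False by linarith
qed

text \<open>Completing the square: the Palm form at c is the original form after adjoining the point
  a with the coefficient d = - s / K a a that minimises it.\<close>

lemma psd_kernel_on_palm:
  assumes "psd_kernel_on D K" "a \<in> D"
  shows "psd_kernel_on D (palm_kernel K a)"
\<comment> \<open>If K a a = 0, division by zero gives 0 and the Palm kernel is K itself.\<close>
proof (cases "K a a = 0")
  case True
  then show ?thesis using assms(1) by (simp add: palm_kernel_def[abs_def])
next
  case False
  show ?thesis
    unfolding psd_kernel_on_def
  proof (intro allI impI)
    fix n :: nat and z :: "nat \<Rightarrow> complex" and c
    assume z: "\<forall>i<n. z i \<in> D"
    define s where "s = (\<Sum>j<n. K a (z j) * c j)"
    define d where "d = - s / K a a"
    have ca: "cnj (K a a) = K a a"
      using psd_kernel_on_hermitian[OF assms(1,2,2)] by simp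
    have s': "(\<Sum>i<n. cnj (c i) * K (z i) a) = cnj s"
      unfolding s_def cnj_sum
      using psd_kernel_on_hermitian[OF assms(1,2)] z by (intro sum.cong) auto
    have "(\<Sum>i<Suc n. \<Sum>j<Suc n. cnj ((c(n := d)) i) * K ((z(n := a)) i) ((z(n := a)) j) * (c(n := d)) j) \<in> \<real>\<^sub>\<ge>\<^sub>0"
      using z assms(2) by (intro psd_kernel_onD[OF assms(1)]) (auto simp: less_Suc_eq)
    also have "(\<Sum>i<Suc n. \<Sum>j<Suc n. cnj ((c(n := d)) i) * K ((z(n := a)) i) ((z(n := a)) j) * (c(n := d)) j) =
        (\<Sum>i<n. \<Sum>j<n. cnj (c i) * K (z i) (z j) * c j) + (\<Sum>i<n. cnj (c i) * K (z i) a) * d +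
        (cnj d * s + cnj d * K a a * d)"
      by (simp add: sum.distrib s_def sum_distrib_left sum_distrib_right mult.assoc)
    also have "\<dots> = (\<Sum>i<n. \<Sum>j<n. cnj (c i) * K (z i) (z j) * c j) - cnj s * s / K a a"
      using False by (simp add: s' d_def ca field_simps)
    also have "cnj s * s / K a a = (\<Sum>i<n. \<Sum>j<n. cnj (c i) * (K (z i) a * K a (z j) / K a a) * c j)"
      unfolding s'[symmetric] unfolding s_def sum_product sum_divide_distrib
      by (intro sum.cong refl) (simp add: mult_ac)
    also have "(\<Sum>i<n. \<Sum>j<n. cnj (c i) * K (z i) (z j) * c j) - \<dots> =
        (\<Sum>i<n. \<Sum>j<n. cnj (c i) * palm_kernel K a (z i) (z j) * c j)"
      by (simp add: palm_kernel_def sum_subtractf[symmetric] algebra_simps)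
    finally show "(\<Sum>i<n. \<Sum>j<n. cnj (c i) * palm_kernel K a (z i) (z j) * c j) \<in> \<real>\<^sub>\<ge>\<^sub>0" .
  qed
qed

text \<open>The subtracted term is |K a z|^2 / K a a. The domination serves twice: in Hadamard's
  inequality, and to bound all Palm kernels by \<open>K_H\<close> on the diagonal, uniformly in the
  height of the Palm point.\<close>

lemma palm_kernel_diag_le:
  assumes "psd_kernel_on D K" "a \<in> D" "z \<in> D"
  shows "Re (palm_kernel K a z z) \<le> Re (K z z)"
proof -
  have "K z a * K a z / K a a = of_real ((cmod (K a z))\<^sup>2) / K a a"
    using psd_kernel_on_hermitian[OF assms] by (simp only: complex_norm_square mult.commute)
  moreover have "K a a = of_real (Re (K a a))" "Re (K a a) \<ge> 0"
    using psd_kernel_on_diag[OF assms(1,2)] by (auto simp: complex_nonneg_Reals_iff complex_eq_iff)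
  ultimately have "Re (K z a * K a z / K a a) \<ge> 0"
    by (metis Re_complex_of_real divide_nonneg_nonneg of_real_divide zero_le_power2)
  then show ?thesis by (simp add: palm_kernel_def)
qed

lemma psd_kernel_on_rank_one: "psd_kernel_on D (\<lambda>z \<zeta>. \<phi> z * cnj (\<phi> \<zeta>))"
  unfolding psd_kernel_on_def
proof (intro allI impI)
  fix n :: nat and z :: "nat \<Rightarrow> complex" and c
  define s where "s = (\<Sum>i<n. cnj (c i) * \<phi> (z i))"
  have "(\<Sum>i<n. \<Sum>j<n. cnj (c i) * (\<phi> (z i) * cnj (\<phi> (z j))) * c j) = s * cnj s"
    unfolding s_def cnj_sum sum_product by (intro sum.cong refl) (simp add: mult_ac)
  also have "\<dots> \<in> \<real>\<^sub>\<ge>\<^sub>0" by (simp add: complex_norm_square[symmetric])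
  finally show "(\<Sum>i<n. \<Sum>j<n. cnj (c i) * (\<phi> (z i) * cnj (\<phi> (z j))) * c j) \<in> \<real>\<^sub>\<ge>\<^sub>0" .
qed

lemma psd_kernel_on_sums:
  assumes "\<And>m. psd_kernel_on D (k m)" "\<And>z \<zeta>. z \<in> D \<Longrightarrow> \<zeta> \<in> D \<Longrightarrow> (\<lambda>m. k m z \<zeta>) sums K z \<zeta>"
  shows "psd_kernel_on D K"
  unfolding psd_kernel_on_def
proof (intro allI impI)
  fix n :: nat and z :: "nat \<Rightarrow> complex" and c
  assume z: "\<forall>i<n. z i \<in> D"
  have "(\<lambda>m. \<Sum>i<n. \<Sum>j<n. cnj (c i) * k m (z i) (z j) * c j) sums
      (\<Sum>i<n. \<Sum>j<n. cnj (c i) * K (z i) (z j) * c j)"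
    using z by (intro sums_sum sums_mult2 sums_mult assms(2)) auto
  then have lim: "(\<lambda>N. \<Sum>m<N. \<Sum>i<n. \<Sum>j<n. cnj (c i) * k m (z i) (z j) * c j) \<longlonglongrightarrow>
      (\<Sum>i<n. \<Sum>j<n. cnj (c i) * K (z i) (z j) * c j)"
    by (simp add: sums_def)
  have "(\<Sum>m<N. \<Sum>i<n. \<Sum>j<n. cnj (c i) * k m (z i) (z j) * c j) \<in> \<real>\<^sub>\<ge>\<^sub>0" for N
  proof (induction N)
    case (Suc N)
    moreover have "(\<Sum>i<n. \<Sum>j<n. cnj (c i) * k N (z i) (z j) * c j) \<in> \<real>\<^sub>\<ge>\<^sub>0"
      by (rule psd_kernel_onD[OF assms(1)]) (use z in auto)
    ultimately show ?case by simp
  qed simp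
  then show "(\<Sum>i<n. \<Sum>j<n. cnj (c i) * K (z i) (z j) * c j) \<in> \<real>\<^sub>\<ge>\<^sub>0"
    by (intro closed_sequentially[OF closed_nonneg_Reals_complex _ lim]) auto
qed

section \<open>Kernel determinants\<close>

lemma kernel_det_eq:
  "kernel_det K k z = (\<Sum>p | p permutes {0..<k}. signof p * (\<Prod>i = 0..<k. K (z i) (z (p i))))"
proof -
  have "kernel_det K k z = (\<Sum>p | p permutes {0..<k}. signof p *
      (\<Prod>i = 0..<k. Matrix.mat k k (\<lambda>(i, j). K (z i) (z j)) $$ (i, p i)))"
    unfolding kernel_det_def by (rule det_def') simp
  also have "\<dots> = (\<Sum>p | p permutes {0..<k}. signof p * (\<Prod>i = 0..<k. K (z i) (z (p i))))"
    by (intro sum.cong refl arg_cong[where f = "(*) _"] prod.cong) (auto dest: permutes_in_image)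
  finally show ?thesis .
qed

lemma kernel_det_cong:
  assumes "\<And>i j. i < k \<Longrightarrow> j < k \<Longrightarrow> K (z i) (z j) = L (y i) (y j)"
  shows "kernel_det K k z = kernel_det L k y"
  unfolding kernel_det_def using assms by (intro arg_cong[where f = Determinant.det] eq_matI) auto

lemma kernel_det_0 [simp]: "kernel_det K 0 z = 1"
  by (simp add: kernel_det_eq)

text \<open>Each g (z i) enters once from its row and once from its column. With g the square root
  of the weight, the symmetric thinning of a kernel becomes a product of the weights
  themselves.\<close>

lemma kernel_det_scale:
  "kernel_det (\<lambda>z \<zeta>. of_real (g z) * K z \<zeta> * of_real (g \<zeta>)) k z =
     of_real (\<Prod>i<k. (g (z i))\<^sup>2) * kernel_det K k z"
proof -
  have "(\<Prod>i = 0..<k. of_real (g (z i)) * K (z i) (z (p i)) * of_real (g (z (p i)))) =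
      of_real (\<Prod>i<k. (g (z i))\<^sup>2) * (\<Prod>i = 0..<k. K (z i) (z (p i)))"
    if p: "p permutes {0..<k}" for p
  proof -
    have "(\<Prod>i = 0..<k. of_real (g (z (p i)))) = (\<Prod>i = 0..<k. of_real (g (z i)) :: complex)"
      using prod.permute[OF p, of "\<lambda>i. complex_of_real (g (z i))"] by (simp add: o_def)
    then show ?thesis
      by (simp add: prod.distrib power2_eq_square atLeast0LessThan)
  qed
  then show ?thesis
    by (simp add: kernel_det_eq sum_distrib_left mult_ac)
qed

lemma kernel_det_Suc:
  assumes "K a a \<noteq> 0"
  shows "kernel_det K (Suc k) (z(k := a)) = K a a * kernel_det (palm_kernel K a) k z"
proof -
  define S where "S = Matrix.mat k k (\<lambda>(i, j). palm_kernel K a (z i) (z j))"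
  define C where "C = Matrix.mat k 1 (\<lambda>(i, j). K (z i) a)"
  \<comment> \<open>R is the last row divided by the pivot, so B * R restores that row and C * R
    restores the rank one term that the Palm kernel subtracts.\<close>
  define R where "R = Matrix.mat 1 k (\<lambda>(i, j). K a (z j) / K a a)"
  define B where "B = Matrix.mat 1 1 (\<lambda>(i, j). K a a)"
  have cm: "S \<in> carrier_mat k k" "C \<in> carrier_mat k 1" "R \<in> carrier_mat 1 k" "B \<in> carrier_mat 1 1"
    by (auto simp: S_def C_def R_def B_def)
  have "Matrix.mat (Suc k) (Suc k) (\<lambda>(i, j). K ((z(k := a)) i) ((z(k := a)) j)) =
      four_block_mat (S + C * R) C (B * R) B"
  proof (rule eq_matI)
    fix i j assume "i < dim_row (four_block_mat (S + C * R) C (B * R) B)"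
      "j < dim_col (four_block_mat (S + C * R) C (B * R) B)"
    then have "i < Suc k" "j < Suc k" by (auto simp: C_def R_def B_def S_def)
    then show "Matrix.mat (Suc k) (Suc k) (\<lambda>(i, j). K ((z(k := a)) i) ((z(k := a)) j)) $$ (i, j) =
        four_block_mat (S + C * R) C (B * R) B $$ (i, j)"
      using assms
      by (cases "i = k"; cases "j = k")
        (auto simp: S_def C_def R_def B_def palm_kernel_def scalar_prod_def)
  qed (auto simp: C_def R_def B_def S_def)
  also have "\<dots> = four_block_mat S C (0\<^sub>m 1 k) B * four_block_mat (1\<^sub>m k) (0\<^sub>m k 1) R (1\<^sub>m 1)"
    using cm by (subst mult_four_block_mat[of _ k k _ 1 _ 1 _ _ k _ 1]) auto
  finally have "kernel_det K (Suc k) (z(k := a)) =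
      Determinant.det (four_block_mat S C (0\<^sub>m 1 k) B * four_block_mat (1\<^sub>m k) (0\<^sub>m k 1) R (1\<^sub>m 1))"
    by (simp add: kernel_det_def)
  also have "\<dots> = Determinant.det (four_block_mat S C (0\<^sub>m 1 k) B) *
      Determinant.det (four_block_mat (1\<^sub>m k) (0\<^sub>m k 1) R (1\<^sub>m 1))"
    using cm by (intro det_mult[of _ "k + 1"]) auto
  also have "Determinant.det (four_block_mat S C (0\<^sub>m 1 k) B) = Determinant.det S * Determinant.det B"
    using cm by (intro det_four_block_mat_lower_left_zero) auto
  also have "Determinant.det (four_block_mat (1\<^sub>m k) (0\<^sub>m k 1) R (1\<^sub>m 1)) = (1 :: complex)"
    using cm by (subst det_four_block_mat_upper_right_zero) auto
  also have "Determinant.det B = K a a"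
    by (simp add: B_def det_single)
  finally show ?thesis by (simp add: kernel_det_def S_def)
qed

text \<open>Hadamard's inequality, by Schur complements: the Schur complement of a diagonal entry is the
  matrix of the Palm kernel.\<close>

lemma kernel_det_hadamard:
  assumes "psd_kernel_on D K" "\<And>i. i < k \<Longrightarrow> z i \<in> D"
  shows "kernel_det K k z \<in> \<real>\<^sub>\<ge>\<^sub>0 \<and> Re (kernel_det K k z) \<le> (\<Prod>i<k. Re (K (z i) (z i)))"
  using assms
proof (induction k arbitrary: K)
  case (Suc k)
  define a where "a = z k"
  have aD: "a \<in> D" using Suc.prems by (simp add: a_def)
  have z: "z(k := a) = z" by (simp add: a_def)
  have nn: "K a a \<in> \<real>\<^sub>\<ge>\<^sub>0" by (rule psd_kernel_on_diag[OF Suc.prems(1) aD])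
  then obtain r where r: "K a a = of_real r" "r \<ge> 0" by (rule nonneg_Reals_cases)
  have dn: "Re (K (z i) (z i)) \<ge> 0" if "i < Suc k" for i
    using psd_kernel_on_diag[OF Suc.prems(1), of "z i"] Suc.prems(2)[OF that] by (simp add: complex_nonneg_Reals_iff)
  show ?case
  \<comment> \<open>A zero pivot admits no Schur complement, but then its whole row vanishes and
    with it the determinant.\<close>
  proof (cases "K a a = 0")
    case True
    have "K (z k) (z j) = 0" if "j < Suc k" for j
      using psd_kernel_on_zero[OF Suc.prems(1) aD Suc.prems(2)[OF that] True] by (simp add: a_def)
    then have "(\<Prod>i = 0..<Suc k. K (z i) (z (p i))) = 0" if "p permutes {0..<Suc k}" for p
      using permutes_in_image[OF that, of k] by (intro prod_zero) (auto intro!: bexI[of _ k])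
    then have "kernel_det K (Suc k) z = 0"
      by (auto simp only: kernel_det_eq mem_Collect_eq mult_zero_right intro!: sum.neutral)
    moreover have "(\<Prod>i<Suc k. Re (K (z i) (z i))) \<ge> 0" using dn by (intro prod_nonneg) auto
    ultimately show ?thesis by simp
  next
    case False
    let ?P = "palm_kernel K a"
    have IH: "kernel_det ?P k z \<in> \<real>\<^sub>\<ge>\<^sub>0" "Re (kernel_det ?P k z) \<le> (\<Prod>i<k. Re (?P (z i) (z i)))"
      using Suc.IH[OF psd_kernel_on_palm[OF Suc.prems(1) aD]] Suc.prems(2) by auto
    have *: "kernel_det K (Suc k) z = of_real r * kernel_det ?P k z"
      using kernel_det_Suc[of K a k z] False by (simp add: z r)
    have "(\<Prod>i<k. Re (?P (z i) (z i))) \<le> (\<Prod>i<k. Re (K (z i) (z i)))"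
      using palm_kernel_diag_le[OF Suc.prems(1) aD] Suc.prems(2)
        psd_kernel_on_diag[OF psd_kernel_on_palm[OF Suc.prems(1) aD]]
      by (intro prod_mono) (auto simp: complex_nonneg_Reals_iff)
    then have "r * Re (kernel_det ?P k z) \<le> r * (\<Prod>i<k. Re (K (z i) (z i)))"
      using IH(2) r(2) by (intro mult_left_mono) auto
    moreover have "of_real r * kernel_det ?P k z \<in> \<real>\<^sub>\<ge>\<^sub>0"
      using IH(1) r(2) by simp
    moreover have "r = Re (K (z k) (z k))" using r(1) by (simp add: a_def)
    ultimately show ?thesis by (simp add: * mult.commute)
  qed
qed simp

text \<open>Kernel and points both depend on \<omega>, so that the determinant is measurable jointly
  in the Palm point and the tuple.\<close>

lemma borel_measurable_kernel_det:
  assumes [measurable]: "\<And>i j. i < k \<Longrightarrow> j < k \<Longrightarrow> (\<lambda>\<omega>. K \<omega> (z \<omega> i) (z \<omega> j)) \<in> borel_measurable M"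
  shows "(\<lambda>\<omega>. kernel_det (K \<omega>) k (z \<omega>)) \<in> borel_measurable M"
  unfolding kernel_det_eq
proof (intro borel_measurable_sum borel_measurable_times borel_measurable_prod)
  fix p i assume "p \<in> {p. p permutes {0..<k}}" "i \<in> {0..<k}"
  then show "(\<lambda>\<omega>. K \<omega> (z \<omega> i) (z \<omega> (p i))) \<in> borel_measurable M"
    using permutes_in_image[of p "{0..<k}" i] by (intro assms) auto
qed auto

section \<open>The Hardy--Szego kernel\<close>

lemma open_upper_half_plane: "open upper_half_plane"
  unfolding upper_half_plane_def by (rule open_halfspace_Im_gt)

text \<open>Here z - cnj z = 2 i Im z. The weight 1 / y^2 of \<open>height_law\<close> and the
  factor 1 / (4 pi) of \<open>intensity\<close> both originate in this value.\<close>

lemma K_H_diag: "K_H z z = of_real (1 / (4 * pi * (Im z)\<^sup>2))"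
proof -
  have "(z - cnj z)\<^sup>2 = of_real (- (4 * (Im z)\<^sup>2))"
    by (simp add: complex_diff_cnj power_mult_distrib)
  then show ?thesis by (simp add: K_H_def)
qed

lemma K_H_translate: "K_H (z + of_real x) (\<zeta> + of_real x) = K_H z \<zeta>"
  by (simp add: K_H_def)

lemma palm_K_H_translate:
  "palm_kernel K_H (a + of_real x) (z + of_real x) (\<zeta> + of_real x) = palm_kernel K_H a z \<zeta>"
  by (simp add: palm_kernel_def K_H_translate)

text \<open>Under the Cayley transform \<open>z \<mapsto> (z - \<i>) / (z + \<i>)\<close> the kernel becomes the Bergman kernel of the
  disc, whose power series exhibits it as a sum of rank one kernels.\<close>

lemma psd_K_H: "psd_kernel_on upper_half_plane K_H"
proof (rule psd_kernel_on_sums)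
  \<comment> \<open>With a the Cayley image of z, (1 - a)^2 = 2 i a', where a' is the derivative of
    the Cayley map. The resulting factor 1 / 4 turns the Bergman coefficients (m + 1) / pi of the
    disc into (m + 1) / (4 pi).\<close>
  define \<phi> where "\<phi> m z = of_real (sqrt (real (Suc m) / (4 * pi))) * (1 - (z - \<i>) / (z + \<i>))\<^sup>2 * ((z - \<i>) / (z + \<i>)) ^ m"
    for m and z :: complex
  show "psd_kernel_on upper_half_plane (\<lambda>z \<zeta>. \<phi> m z * cnj (\<phi> m \<zeta>))" for m
    by (rule psd_kernel_on_rank_one)
  fix z \<zeta> assume "z \<in> upper_half_plane" "\<zeta> \<in> upper_half_plane"
  then have pos: "Im z > 0" "Im \<zeta> > 0" by (auto simp: upper_half_plane_def)
  define a where "a = (z - \<i>) / (z + \<i>)"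
  define b where "b = (\<zeta> - \<i>) / (\<zeta> + \<i>)"
  have lt: "cmod ((u - \<i>) / (u + \<i>)) < 1" if "Im u > 0" for u
  proof -
    have "(cmod (u - \<i>))\<^sup>2 < (cmod (u + \<i>))\<^sup>2"
      using that unfolding cmod_power2 by (simp add: power2_eq_square algebra_simps)
    then have "cmod (u - \<i>) < cmod (u + \<i>)" by (rule power_less_imp_less_base) simp
    then show ?thesis
      by (simp add: norm_divide divide_less_eq_1)
  qed
  have ab: "cmod a < 1" "cmod b < 1" using lt pos by (auto simp: a_def b_def)
  have "cmod (a * cnj b) < 1"
    using ab mult_strict_mono[of "cmod a" 1 "cmod b" 1] by (simp add: norm_mult)
  then have "(\<lambda>m. of_nat (Suc m) * (a * cnj b) ^ m) sums (1 / (1 - a * cnj b)\<^sup>2)"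
    by (rule geometric_deriv_sums)
  then have "(\<lambda>m. (1 - a)\<^sup>2 * cnj ((1 - b)\<^sup>2) / of_real (4 * pi) * (of_nat (Suc m) * (a * cnj b) ^ m)) sums
      ((1 - a)\<^sup>2 * cnj ((1 - b)\<^sup>2) / of_real (4 * pi) * (1 / (1 - a * cnj b)\<^sup>2))"
    by (rule sums_mult)
  also have "(\<lambda>m. (1 - a)\<^sup>2 * cnj ((1 - b)\<^sup>2) / of_real (4 * pi) * (of_nat (Suc m) * (a * cnj b) ^ m)) =
      (\<lambda>m. \<phi> m z * cnj (\<phi> m \<zeta>))"
  proof
    fix m
    have sq: "complex_of_real (sqrt (real (Suc m) / (4 * pi))) * complex_of_real (sqrt (real (Suc m) / (4 * pi))) =
        of_nat (Suc m) / of_real (4 * pi)"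
      by (simp flip: of_real_mult)
    have "\<phi> m z * cnj (\<phi> m \<zeta>) =
      (complex_of_real (sqrt (real (Suc m) / (4 * pi))) * complex_of_real (sqrt (real (Suc m) / (4 * pi)))) *
      ((1 - a)\<^sup>2 * cnj ((1 - b)\<^sup>2) * (a * cnj b) ^ m)"
      unfolding \<phi>_def a_def[symmetric] b_def[symmetric] by (simp add: power_mult_distrib)
    then show "(1 - a)\<^sup>2 * cnj ((1 - b)\<^sup>2) / of_real (4 * pi) * (of_nat (Suc m) * (a * cnj b) ^ m) =
        \<phi> m z * cnj (\<phi> m \<zeta>)"
      unfolding sq by simp
  qed
  also have "(1 - a)\<^sup>2 * cnj ((1 - b)\<^sup>2) / of_real (4 * pi) * (1 / (1 - a * cnj b)\<^sup>2) = K_H z \<zeta>"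
  proof -
    have nz: "z + \<i> \<noteq> 0" "cnj \<zeta> - \<i> \<noteq> 0" "z - cnj \<zeta> \<noteq> 0"
      using pos by (auto simp: complex_eq_iff)
    have 1: "1 - a = 2 * \<i> / (z + \<i>)" using nz by (simp add: a_def field_simps)
    have 2: "cnj (1 - b) = - 2 * \<i> / (cnj \<zeta> - \<i>)" using nz by (simp add: b_def field_simps)
    have 3: "1 - a * cnj b = - 2 * \<i> * (z - cnj \<zeta>) / ((z + \<i>) * (cnj \<zeta> - \<i>))"
      using nz by (simp add: a_def b_def divide_simps) (simp add: algebra_simps)
    have "(1 - a)\<^sup>2 * cnj ((1 - b)\<^sup>2) / of_real (4 * pi) * (1 / (1 - a * cnj b)\<^sup>2) =
      ((1 - a) * cnj (1 - b) / (1 - a * cnj b))\<^sup>2 / of_real (4 * pi)"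
      by (simp add: power_divide power_mult_distrib)
    also have "(1 - a) * cnj (1 - b) / (1 - a * cnj b) = 2 * \<i> / (z - cnj \<zeta>)"
      unfolding 1 2 3 using nz by (simp add: divide_simps) (simp add: algebra_simps)
    finally show ?thesis
      using nz by (simp add: K_H_def power_divide power_mult_distrib)
  qed
  finally show "(\<lambda>m. \<phi> m z * cnj (\<phi> m \<zeta>)) sums K_H z \<zeta>" .
qed

section \<open>Sums over tuples of distinct points\<close>

text \<open>Tuples are extensional functions, so that they are points of the product space
  \<open>dA_power k\<close>; for k = 0 there is exactly one.\<close>

definition distinct_tuples :: "nat \<Rightarrow> 'a set \<Rightarrow> (nat \<Rightarrow> 'a) set" where
  "distinct_tuples k S = {z \<in> PiE {..<k} (\<lambda>_. S). inj_on z {..<k}}"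

lemma countable_distinct_tuples:
  assumes "countable S"
  shows "countable (distinct_tuples k S)"
proof (rule countable_subset)
  show "countable (PiE {..<k} (\<lambda>_. S))" using assms by (intro countable_PiE) auto
qed (auto simp: distinct_tuples_def)

lemma measurable_distinct_tuple_sum:
  fixes E :: "'a::euclidean_space set" and f :: "'a measure \<times> (nat \<Rightarrow> 'a) \<Rightarrow> ennreal"
  assumes "open E" and [measurable]: "f \<in> borel_measurable (config_space E \<Otimes>\<^sub>M PiM {..<k} (\<lambda>_. restrict_space borel E))"
  shows "(\<lambda>\<xi>. \<integral>\<^sup>+z. f (\<xi>, z) \<partial>count_space (distinct_tuples k (atoms \<xi>))) \<in> borel_measurable (config_space E)"
proof -
  let ?P = "PiM {..<k} (\<lambda>_. restrict_space borel E)"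
  have id: "(\<lambda>x. x) \<in> measurable (restrict_space borel E) borel"
    by (rule measurable_restrict_space1) simp
  have c [measurable]: "(\<lambda>z. z i) \<in> borel_measurable ?P" if "i < k" for i
  proof -
    have "(\<lambda>z. z i) \<in> measurable ?P (restrict_space borel E)"
      using that by (intro measurable_component_singleton) simp
    from measurable_compose[OF this id] show ?thesis .
  qed
  \<comment> \<open>Injectivity is phrased through nonzero distances, which are measurable functions
    of the tuple.\<close>
  have "Measurable.pred ?P (\<lambda>z. \<forall>i\<in>{..<k}. \<forall>j\<in>{..<k}. i \<noteq> j \<longrightarrow> dist (z i) (z j) \<noteq> 0)"
    by measurable
  then have [measurable]: "Measurable.pred ?P (\<lambda>z. inj_on z {..<k})"
    by (rule measurable_cong[THEN iffD1, rotated]) (auto simp: inj_on_def)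
  have "(\<lambda>\<xi>. \<integral>\<^sup>+z. (f (\<xi>, z) * indicator {z. inj_on z {..<k}} z) \<partial>count_space (PiE {..<k} (\<lambda>_. atoms \<xi>)))
      \<in> borel_measurable (config_space E)"
    using measurable_tuple_sum[OF assms(1), of "\<lambda>p. f p * indicator {z. inj_on z {..<k}} (snd p)" k] by simp
  also have "(\<lambda>\<xi>. \<integral>\<^sup>+z. (f (\<xi>, z) * indicator {z. inj_on z {..<k}} z) \<partial>count_space (PiE {..<k} (\<lambda>_. atoms \<xi>))) =
      (\<lambda>\<xi>. \<integral>\<^sup>+z. f (\<xi>, z) \<partial>count_space (distinct_tuples k (atoms \<xi>)))"
    by (intro ext, subst (1 2) nn_integral_count_space_indicator)
      (auto simp: distinct_tuples_def intro!: nn_integral_cong split: split_indicator)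
  finally show ?thesis .
qed

section \<open>Moments of determinantal laws\<close>

lemma space_dA [simp]: "space dA = upper_half_plane"
  by (simp add: dA_def space_restrict_space)

lemma sets_dA [measurable_cong]: "sets dA = sets (restrict_space borel upper_half_plane)"
  unfolding dA_def by (rule sets_restrict_space_cong) simp

lemma sigma_finite_dA: "sigma_finite_measure dA"
  unfolding dA_def using open_upper_half_plane
  by (intro sigma_finite_measure_restrict_space sigma_finite_lborel) auto

interpretation dA: product_sigma_finite "\<lambda>_::nat. dA"
  using sigma_finite_dA by (simp add: product_sigma_finite_def)

lemma sets_dA_power [measurable_cong]:
  "sets (PiM I (\<lambda>_. dA)) = sets (PiM I (\<lambda>_. restrict_space borel upper_half_plane))"
  by (rule sets_PiM_cong) (auto simp: sets_dA)

lemma determinantal_lawD: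
  assumes "determinantal_law K P"
  shows "prob_space P" "sets P = sets N_H" "space P = simple_configs upper_half_plane"
  using assms sets_eq_imp_space_eq[of P N_H] by (auto simp: determinantal_law_def)

lemma measurable_distinct_tuple_sum_dA:
  assumes "f \<in> borel_measurable (dA_power k)"
  shows "(\<lambda>\<xi>. \<integral>\<^sup>+z. f z \<partial>count_space (distinct_tuples k (atoms \<xi>))) \<in> borel_measurable N_H"
proof -
  have "(\<lambda>p. f (snd p)) \<in> borel_measurable (N_H \<Otimes>\<^sub>M PiM {..<k} (\<lambda>_. restrict_space borel upper_half_plane))"
    using assms by (intro measurable_compose[OF measurable_snd]) (simp cong: measurable_cong_sets add: sets_dA_power)
  from measurable_distinct_tuple_sum[OF open_upper_half_plane this] show ?thesis by simp
qed

lemma factorial_moment_measure_eq: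
  assumes B: "B \<in> sets (dA_power k)"
  shows "factorial_moment_measure P k B =
    (\<integral>\<^sup>+\<xi>. (\<integral>\<^sup>+z. indicator B z \<partial>count_space (distinct_tuples k (atoms \<xi>))) \<partial>P)"
  unfolding factorial_moment_measure_def
proof (intro nn_integral_cong)
  fix \<xi> assume "\<xi> \<in> space P"
  \<comment> \<open>The factorial moment counts arbitrary functions z in B; that they are
    extensional comes from B being a subset of the product space.\<close>
  have "B \<subseteq> extensional {..<k}"
    using sets.sets_into_space[OF B] by (auto simp: space_PiM PiE_def)
  then have "{z \<in> B. inj_on z {..<k} \<and> (\<forall>i<k. z i \<in> atoms \<xi>)} = B \<inter> distinct_tuples k (atoms \<xi>)"
    by (auto simp: distinct_tuples_def PiE_iff)
  then have "emeasure (count_space UNIV) {z \<in> B. inj_on z {..<k} \<and> (\<forall>i<k. z i \<in> atoms \<xi>)} =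
      (\<integral>\<^sup>+z. indicator (B \<inter> distinct_tuples k (atoms \<xi>)) z \<partial>count_space UNIV)"
    by simp
  also have "\<dots> = (\<integral>\<^sup>+z. indicator B z * indicator (distinct_tuples k (atoms \<xi>)) z \<partial>count_space UNIV)"
    by (simp only: indicator_inter_arith)
  also have "\<dots> = (\<integral>\<^sup>+z. indicator B z \<partial>count_space (distinct_tuples k (atoms \<xi>)))"
    by (rule nn_integral_count_space_indicator[symmetric]) simp
  finally show "emeasure (count_space UNIV) {z \<in> B. inj_on z {..<k} \<and> (\<forall>i<k. z i \<in> atoms \<xi>)} =
      (\<integral>\<^sup>+z. indicator B z \<partial>count_space (distinct_tuples k (atoms \<xi>)))" .
qed

text \<open>The definition of a determinantal law is the case of an indicator f; the standard
  induction extends it to a Campbell formula for nonnegative functions.\<close>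

lemma determinantal_campbell:
  assumes P: "determinantal_law K P" and k: "k \<ge> 1" and f: "f \<in> borel_measurable (dA_power k)"
  shows "(\<integral>\<^sup>+\<xi>. (\<integral>\<^sup>+z. f z \<partial>count_space (distinct_tuples k (atoms \<xi>))) \<partial>P) =
    (\<integral>\<^sup>+z. f z * ennreal (Re (kernel_det K k z)) \<partial>dA_power k)"
  using f
proof (induction f rule: borel_measurable_induct)
  case (cong f g)
  have "(\<integral>\<^sup>+z. f z \<partial>count_space (distinct_tuples k (atoms \<xi>))) = (\<integral>\<^sup>+z. g z \<partial>count_space (distinct_tuples k (atoms \<xi>)))"
    if "\<xi> \<in> space P" for \<xi>
    using simple_configsE(1)[of \<xi> upper_half_plane] that determinantal_lawD(3)[OF P]
    by (intro nn_integral_cong cong(3)) (auto simp: distinct_tuples_def space_PiM PiE_iff)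
  then have "(\<integral>\<^sup>+\<xi>. (\<integral>\<^sup>+z. f z \<partial>count_space (distinct_tuples k (atoms \<xi>))) \<partial>P) =
      (\<integral>\<^sup>+\<xi>. (\<integral>\<^sup>+z. g z \<partial>count_space (distinct_tuples k (atoms \<xi>))) \<partial>P)"
    by (rule nn_integral_cong)
  moreover have "(\<integral>\<^sup>+z. f z * ennreal (Re (kernel_det K k z)) \<partial>dA_power k) =
      (\<integral>\<^sup>+z. g z * ennreal (Re (kernel_det K k z)) \<partial>dA_power k)"
    using cong(3) by (intro nn_integral_cong) auto
  ultimately show ?case using cong(4) by simp
next
  case (set A)
  then show ?case
    using P k factorial_moment_measure_eq[OF set, of P] by (simp add: determinantal_law_def mult.commute)
next
  case (mult u c)
  have [measurable]: "(\<lambda>z. kernel_det K k z) \<in> borel_measurable (dA_power k)"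
    using P k by (simp add: determinantal_law_def)
  have "(\<integral>\<^sup>+\<xi>. c * (\<integral>\<^sup>+z. u z \<partial>count_space (distinct_tuples k (atoms \<xi>))) \<partial>P) =
      c * (\<integral>\<^sup>+\<xi>. (\<integral>\<^sup>+z. u z \<partial>count_space (distinct_tuples k (atoms \<xi>))) \<partial>P)"
    using measurable_distinct_tuple_sum_dA[OF mult(2)]
    by (intro nn_integral_cmult) (simp cong: measurable_cong_sets add: determinantal_lawD(2)[OF P])
  then show ?case
    using mult by (simp add: nn_integral_cmult mult.assoc)
next
  case (add u v)
  have [measurable]: "(\<lambda>z. kernel_det K k z) \<in> borel_measurable (dA_power k)"
    using P k by (simp add: determinantal_law_def)
  have [measurable]: "(\<lambda>\<xi>. \<integral>\<^sup>+z. h z \<partial>count_space (distinct_tuples k (atoms \<xi>))) \<in> borel_measurable P"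
    if "h \<in> borel_measurable (dA_power k)" for h
    using measurable_distinct_tuple_sum_dA[OF that]
    by (simp cong: measurable_cong_sets add: determinantal_lawD(2)[OF P])
  show ?case
    using add by (simp add: nn_integral_add distrib_right)
next
  case (seq U)
  have [measurable]: "(\<lambda>z. kernel_det K k z) \<in> borel_measurable (dA_power k)"
    using P k by (simp add: determinantal_law_def)
  have m: "(\<lambda>\<xi>. \<integral>\<^sup>+z. h z \<partial>count_space (distinct_tuples k (atoms \<xi>))) \<in> borel_measurable P"
    if "h \<in> borel_measurable (dA_power k)" for h
    using measurable_distinct_tuple_sum_dA[OF that]
    by (simp cong: measurable_cong_sets add: determinantal_lawD(2)[OF P])
  have "(\<integral>\<^sup>+\<xi>. (\<integral>\<^sup>+z. (SUP i. U i) z \<partial>count_space (distinct_tuples k (atoms \<xi>))) \<partial>P) =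
      (\<integral>\<^sup>+\<xi>. (SUP i. \<integral>\<^sup>+z. U i z \<partial>count_space (distinct_tuples k (atoms \<xi>))) \<partial>P)"
    unfolding SUP_apply using seq(3)
    by (intro nn_integral_cong nn_integral_monotone_convergence_SUP) (auto simp: incseq_def le_fun_def)
  also have "\<dots> = (SUP i. \<integral>\<^sup>+\<xi>. (\<integral>\<^sup>+z. U i z \<partial>count_space (distinct_tuples k (atoms \<xi>))) \<partial>P)"
    using seq(3) m[OF seq(1)]
    by (intro nn_integral_monotone_convergence_SUP) (auto simp: incseq_def le_fun_def intro!: nn_integral_mono)
  also have "\<dots> = (SUP i. \<integral>\<^sup>+z. U i z * ennreal (Re (kernel_det K k z)) \<partial>dA_power k)"
    by (simp add: seq.IH)
  also have "\<dots> = (\<integral>\<^sup>+z. (SUP i. U i z * ennreal (Re (kernel_det K k z))) \<partial>dA_power k)"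
    using seq(1,3) by (intro nn_integral_monotone_convergence_SUP[symmetric])
      (auto simp: incseq_def le_fun_def intro!: mult_right_mono)
  also have "\<dots> = (\<integral>\<^sup>+z. (SUP i. U i) z * ennreal (Re (kernel_det K k z)) \<partial>dA_power k)"
    by (simp only: SUP_apply SUP_mult_right_ennreal)
  finally show ?case .
qed

section \<open>Thinning\<close>

lemma thinned_config:
  fixes \<xi> :: "'a::t1_space measure"
  assumes "\<xi> \<in> simple_configs E"
  shows "point_measure_on E {z \<in> atoms \<xi>. b z} \<in> simple_configs E"
proof (rule point_measure_on_in_simple_configs)
  show "finite ({z \<in> atoms \<xi>. b z} \<inter> C)" if "compact C" "C \<subseteq> E" for C
    using simple_configsE(3)[OF assms that] by (rule rev_finite_subset) auto
qed (use simple_configsE(1)[OF assms] in auto)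

text \<open>Coins may be tossed at infinitely many atoms, but a void event on A concerns only the
  finitely many atoms in A, and void events suffice.\<close>

lemma measurable_thinning:
  assumes xi: "\<xi> \<in> simple_configs upper_half_plane"
  shows "(\<lambda>b. point_measure_on upper_half_plane {z \<in> atoms \<xi>. b z}) \<in>
    measurable (PiM (atoms \<xi>) (\<lambda>z. measure_pmf (bernoulli_pmf (q z)))) N_H"
proof (rule measurable_sigma_sets[OF sets_config_space_void_events[OF open_upper_half_plane] void_events_subset])
  fix y assume "y \<in> void_events upper_half_plane"
  then obtain A C where A: "y = {\<xi> \<in> simple_configs upper_half_plane. emeasure \<xi> A = 0}" "A \<in> sets borel"
    "compact C" "C \<subseteq> upper_half_plane" "A \<subseteq> C"
    unfolding void_events_def by blast
  let ?P = "PiM (atoms \<xi>) (\<lambda>z. measure_pmf (bernoulli_pmf (q z)))"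
  have "(\<lambda>b. point_measure_on upper_half_plane {z \<in> atoms \<xi>. b z}) -` y \<inter> space ?P =
      {b \<in> space ?P. \<forall>z\<in>atoms \<xi> \<inter> A. \<not> b z}"
    using emeasure_simple_configs_eq_0[OF thinned_config[OF xi] A(2)] A(4,5) thinned_config[OF xi]
      simple_configsE(1)[OF xi]
    by (auto simp: A(1) subset_eq)
  also have "\<dots> \<in> sets ?P"
  proof (rule sets.sets_Collect_finite_All)
    show "finite (atoms \<xi> \<inter> A)"
      using simple_configsE(3)[OF xi A(3,4)] by (rule rev_finite_subset) (use A(5) in auto)
    fix z assume "z \<in> atoms \<xi> \<inter> A"
    then have "(\<lambda>b. b z) \<in> measurable ?P (measure_pmf (bernoulli_pmf (q z)))"
      by (intro measurable_component_singleton) auto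
    then have "(\<lambda>b. b z) -` {False} \<inter> space ?P \<in> sets ?P"
      by (rule measurable_sets) simp
    also have "(\<lambda>b. b z) -` {False} \<inter> space ?P = {b \<in> space ?P. \<not> b z}" by auto
    finally show "{b \<in> space ?P. \<not> b z} \<in> sets ?P" .
  qed
  finally show "(\<lambda>b. point_measure_on upper_half_plane {z \<in> atoms \<xi>. b z}) -` y \<inter> space ?P \<in> sets ?P" .
qed (use thinned_config[OF xi] in auto)

lemma thin_kernel_prob:
  assumes "\<xi> \<in> simple_configs upper_half_plane"
  shows "prob_space (thin_kernel q \<xi>)" "sets (thin_kernel q \<xi>) = sets N_H"
  unfolding thin_kernel_def
  by (auto intro!: prob_space.prob_space_distr measurable_thinning[OF assms] prob_space_PiM prob_space_measure_pmf)

lemma emeasure_coins: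
  assumes "finite J" "J \<subseteq> I" "\<And>z. z \<in> J \<Longrightarrow> 0 \<le> q z \<and> q z \<le> 1"
  shows "emeasure (PiM I (\<lambda>z. measure_pmf (bernoulli_pmf (q z)))) {b \<in> space (PiM I (\<lambda>z. measure_pmf (bernoulli_pmf (q z)))). \<forall>z\<in>J. b z} =
      (\<Prod>z\<in>J. ennreal (q z))"
    and "emeasure (PiM I (\<lambda>z. measure_pmf (bernoulli_pmf (q z)))) {b \<in> space (PiM I (\<lambda>z. measure_pmf (bernoulli_pmf (q z)))). \<forall>z\<in>J. \<not> b z} =
      (\<Prod>z\<in>J. ennreal (1 - q z))"
proof -
  interpret product_prob_space "\<lambda>z. measure_pmf (bernoulli_pmf (q z))" I
    by (simp add: product_prob_space_def product_prob_space_axioms_def product_sigma_finite_def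
      prob_space_measure_pmf prob_space_imp_sigma_finite)
  have "emeasure (PiM I (\<lambda>z. measure_pmf (bernoulli_pmf (q z)))) {b \<in> space (PiM I (\<lambda>z. measure_pmf (bernoulli_pmf (q z)))). \<forall>z\<in>J. b z \<in> {c}} =
      (\<Prod>z\<in>J. emeasure (measure_pmf (bernoulli_pmf (q z))) {c})" for c
    using assms(1,2) by (intro emeasure_PiM_Collect) auto
  from this[of True] this[of False] show
    "emeasure (PiM I (\<lambda>z. measure_pmf (bernoulli_pmf (q z)))) {b \<in> space (PiM I (\<lambda>z. measure_pmf (bernoulli_pmf (q z)))). \<forall>z\<in>J. b z} =
      (\<Prod>z\<in>J. ennreal (q z))"
    "emeasure (PiM I (\<lambda>z. measure_pmf (bernoulli_pmf (q z)))) {b \<in> space (PiM I (\<lambda>z. measure_pmf (bernoulli_pmf (q z)))). \<forall>z\<in>J. \<not> b z} =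
      (\<Prod>z\<in>J. ennreal (1 - q z))"
    using assms(3) by (auto simp: emeasure_pmf_single intro!: prod.cong)
qed

text \<open>The product is the exponential of minus the integral of - ln g against the
  configuration, and integrals are known to be measurable; a factor 0 is encoded by the value
  \<infinity>. With g = 1 - q these products are the void probabilities of a thinned
  configuration.\<close>

lemma measurable_config_prod:
  fixes E :: "'a::euclidean_space set" and g :: "'a \<Rightarrow> real"
  assumes "open E" "A \<in> sets borel" "A \<subseteq> C" "compact C" "C \<subseteq> E"
    and g: "g \<in> borel_measurable (restrict_space borel E)" "\<And>z. z \<in> E \<Longrightarrow> 0 \<le> g z \<and> g z \<le> 1"
  shows "(\<lambda>\<xi>. \<Prod>z\<in>atoms \<xi> \<inter> A. ennreal (g z)) \<in> borel_measurable (config_space E)"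
proof -
  define h where "h z = (if g z = 0 then \<infinity> else ennreal (- ln (g z))) * indicator A z" for z
  have [measurable]: "A \<in> sets (restrict_space borel E)"
    using assms by (auto simp: sets_restrict_space_iff)
  have h [measurable]: "h \<in> borel_measurable (restrict_space borel E)"
    unfolding h_def using g(1) by measurable
  have "(\<lambda>\<xi>. \<integral>\<^sup>+z. h z \<partial>\<xi>) \<in> borel_measurable (config_space E)"
    using nn_integral_config_measurable[OF assms(1), of "\<lambda>\<xi>. \<xi>" "config_space E" "\<lambda>p. h (snd p)"] by simp
  then have m: "(\<lambda>\<xi>. if (\<integral>\<^sup>+z. h z \<partial>\<xi>) = \<infinity> then 0 else ennreal (exp (- enn2real (\<integral>\<^sup>+z. h z \<partial>\<xi>))))
      \<in> borel_measurable (config_space E)"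
    by measurable
  have "(if (\<integral>\<^sup>+z. h z \<partial>\<xi>) = \<infinity> then 0 else ennreal (exp (- enn2real (\<integral>\<^sup>+z. h z \<partial>\<xi>)))) =
      (\<Prod>z\<in>atoms \<xi> \<inter> A. ennreal (g z))" if xi: "\<xi> \<in> simple_configs E" for \<xi>
  proof -
    have fin: "finite (atoms \<xi> \<inter> A)"
      using simple_configsE(3)[OF xi assms(4,5)] by (rule rev_finite_subset) (use assms(3) in auto)
    have gz: "0 \<le> g z" "g z \<le> 1" if "z \<in> atoms \<xi>" for z
      using g(2) simple_configsE(1)[OF xi] that by auto
    have "(\<integral>\<^sup>+z. h z \<partial>\<xi>) = (\<integral>\<^sup>+z. h z \<partial>count_space (atoms \<xi>))"
      by (rule nn_integral_simple_configs[OF xi h])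
    also have "\<dots> = (\<Sum>z\<in>atoms \<xi> \<inter> A. h z)"
      by (rule nn_integral_count_space'[OF fin]) (auto simp: h_def)
    finally have int: "(\<integral>\<^sup>+z. h z \<partial>\<xi>) = (\<Sum>z\<in>atoms \<xi> \<inter> A. h z)" .
    show ?thesis
    proof (cases "\<exists>z\<in>atoms \<xi> \<inter> A. g z = 0")
      case True
      then obtain z where z: "z \<in> atoms \<xi> \<inter> A" "g z = 0" by blast
      then have "h z \<le> (\<Sum>z\<in>atoms \<xi> \<inter> A. h z)"
        using fin by (intro member_le_sum) auto
      moreover have "h z = \<infinity>" using z by (simp add: h_def)
      ultimately have "(\<Sum>z\<in>atoms \<xi> \<inter> A. h z) = \<infinity>" by (simp add: top_unique)
      moreover have "(\<Prod>z\<in>atoms \<xi> \<inter> A. ennreal (g z)) = 0"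
        using z fin by (intro prod_zero bexI[of _ z]) auto
      ultimately show ?thesis by (simp add: int)
    next
      case False
      then have pos: "0 < g z" "g z \<le> 1" if "z \<in> atoms \<xi> \<inter> A" for z
        using gz[of z] that by (auto simp: order_le_less)
      have "(\<Sum>z\<in>atoms \<xi> \<inter> A. h z) = (\<Sum>z\<in>atoms \<xi> \<inter> A. ennreal (- ln (g z)))"
        by (intro sum.cong refl) (use pos in \<open>fastforce simp: h_def\<close>)
      also have "\<dots> = ennreal (\<Sum>z\<in>atoms \<xi> \<inter> A. - ln (g z))"
        using pos by (intro sum_ennreal) (auto simp: ln_le_zero_iff)
      finally have *: "(\<Sum>z\<in>atoms \<xi> \<inter> A. h z) = ennreal (\<Sum>z\<in>atoms \<xi> \<inter> A. - ln (g z))" .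
      have "exp (- (\<Sum>z\<in>atoms \<xi> \<inter> A. - ln (g z))) = (\<Prod>z\<in>atoms \<xi> \<inter> A. g z)"
        using fin pos by (simp add: sum_negf exp_sum)
      moreover have "(\<Sum>z\<in>atoms \<xi> \<inter> A. - ln (g z)) \<ge> 0"
        using pos by (intro sum_nonneg) (auto simp: ln_le_zero_iff)
      moreover have "(\<Prod>z\<in>atoms \<xi> \<inter> A. ennreal (g z)) = ennreal (\<Prod>z\<in>atoms \<xi> \<inter> A. g z)"
        using gz by (intro prod_ennreal) auto
      ultimately show ?thesis by (simp add: int *)
    qed
  qed
  then show ?thesis using m by (subst measurable_cong[symmetric]) auto
qed

text \<open>\<open>law_M\<close> is a monadic bind, so thinning has to be a measurable kernel. On a
  void event its value is the product of 1 - q over the atoms in A, the chance that all of them are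
  deleted.\<close>

lemma measurable_thin_kernel:
  assumes q: "q \<in> borel_measurable (restrict_space borel upper_half_plane)"
    "\<And>z. z \<in> upper_half_plane \<Longrightarrow> 0 \<le> q z \<and> q z \<le> 1"
  shows "thin_kernel q \<in> measurable N_H (prob_algebra N_H)"
proof (rule measurable_prob_algebra_generated[OF sets_config_space_void_events[OF open_upper_half_plane]
      Int_stable_void_events void_events_subset])
  fix a assume a: "a \<in> void_events upper_half_plane"
  then obtain A C where A: "a = {\<xi> \<in> simple_configs upper_half_plane. emeasure \<xi> A = 0}" "A \<in> sets borel"
    "compact C" "C \<subseteq> upper_half_plane" "A \<subseteq> C"
    unfolding void_events_def by blast
  have a_sets: "a \<in> sets N_H"
    using a by (simp add: sets_config_space_void_events[OF open_upper_half_plane] sigma_sets.Basic)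
  have "emeasure (thin_kernel q \<xi>) a = (\<Prod>z\<in>atoms \<xi> \<inter> A. ennreal (1 - q z))"
    if xi: "\<xi> \<in> simple_configs upper_half_plane" for \<xi>
  proof -
    let ?P = "PiM (atoms \<xi>) (\<lambda>z. measure_pmf (bernoulli_pmf (q z)))"
    have "(\<lambda>b. point_measure_on upper_half_plane {z \<in> atoms \<xi>. b z}) -` a \<inter> space ?P =
        {b \<in> space ?P. \<forall>z\<in>atoms \<xi> \<inter> A. \<not> b z}"
      using emeasure_simple_configs_eq_0[OF thinned_config[OF xi] A(2)] A(4,5) thinned_config[OF xi]
        simple_configsE(1)[OF xi]
      by (auto simp: A(1) subset_eq)
    then have "emeasure (thin_kernel q \<xi>) a = emeasure ?P {b \<in> space ?P. \<forall>z\<in>atoms \<xi> \<inter> A. \<not> b z}"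
      unfolding thin_kernel_def using a_sets by (subst emeasure_distr[OF measurable_thinning[OF xi]]) auto
    also have "\<dots> = (\<Prod>z\<in>atoms \<xi> \<inter> A. ennreal (1 - q z))"
    proof (rule emeasure_coins(2))
      show "finite (atoms \<xi> \<inter> A)"
        using simple_configsE(3)[OF xi A(3,4)] by (rule rev_finite_subset) (use A(5) in auto)
    qed (use q(2) simple_configsE(1)[OF xi] in auto)
    finally show ?thesis .
  qed
  moreover have "(\<lambda>\<xi>. \<Prod>z\<in>atoms \<xi> \<inter> A. ennreal (1 - q z)) \<in> borel_measurable N_H"
    by (rule measurable_config_prod[OF open_upper_half_plane A(2,5,3,4)]) (use q in auto)
  ultimately show "(\<lambda>\<xi>. emeasure (thin_kernel q \<xi>) a) \<in> borel_measurable N_H"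
    by (subst measurable_cong) auto
qed (use thin_kernel_prob in auto)

text \<open>Distinct points carry independent coins, so a tuple survives with the product of its
  retention probabilities. In a tuple with repetitions the same coin would be counted twice.\<close>

lemma thin_kernel_tuple_sum:
  assumes q: "\<And>z. z \<in> upper_half_plane \<Longrightarrow> 0 \<le> q z \<and> q z \<le> 1"
    and f: "f \<in> borel_measurable (dA_power k)" and xi: "\<xi> \<in> simple_configs upper_half_plane"
  shows "(\<integral>\<^sup>+\<eta>. (\<integral>\<^sup>+z. f z \<partial>count_space (distinct_tuples k (atoms \<eta>))) \<partial>thin_kernel q \<xi>) =
    (\<integral>\<^sup>+z. f z * (\<Prod>i<k. ennreal (q (z i))) \<partial>count_space (distinct_tuples k (atoms \<xi>)))"
proof -
  let ?P = "PiM (atoms \<xi>) (\<lambda>z. measure_pmf (bernoulli_pmf (q z)))"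
  have ev: "{b \<in> space ?P. \<forall>i<k. b (z i)} \<in> sets ?P" if z: "z \<in> distinct_tuples k (atoms \<xi>)" for z
  proof -
    have ev1: "{b \<in> space ?P. b (z i)} \<in> sets ?P" if "i < k" for i
    proof -
      have "z i \<in> atoms \<xi>" using z that by (auto simp: distinct_tuples_def)
      then have "(\<lambda>b. b (z i)) \<in> measurable ?P (measure_pmf (bernoulli_pmf (q (z i))))"
        by (intro measurable_component_singleton) auto
      then have "(\<lambda>b. b (z i)) -` {True} \<inter> space ?P \<in> sets ?P"
        by (rule measurable_sets) simp
      also have "(\<lambda>b. b (z i)) -` {True} \<inter> space ?P = {b \<in> space ?P. b (z i)}" by auto
      finally show ?thesis .
    qed
    have "{b \<in> space ?P. \<forall>i\<in>{..<k}. b (z i)} \<in> sets ?P"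
      by (rule sets.sets_Collect_finite_All[OF ev1 finite_lessThan]) (simp only: lessThan_iff)
    then show ?thesis by (simp only: Ball_def lessThan_iff)
  qed
  have "(\<integral>\<^sup>+\<eta>. (\<integral>\<^sup>+z. f z \<partial>count_space (distinct_tuples k (atoms \<eta>))) \<partial>thin_kernel q \<xi>) =
      (\<integral>\<^sup>+b. (\<integral>\<^sup>+z. f z \<partial>count_space (distinct_tuples k {z \<in> atoms \<xi>. b z})) \<partial>?P)"
    unfolding thin_kernel_def
    using simple_configsE(1)[OF xi]
    using measurable_distinct_tuple_sum_dA[OF f]
    by (subst nn_integral_distr[OF measurable_thinning[OF xi]])
      (auto intro!: nn_integral_cong simp: subset_eq)
  also have "\<dots> = (\<integral>\<^sup>+b. (\<integral>\<^sup>+z. f z * indicator {b \<in> space ?P. \<forall>i<k. b (z i)} b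
      \<partial>count_space (distinct_tuples k (atoms \<xi>))) \<partial>?P)"
  proof (intro nn_integral_cong)
    fix b assume b: "b \<in> space ?P"
    have eq: "indicator (distinct_tuples k {z \<in> atoms \<xi>. b z}) z =
        indicator {b \<in> space ?P. \<forall>i<k. b (z i)} b * (indicator (distinct_tuples k (atoms \<xi>)) z :: ennreal)" for z
      using b by (simp add: indicator_def distinct_tuples_def PiE_iff) blast
    have "(\<integral>\<^sup>+z. f z \<partial>count_space (distinct_tuples k {z \<in> atoms \<xi>. b z})) =
        (\<integral>\<^sup>+z. f z * indicator (distinct_tuples k {z \<in> atoms \<xi>. b z}) z \<partial>count_space UNIV)"
      by (rule nn_integral_count_space_indicator) simp
    also have "\<dots> = (\<integral>\<^sup>+z. f z * indicator {b \<in> space ?P. \<forall>i<k. b (z i)} b *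
        indicator (distinct_tuples k (atoms \<xi>)) z \<partial>count_space UNIV)"
      by (simp only: eq mult.assoc)
    also have "\<dots> = (\<integral>\<^sup>+z. f z * indicator {b \<in> space ?P. \<forall>i<k. b (z i)} b
        \<partial>count_space (distinct_tuples k (atoms \<xi>)))"
      by (rule nn_integral_count_space_indicator[symmetric]) simp
    finally show "(\<integral>\<^sup>+z. f z \<partial>count_space (distinct_tuples k {z \<in> atoms \<xi>. b z})) =
      (\<integral>\<^sup>+z. f z * indicator {b \<in> space ?P. \<forall>i<k. b (z i)} b
        \<partial>count_space (distinct_tuples k (atoms \<xi>)))" .
  qed
  also have "\<dots> = (\<integral>\<^sup>+z. (\<integral>\<^sup>+b. f z * indicator {b \<in> space ?P. \<forall>i<k. b (z i)} b \<partial>?P)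
      \<partial>count_space (distinct_tuples k (atoms \<xi>)))"
  proof (rule nn_integral_count_space_nn_integral)
    show "countable (distinct_tuples k (atoms \<xi>))"
      by (intro countable_distinct_tuples countable_atoms[OF xi open_upper_half_plane])
    show "(\<lambda>b. f z * indicator {b \<in> space ?P. \<forall>i<k. b (z i)} b) \<in> borel_measurable ?P"
      if "z \<in> distinct_tuples k (atoms \<xi>)" for z
      by (intro borel_measurable_times_ennreal borel_measurable_const borel_measurable_indicator ev[OF that])
  qed
  also have "\<dots> = (\<integral>\<^sup>+z. f z * (\<Prod>i<k. ennreal (q (z i))) \<partial>count_space (distinct_tuples k (atoms \<xi>)))"
  proof (intro nn_integral_cong)
    fix z assume "z \<in> space (count_space (distinct_tuples k (atoms \<xi>)))"
    then have z: "z \<in> distinct_tuples k (atoms \<xi>)" by simp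
    have "(\<forall>i<k. b (z i)) \<longleftrightarrow> (\<forall>u\<in>z ` {..<k}. b u)" for b by auto
    then have "emeasure ?P {b \<in> space ?P. \<forall>i<k. b (z i)} = emeasure ?P {b \<in> space ?P. \<forall>u\<in>z ` {..<k}. b u}"
      by (simp only:)
    also have "\<dots> = (\<Prod>u\<in>z ` {..<k}. ennreal (q u))"
      using z simple_configsE(1)[OF xi] by (intro emeasure_coins q) (auto simp: distinct_tuples_def)
    also have "\<dots> = (\<Prod>i<k. ennreal (q (z i)))"
      using z by (subst prod.reindex) (auto simp: distinct_tuples_def)
    finally have e: "emeasure ?P {b \<in> space ?P. \<forall>i<k. b (z i)} = (\<Prod>i<k. ennreal (q (z i)))" .
    show "(\<integral>\<^sup>+b. f z * indicator {b \<in> space ?P. \<forall>i<k. b (z i)} b \<partial>?P) =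
        f z * (\<Prod>i<k. ennreal (q (z i)))"
      by (simp only: nn_integral_cmult_indicator[OF ev[OF z]] e)
  qed
  finally show ?thesis .
qed

lemma thinning_campbell:
  assumes P: "determinantal_law K P" and k: "k \<ge> 1" and f: "f \<in> borel_measurable (dA_power k)"
    and q: "q \<in> borel_measurable (restrict_space borel upper_half_plane)"
      "\<And>z. z \<in> upper_half_plane \<Longrightarrow> 0 \<le> q z \<and> q z \<le> 1"
  shows "(\<integral>\<^sup>+\<eta>. (\<integral>\<^sup>+z. f z \<partial>count_space (distinct_tuples k (atoms \<eta>))) \<partial>(P \<bind> thin_kernel q)) =
    (\<integral>\<^sup>+z. f z * (\<Prod>i<k. ennreal (q (z i))) * ennreal (Re (kernel_det K k z)) \<partial>dA_power k)"
proof -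
  have tk: "thin_kernel q \<in> measurable P (subprob_algebra N_H)"
    using measurable_prob_algebraD[OF measurable_thin_kernel[OF q]] determinantal_lawD(2)[OF P]
    by (simp cong: measurable_cong_sets)
  have [measurable]: "q \<in> borel_measurable dA" using q(1) by (simp cong: measurable_cong_sets add: sets_dA)
  have "(\<integral>\<^sup>+\<eta>. (\<integral>\<^sup>+z. f z \<partial>count_space (distinct_tuples k (atoms \<eta>))) \<partial>(P \<bind> thin_kernel q)) =
      (\<integral>\<^sup>+\<xi>. (\<integral>\<^sup>+\<eta>. (\<integral>\<^sup>+z. f z \<partial>count_space (distinct_tuples k (atoms \<eta>))) \<partial>thin_kernel q \<xi>) \<partial>P)"
    by (rule nn_integral_bind[OF measurable_distinct_tuple_sum_dA[OF f] tk])
  also have "\<dots> = (\<integral>\<^sup>+\<xi>. (\<integral>\<^sup>+z. f z * (\<Prod>i<k. ennreal (q (z i))) \<partial>count_space (distinct_tuples k (atoms \<xi>))) \<partial>P)"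
    using determinantal_lawD(3)[OF P] by (intro nn_integral_cong thin_kernel_tuple_sum q f) auto
  also have "\<dots> = (\<integral>\<^sup>+z. f z * (\<Prod>i<k. ennreal (q (z i))) * ennreal (Re (kernel_det K k z)) \<partial>dA_power k)"
    by (rule determinantal_campbell[OF P k]) (use f in measurable)
  finally show ?thesis .
qed

section \<open>Counting tuples of distinct points\<close>

text \<open>The last coordinate is drawn first, from \<open>S0\<close>, and the others from a set
  \<open>U a\<close> that may depend on it. With U a = S - {a} this counts distinct tuples; with U a
  the neighbours of a it groups tuples by their Palm point.\<close>

lemma distinct_tuples_Suc_bij:
  assumes "S0 \<subseteq> S" "\<And>a. a \<in> S0 \<Longrightarrow> U a \<subseteq> S - {a}"
  shows "bij_betw (\<lambda>(a, z). z(k := a)) (SIGMA a:S0. distinct_tuples k (U a))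
    {z \<in> distinct_tuples (Suc k) S. z k \<in> S0 \<and> (\<forall>i<k. z i \<in> U (z k))}"
  unfolding bij_betw_def
proof
  have US: "distinct_tuples k (U a) \<subseteq> PiE {..<k} (\<lambda>_. S)" if "a \<in> S0" for a
  proof -
    have "PiE {..<k} (\<lambda>_. U a) \<subseteq> PiE {..<k} (\<lambda>_. S)"
      using assms(2)[OF that] by (intro PiE_mono) blast
    then show ?thesis unfolding distinct_tuples_def by blast
  qed
  show "inj_on (\<lambda>(a, z). z(k := a)) (SIGMA a:S0. distinct_tuples k (U a))"
  proof (rule inj_onI, clarify)
    fix a z a' z'
    assume "z \<in> distinct_tuples k (U a)" "z' \<in> distinct_tuples k (U a')" "a \<in> S0" "a' \<in> S0"
      and eq: "z(k := a) = z'(k := a')"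
    then have "z \<in> PiE {..<k} (\<lambda>_. S)" "z' \<in> PiE {..<k} (\<lambda>_. S)" "a \<in> S" "a' \<in> S"
      using US assms(1) by blast+
    then show "a = a' \<and> z = z'"
      using inj_onD[OF inj_combinator[of k "{..<k}" "\<lambda>_. S"], of "(a, z)" "(a', z')"] eq by simp
  qed
  show "(\<lambda>(a, z). z(k := a)) ` (SIGMA a:S0. distinct_tuples k (U a)) =
      {z \<in> distinct_tuples (Suc k) S. z k \<in> S0 \<and> (\<forall>i<k. z i \<in> U (z k))}"
  proof (intro equalityI subsetI)
    fix y assume "y \<in> (\<lambda>(a, z). z(k := a)) ` (SIGMA a:S0. distinct_tuples k (U a))"
    then obtain a z where y: "y = z(k := a)" and a: "a \<in> S0" and z: "z \<in> distinct_tuples k (U a)" by auto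
    have zi: "z i \<in> U a" "z i \<in> S" "z i \<noteq> a" if "i < k" for i
      using z that assms(2)[OF a] by (auto simp: distinct_tuples_def PiE_iff)
    have "y \<in> PiE {..<Suc k} (\<lambda>_. S)"
      using z zi a assms(1) by (auto simp: y distinct_tuples_def PiE_iff extensional_def less_Suc_eq)
    moreover have "inj_on y {..<Suc k}"
    proof (rule inj_onI)
      fix i j assume "i \<in> {..<Suc k}" "j \<in> {..<Suc k}" "y i = y j"
      then show "i = j"
        using zi[of i] zi[of j] z by (auto simp: y distinct_tuples_def less_Suc_eq split: if_splits dest: inj_onD)
    qed
    ultimately show "y \<in> {z \<in> distinct_tuples (Suc k) S. z k \<in> S0 \<and> (\<forall>i<k. z i \<in> U (z k))}"
      using a zi by (simp add: distinct_tuples_def y)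
  next
    fix y assume "y \<in> {z \<in> distinct_tuples (Suc k) S. z k \<in> S0 \<and> (\<forall>i<k. z i \<in> U (z k))}"
    then have y: "y \<in> extensional {..<Suc k}" "inj_on y {..<Suc k}" "y k \<in> S0" "\<And>i. i < k \<Longrightarrow> y i \<in> U (y k)"
      by (auto simp: distinct_tuples_def PiE_iff)
    have "restrict y {..<k} \<in> distinct_tuples k (U (y k))"
      using y(2,4) by (auto simp: distinct_tuples_def inj_on_def)
    moreover have "y = (restrict y {..<k})(k := y k)"
      using y(1) by (auto simp: fun_eq_iff extensional_def)
    ultimately show "y \<in> (\<lambda>(a, z). z(k := a)) ` (SIGMA a:S0. distinct_tuples k (U a))"
      using y(3) by (intro image_eqI[where x = "(y k, restrict y {..<k})"]) auto
  qed
qed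

lemma finite_distinct_tuples: "finite S \<Longrightarrow> finite (distinct_tuples k S)"
  unfolding distinct_tuples_def by (rule finite_subset[of _ "PiE {..<k} (\<lambda>_. S)"]) (auto intro: finite_PiE)

lemma card_distinct_tuples:
  assumes "finite S"
  shows "card (distinct_tuples k S) = fact k * (card S choose k)"
  using assms
proof (induction k arbitrary: S)
  case 0
  have "distinct_tuples 0 S = {\<lambda>_. undefined}" by (auto simp: distinct_tuples_def)
  then show ?case by simp
next
  case (Suc k)
  have "{z \<in> distinct_tuples (Suc k) S. z k \<in> S \<and> (\<forall>i<k. z i \<in> S - {z k})} = distinct_tuples (Suc k) S"
    by (auto simp: distinct_tuples_def PiE_iff inj_on_def)
  then have "card (distinct_tuples (Suc k) S) = card (SIGMA a:S. distinct_tuples k (S - {a}))"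
    using bij_betw_same_card[OF distinct_tuples_Suc_bij[of S S "\<lambda>a. S - {a}" k]] by simp
  also have "\<dots> = (\<Sum>a\<in>S. card (distinct_tuples k (S - {a})))"
    using Suc.prems by (intro card_SigmaI) (auto intro: finite_distinct_tuples)
  also have "\<dots> = (\<Sum>a\<in>S. fact k * ((card S - 1) choose k))"
    using Suc by (intro sum.cong) auto
  also have "\<dots> = card S * (fact k * ((card S - 1) choose k))" by simp
  also have "\<dots> = fact k * (Suc k * (card S choose Suc k))"
    by (simp only: binomial_absorption mult.left_commute)
  finally show ?case by (simp add: algebra_simps)
qed

text \<open>There are k! times (n choose k) tuples for n points, so the factorials cancel and the
  series is the finite binomial expansion of (1 - 1)^n.\<close>

lemma void_inclusion_exclusion:
  assumes "finite S"
  shows "(\<lambda>k. (-1) ^ k / fact k * real (card (distinct_tuples k S))) sums (if S = {} then 1 else 0)"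
proof -
  have "(\<lambda>k. (-1) ^ k * real (card S choose k)) sums (\<Sum>k\<le>card S. (-1) ^ k * real (card S choose k))"
    by (rule sums_finite) (auto simp: not_le binomial_eq_0)
  also have "(\<Sum>k\<le>card S. (-1) ^ k * real (card S choose k)) = (if S = {} then 1 else 0)"
    using choose_alternating_sum[of "card S", where ?'a = real] assms by (auto simp: card_gt_0_iff)
  finally show ?thesis
    by (simp add: card_distinct_tuples[OF assms])
qed

text \<open>The bound C V^k makes the sum of absolute values at most C exp V, which justifies
  exchanging series and integral. The function h is given only as a pointwise sum; its measurability
  is part of the conclusion because this is how void probabilities become measurable in the
  height.\<close>

lemma alternating_expectation:
  fixes B :: "nat \<Rightarrow> 'a \<Rightarrow> ennreal"
  assumes [measurable]: "\<And>k. B k \<in> borel_measurable M"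
    and fin: "\<And>k x. x \<in> space M \<Longrightarrow> B k x < \<infinity>"
    and summ: "\<And>x. x \<in> space M \<Longrightarrow> summable (\<lambda>k. enn2real (B k x) / fact k)"
    and h: "\<And>x. x \<in> space M \<Longrightarrow> (\<lambda>k. (-1) ^ k / fact k * enn2real (B k x)) sums h x"
    and bound: "\<And>k. (\<integral>\<^sup>+x. B k x \<partial>M) \<le> ennreal (C * V ^ k)" and V: "0 \<le> C" "0 \<le> V"
  shows "(\<lambda>k. (-1) ^ k / fact k * enn2real (\<integral>\<^sup>+x. B k x \<partial>M)) sums (\<integral>x. h x \<partial>M) \<and> h \<in> borel_measurable M"
proof
  define f where "f k x = (-1) ^ k / fact k * enn2real (B k x)" for k x
  have fm [measurable]: "f k \<in> borel_measurable M" for k unfolding f_def by measurable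
  have Bint: "integrable M (\<lambda>x. enn2real (B k x))" "(\<integral>x. enn2real (B k x) \<partial>M) = enn2real (\<integral>\<^sup>+x. B k x \<partial>M)" for k
  proof -
    have eq: "(\<integral>\<^sup>+x. ennreal (enn2real (B k x)) \<partial>M) = (\<integral>\<^sup>+x. B k x \<partial>M)"
      using fin by (intro nn_integral_cong) auto
    have "(\<integral>\<^sup>+x. B k x \<partial>M) < \<infinity>" using bound[of k] by (rule order_le_less_trans) simp
    then show "integrable M (\<lambda>x. enn2real (B k x))"
      using eq by (intro integrableI_nonneg) auto
    show "(\<integral>x. enn2real (B k x) \<partial>M) = enn2real (\<integral>\<^sup>+x. B k x \<partial>M)"
      using eq by (subst integral_eq_nn_integral) auto
  qed
  have norm: "norm (f k x) = enn2real (B k x) / fact k" for k x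
    by (simp add: f_def abs_mult power_abs)
  have hs: "h x = (\<Sum>k. f k x)" if "x \<in> space M" for x
    using h[OF that] by (simp add: f_def sums_iff)
  have "(\<lambda>k. integral\<^sup>L M (f k)) sums (\<integral>x. (\<Sum>k. f k x) \<partial>M)"
  proof (rule sums_integral)
    show "integrable M (f k)" for k
      unfolding f_def using Bint(1) by (intro integrable_mult_right) auto
    show "AE x in M. summable (\<lambda>k. norm (f k x))"
      unfolding norm using summ by (intro AE_I2)
    show "summable (\<lambda>k. \<integral>x. norm (f k x) \<partial>M)"
    proof (rule summable_comparison_test')
      show "summable (\<lambda>k. C * (inverse (fact k) * V ^ k))"
        by (intro summable_mult summable_exp)
      fix k :: nat assume "k \<ge> 0"
      have "enn2real (\<integral>\<^sup>+x. B k x \<partial>M) \<le> C * V ^ k"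
        using bound[of k] V by (intro enn2real_leI) auto
      then show "norm (\<integral>x. norm (f k x) \<partial>M) \<le> C * (inverse (fact k) * V ^ k)"
        unfolding norm using Bint(2)[of k]
        by (simp add: divide_simps enn2real_nonneg)
    qed
  qed
  also have "(\<integral>x. (\<Sum>k. f k x) \<partial>M) = (\<integral>x. h x \<partial>M)"
    using hs by (intro Bochner_Integration.integral_cong) auto
  also have "(\<lambda>k. integral\<^sup>L M (f k)) = (\<lambda>k. (-1) ^ k / fact k * enn2real (\<integral>\<^sup>+x. B k x \<partial>M))"
    unfolding f_def by (simp only: integral_mult_right_zero Bint(2))
  finally show "(\<lambda>k. (-1) ^ k / fact k * enn2real (\<integral>\<^sup>+x. B k x \<partial>M)) sums (\<integral>x. h x \<partial>M)" .
  have "(\<lambda>x. \<Sum>k. f k x) \<in> borel_measurable M" by measurable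
  then show "h \<in> borel_measurable M"
    using hs by (subst measurable_cong) auto
qed

section \<open>Area measure on the half-plane\<close>

lemma lborel_complex: "distr (lborel \<Otimes>\<^sub>M lborel) borel (\<lambda>(x, y). Complex x y) = lborel"
proof (rule lborel_eqI[symmetric])
  have Cm [measurable]: "(\<lambda>(x, y). Complex x y) \<in> borel_measurable (borel \<Otimes>\<^sub>M borel)"
    by (simp add: complex_of_real_def[symmetric] Complex_eq)
  fix l u :: complex assume le: "\<And>b. b \<in> Basis \<Longrightarrow> l \<bullet> b \<le> u \<bullet> b"
  have "(\<lambda>(x, y). Complex x y) -` box l u \<inter> space (lborel \<Otimes>\<^sub>M lborel) = {Re l<..<Re u} \<times> {Im l<..<Im u}"
    by (auto simp: in_box_complex_iff space_pair_measure)
  then have "emeasure (distr (lborel \<Otimes>\<^sub>M lborel) borel (\<lambda>(x, y). Complex x y)) (box l u) =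
      emeasure (lborel \<Otimes>\<^sub>M lborel) ({Re l<..<Re u} \<times> {Im l<..<Im u})"
    by (subst emeasure_distr) auto
  also have "\<dots> = ennreal (Re u - Re l) * ennreal (Im u - Im l)"
    using le[of 1] le[of \<i>] by (simp add: lborel.emeasure_pair_measure_Times Basis_complex_def)
  also have "\<dots> = ennreal (\<Prod>b\<in>Basis. (u - l) \<bullet> b)"
    using le[of 1] le[of \<i>] by (simp add: Basis_complex_def ennreal_mult)
  finally show "emeasure (distr (lborel \<Otimes>\<^sub>M lborel) borel (\<lambda>(x, y). Complex x y)) (box l u) =
      ennreal (\<Prod>b\<in>Basis. (u - l) \<bullet> b)" .
qed simp

lemma nn_integral_dA:
  assumes "f \<in> borel_measurable dA"
  shows "(\<integral>\<^sup>+z. f z \<partial>dA) = (\<integral>\<^sup>+x. (\<integral>\<^sup>+y. f (Complex x y) * indicator {0<..} y \<partial>lborel) \<partial>lborel)"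
proof -
  have H [measurable]: "upper_half_plane \<in> sets borel"
    using open_upper_half_plane by simp
  have Cm [measurable]: "(\<lambda>(x, y). Complex x y) \<in> borel_measurable (borel \<Otimes>\<^sub>M borel)"
    by (simp add: complex_of_real_def[symmetric] Complex_eq)
  have [measurable]: "(\<lambda>z. f z * indicator upper_half_plane z) \<in> borel_measurable borel"
    using assms by (simp add: dA_def borel_measurable_restrict_space_iff_ennreal)
  have "(\<integral>\<^sup>+z. f z \<partial>dA) = (\<integral>\<^sup>+z. f z * indicator upper_half_plane z \<partial>lborel)"
    unfolding dA_def by (subst nn_integral_restrict_space) auto
  also have "\<dots> = (\<integral>\<^sup>+p. f (case p of (x, y) \<Rightarrow> Complex x y) * indicator upper_half_plane (case p of (x, y) \<Rightarrow> Complex x y) \<partial>(lborel \<Otimes>\<^sub>M lborel))"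
    by (subst lborel_complex[symmetric], subst nn_integral_distr) auto
  also have "\<dots> = (\<integral>\<^sup>+x. (\<integral>\<^sup>+y. f (Complex x y) * indicator upper_half_plane (Complex x y) \<partial>lborel) \<partial>lborel)"
    by (subst lborel.nn_integral_fst[symmetric]) auto
  finally show ?thesis
    by (simp add: upper_half_plane_def indicator_def)
qed

lemma distr_dA_translate: "distr dA dA (\<lambda>z. z + of_real x) = dA"
proof (rule measure_eqI)
  have H [measurable]: "upper_half_plane \<in> sets borel"
    using open_upper_half_plane by simp
  have T: "(\<lambda>z. z + complex_of_real x) \<in> measurable dA dA"
    unfolding dA_def
    by (intro measurable_restrict_space3) (auto simp: upper_half_plane_def)
  fix A assume "A \<in> sets (distr dA dA (\<lambda>z. z + complex_of_real x))"
  then have A: "A \<in> sets dA" by simp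
  then have A': "A \<in> sets borel" "A \<subseteq> upper_half_plane"
    by (auto simp: sets_dA sets_restrict_space_iff)
  have "emeasure (distr dA dA (\<lambda>z. z + complex_of_real x)) A = emeasure dA ((\<lambda>z. z + complex_of_real x) -` A \<inter> upper_half_plane)"
    using T A by (simp add: emeasure_distr)
  also have "(\<lambda>z. z + complex_of_real x) -` A \<inter> upper_half_plane = (\<lambda>z. z + complex_of_real x) -` A"
    using A'(2) by (auto simp: upper_half_plane_def)
  also have "emeasure dA ((\<lambda>z. z + complex_of_real x) -` A) = emeasure lborel ((\<lambda>z. z + complex_of_real x) -` A)"
    unfolding dA_def using A' by (intro emeasure_restrict_space) (auto simp: upper_half_plane_def)
  also have "\<dots> = emeasure (distr lborel borel ((+) (complex_of_real x))) A"
  proof -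
    have "(\<lambda>z. z + complex_of_real x) = (+) (complex_of_real x)" by (simp add: fun_eq_iff add.commute)
    then show ?thesis using A'(1) by (subst emeasure_distr) auto
  qed
  also have "\<dots> = emeasure dA A"
    unfolding lborel_distr_plus dA_def using A' by (intro emeasure_restrict_space[symmetric]) auto
  finally show "emeasure (distr dA dA (\<lambda>z. z + complex_of_real x)) A = emeasure dA A" .
qed simp

lemma nn_integral_dA_power_translate:
  assumes f: "f \<in> borel_measurable (dA_power k)"
  shows "(\<integral>\<^sup>+z. f z \<partial>dA_power k) = (\<integral>\<^sup>+z. f (\<lambda>i\<in>{..<k}. z i + of_real x) \<partial>dA_power k)"
proof -
  have T: "(\<lambda>z. z + complex_of_real x) \<in> measurable dA dA"
    unfolding dA_def by (intro measurable_restrict_space3) (auto simp: upper_half_plane_def)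
  have TP [measurable]: "(\<lambda>z. \<lambda>i\<in>{..<k}. z i + complex_of_real x) \<in> measurable (dA_power k) (dA_power k)"
  proof (rule measurable_restrict)
    show "(\<lambda>z. z i + complex_of_real x) \<in> measurable (dA_power k) dA" if "i \<in> {..<k}" for i
      using measurable_compose[OF measurable_component_singleton[OF that] T] .
  qed
  have "distr (dA_power k) (dA_power k) (\<lambda>z. \<lambda>i\<in>{..<k}. z i + complex_of_real x) = dA_power k"
  proof (rule dA.PiM_eqI)
    fix A assume A: "\<And>i. i \<in> {..<k} \<Longrightarrow> A i \<in> sets dA"
    have A': "(\<lambda>z. z + complex_of_real x) -` A i \<inter> space dA \<in> sets dA" if "i < k" for i
      using measurable_sets[OF T A[of i]] that by simp
    have "(\<lambda>z. \<lambda>i\<in>{..<k}. z i + complex_of_real x) -` Pi\<^sub>E {..<k} A \<inter> space (dA_power k) =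
        Pi\<^sub>E {..<k} (\<lambda>i. (\<lambda>z. z + complex_of_real x) -` A i \<inter> space dA)"
      by (auto simp: space_PiM PiE_iff)
    then have "emeasure (distr (dA_power k) (dA_power k) (\<lambda>z. \<lambda>i\<in>{..<k}. z i + complex_of_real x)) (Pi\<^sub>E {..<k} A) =
        emeasure (dA_power k) (Pi\<^sub>E {..<k} (\<lambda>i. (\<lambda>z. z + complex_of_real x) -` A i \<inter> space dA))"
      using A by (subst emeasure_distr[OF TP]) (auto intro!: sets_PiM_I_finite)
    also have "\<dots> = (\<Prod>i<k. emeasure dA ((\<lambda>z. z + complex_of_real x) -` A i \<inter> space dA))"
      using A' by (intro dA.emeasure_PiM) auto
    also have "\<dots> = (\<Prod>i<k. emeasure (distr dA dA (\<lambda>z. z + complex_of_real x)) (A i))"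
      using A by (intro prod.cong refl) (simp add: emeasure_distr[OF T])
    finally show "emeasure (distr (dA_power k) (dA_power k) (\<lambda>z. \<lambda>i\<in>{..<k}. z i + complex_of_real x)) (Pi\<^sub>E {..<k} A) =
        (\<Prod>i<k. emeasure dA (A i))"
      by (simp add: distr_dA_translate)
  qed auto
  then have "(\<integral>\<^sup>+z. f z \<partial>dA_power k) = (\<integral>\<^sup>+z. f z \<partial>distr (dA_power k) (dA_power k) (\<lambda>z. \<lambda>i\<in>{..<k}. z i + complex_of_real x))"
    by simp
  also have "\<dots> = (\<integral>\<^sup>+z. f (\<lambda>i\<in>{..<k}. z i + of_real x) \<partial>dA_power k)"
    using f by (intro nn_integral_distr[OF TP]) simp
  finally show ?thesis .
qed

section \<open>Laws with thinned determinantal moments\<close>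

text \<open>The common form of \<open>law_M\<close>, with K = \<open>K_H\<close>, and of the Palm
  laws, with K the Palm kernel at i y. Keeping the weights apart from the determinant removes the
  square roots, and k = 0 is included because inclusion-exclusion starts there.\<close>

definition thinned_law :: "(real \<Rightarrow> real) \<Rightarrow> (complex \<Rightarrow> complex \<Rightarrow> complex) \<Rightarrow> complex measure measure \<Rightarrow> bool" where
  "thinned_law w K P \<longleftrightarrow> prob_space P \<and> sets P = sets N_H \<and>
    (\<forall>k. \<forall>f\<in>borel_measurable (dA_power k).
      (\<integral>\<^sup>+\<xi>. (\<integral>\<^sup>+z. f z \<partial>count_space (distinct_tuples k (atoms \<xi>))) \<partial>P) =
      (\<integral>\<^sup>+z. f z * (\<Prod>i<k. ennreal (w (Im (z i)))) * ennreal (Re (kernel_det K k z)) \<partial>dA_power k))"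

lemma thinned_lawD:
  assumes "thinned_law w K P"
  shows "prob_space P" "sets P = sets N_H" "space P = simple_configs upper_half_plane"
    "f \<in> borel_measurable (dA_power k) \<Longrightarrow>
      (\<integral>\<^sup>+\<xi>. (\<integral>\<^sup>+z. f z \<partial>count_space (distinct_tuples k (atoms \<xi>))) \<partial>P) =
      (\<integral>\<^sup>+z. f z * (\<Prod>i<k. ennreal (w (Im (z i)))) * ennreal (Re (kernel_det K k z)) \<partial>dA_power k)"
  using assms sets_eq_imp_space_eq[of P N_H] by (auto simp: thinned_law_def)

lemma distinct_tuples_0: "distinct_tuples 0 S = {\<lambda>_. undefined}"
  by (auto simp: distinct_tuples_def)

text \<open>\<open>determinantal_law\<close> speaks of k \<ge> 1. For k = 0 there is one empty tuple
  and the determinant is 1, so the moment formula is normalisation of the law.\<close>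

lemma moment_0:
  assumes "prob_space P"
  shows "(\<integral>\<^sup>+\<xi>. (\<integral>\<^sup>+z. f z \<partial>count_space (distinct_tuples 0 (atoms \<xi>))) \<partial>P) =
    (\<integral>\<^sup>+z. f z * (\<Prod>i<0. ennreal (w (Im (z i)))) * ennreal (Re (kernel_det K 0 z)) \<partial>dA_power 0)"
  using assms by (simp add: distinct_tuples_0 nn_integral_count_space_finite dA.nn_integral_empty
    prob_space.emeasure_space_1)

lemma measurable_dA_component:
  assumes "f \<in> measurable dA N" "i < k"
  shows "(\<lambda>z. f (z i)) \<in> measurable (dA_power k) N"
proof -
  have "(\<lambda>z. z i) \<in> measurable (dA_power k) dA"
    using assms(2) by (intro measurable_component_singleton) simp
  from measurable_compose[OF this assms(1)] show ?thesis .
qed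

lemma measurable_dA_Re: "Re \<in> borel_measurable dA" and measurable_dA_Im: "Im \<in> borel_measurable dA"
  unfolding measurable_cong_sets[OF sets_dA refl] by (rule measurable_restrict_space1, simp)+

lemma weights_measurable:
  assumes "w \<in> weights \<alpha> \<beta>"
  shows "(\<lambda>z. w (Im z)) \<in> borel_measurable (restrict_space borel upper_half_plane)"
proof -
  have "Im \<in> measurable (restrict_space borel upper_half_plane) (restrict_space borel {0<..})"
    by (intro measurable_restrict_space3) (auto simp: upper_half_plane_def)
  then show ?thesis using assms by (auto simp: weights_def intro: measurable_compose)
qed

lemma weights_bounds:
  assumes "w \<in> weights \<alpha> \<beta>"
  shows "y > 0 \<Longrightarrow> 0 \<le> w y" "y > 0 \<Longrightarrow> w y \<le> 1" "y > 0 \<Longrightarrow> y \<notin> {\<alpha>..\<beta>} \<Longrightarrow> w y = 0"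
  using assms by (auto simp: weights_def)

lemma thinned_law_law_M:
  assumes P: "determinantal_law K P" and w: "w \<in> weights \<alpha> \<beta>"
  shows "thinned_law w K (law_M w P)"
proof -
  have q: "(\<lambda>z. w (Im z)) \<in> borel_measurable (restrict_space borel upper_half_plane)"
    "\<And>z. z \<in> upper_half_plane \<Longrightarrow> 0 \<le> w (Im z) \<and> w (Im z) \<le> 1"
    using weights_measurable[OF w] weights_bounds[OF w] by (auto simp: upper_half_plane_def)
  have tk: "thin_kernel (\<lambda>z. w (Im z)) \<in> measurable P (subprob_algebra N_H)"
    using measurable_prob_algebraD[OF measurable_thin_kernel[OF q]] determinantal_lawD(2)[OF P]
    by (simp cong: measurable_cong_sets)
  interpret P: prob_space P by (rule determinantal_lawD(1)[OF P])
  have "prob_space (law_M w P)"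
    unfolding law_M_def using thin_kernel_prob(1) determinantal_lawD(3)[OF P]
    by (intro P.prob_space_bind[OF _ tk] AE_I2) simp
  moreover have "sets (law_M w P) = sets N_H"
    unfolding law_M_def using thin_kernel_prob(2) determinantal_lawD(3)[OF P]
    by (intro sets_bind P.not_empty) simp
  moreover have "(\<integral>\<^sup>+\<xi>. (\<integral>\<^sup>+z. f z \<partial>count_space (distinct_tuples k (atoms \<xi>))) \<partial>law_M w P) =
      (\<integral>\<^sup>+z. f z * (\<Prod>i<k. ennreal (w (Im (z i)))) * ennreal (Re (kernel_det K k z)) \<partial>dA_power k)"
    if f: "f \<in> borel_measurable (dA_power k)" for f k
  proof (cases "k = 0")
    case True
    then show ?thesis using moment_0[OF calculation(1)] by simp
  next
    case False
    then show ?thesis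
      unfolding law_M_def using thinning_campbell[OF P _ f q] by simp
  qed
  ultimately show ?thesis unfolding thinned_law_def by blast
qed

lemma thinned_law_palm:
  assumes P: "determinantal_law (thinned_palm_kernel w y) P" and w: "w \<in> weights \<alpha> \<beta>"
  shows "thinned_law w (palm_kernel K_H (\<i> * of_real y)) P"
proof -
  have "(\<integral>\<^sup>+\<xi>. (\<integral>\<^sup>+z. f z \<partial>count_space (distinct_tuples k (atoms \<xi>))) \<partial>P) =
      (\<integral>\<^sup>+z. f z * (\<Prod>i<k. ennreal (w (Im (z i)))) * ennreal (Re (kernel_det (palm_kernel K_H (\<i> * of_real y)) k z)) \<partial>dA_power k)"
    if f: "f \<in> borel_measurable (dA_power k)" for f k
  proof (cases "k = 0")
    case True
    then show ?thesis using moment_0[OF determinantal_lawD(1)[OF P]] by simp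
  next
    case False
    have "(\<integral>\<^sup>+\<xi>. (\<integral>\<^sup>+z. f z \<partial>count_space (distinct_tuples k (atoms \<xi>))) \<partial>P) =
        (\<integral>\<^sup>+z. f z * ennreal (Re (kernel_det (thinned_palm_kernel w y) k z)) \<partial>dA_power k)"
      using False by (intro determinantal_campbell[OF P _ f]) simp
    also have "\<dots> = (\<integral>\<^sup>+z. f z * (\<Prod>i<k. ennreal (w (Im (z i)))) * ennreal (Re (kernel_det (palm_kernel K_H (\<i> * of_real y)) k z)) \<partial>dA_power k)"
    proof (rule nn_integral_cong)
      fix z assume z: "z \<in> space (dA_power k)"
      have wz: "w (Im (z i)) \<ge> 0" if "i < k" for i
        using z that weights_bounds(1)[OF w, of "Im (z i)"]
        by (auto simp: space_PiM PiE_iff upper_half_plane_def)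
      have "thinned_palm_kernel w y = (\<lambda>z \<zeta>. of_real (sqrt (w (Im z))) * palm_kernel K_H (\<i> * of_real y) z \<zeta> * of_real (sqrt (w (Im \<zeta>))))"
        by (intro ext) (simp add: thinned_palm_kernel_def)
      then have "kernel_det (thinned_palm_kernel w y) k z =
          of_real (\<Prod>i<k. (sqrt (w (Im (z i))))\<^sup>2) * kernel_det (palm_kernel K_H (\<i> * of_real y)) k z"
        by (simp only: kernel_det_scale[where g = "\<lambda>z. sqrt (w (Im z))"])
      also have "(\<Prod>i<k. (sqrt (w (Im (z i))))\<^sup>2) = (\<Prod>i<k. w (Im (z i)))"
        using wz by (intro prod.cong) auto
      finally have *: "Re (kernel_det (thinned_palm_kernel w y) k z) =
          (\<Prod>i<k. w (Im (z i))) * Re (kernel_det (palm_kernel K_H (\<i> * of_real y)) k z)"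
        by (simp del: of_real_prod)
      \<comment> \<open>The nonnegative weights factor out of \<open>ennreal\<close> whatever the
        sign of the determinant: where it is negative, both sides are 0.\<close>
      have "ennreal (Re (kernel_det (thinned_palm_kernel w y) k z)) =
          ennreal (\<Prod>i<k. w (Im (z i))) * ennreal (Re (kernel_det (palm_kernel K_H (\<i> * of_real y)) k z))"
      proof -
        have "0 \<le> (\<Prod>i<k. w (Im (z i)))" using wz by (intro prod_nonneg) auto
        with * show ?thesis by (simp only: ennreal_mult')
      qed
      also have "ennreal (\<Prod>i<k. w (Im (z i))) = (\<Prod>i<k. ennreal (w (Im (z i))))"
        using wz by (intro prod_ennreal[symmetric]) auto
      finally show "f z * ennreal (Re (kernel_det (thinned_palm_kernel w y) k z)) =
          f z * (\<Prod>i<k. ennreal (w (Im (z i)))) * ennreal (Re (kernel_det (palm_kernel K_H (\<i> * of_real y)) k z))"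
        by (simp add: mult.assoc)
    qed
    finally show ?thesis .
  qed
  then show ?thesis
    using determinantal_lawD[OF P] unfolding thinned_law_def by blast
qed

text \<open>Here f marks forbidden tuples: if the expected sum of f over tuples is 0, almost surely
  none of them occurs.\<close>

lemma thinned_law_AE:
  assumes P: "thinned_law w K P" and f: "f \<in> borel_measurable (dA_power k)"
    and zero: "(\<integral>\<^sup>+z. f z * (\<Prod>i<k. ennreal (w (Im (z i)))) * ennreal (Re (kernel_det K k z)) \<partial>dA_power k) = 0"
  shows "AE \<xi> in P. \<forall>z\<in>distinct_tuples k (atoms \<xi>). f z = 0"
proof -
  have "(\<lambda>\<xi>. \<integral>\<^sup>+z. f z \<partial>count_space (distinct_tuples k (atoms \<xi>))) \<in> borel_measurable P"
    using measurable_distinct_tuple_sum_dA[OF f] by (simp cong: measurable_cong_sets add: thinned_lawD(2)[OF P])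
  then have "AE \<xi> in P. (\<integral>\<^sup>+z. f z \<partial>count_space (distinct_tuples k (atoms \<xi>))) = 0"
    using thinned_lawD(4)[OF P f] zero by (simp add: nn_integral_0_iff_AE)
  then show ?thesis
    by eventually_elim (simp add: nn_integral_0_iff_AE AE_count_space)
qed

section \<open>Strips over sets of reals\<close>

definition strip :: "real \<Rightarrow> real \<Rightarrow> real set \<Rightarrow> complex set" where
  "strip \<alpha> \<beta> A = {z. Re z \<in> A \<and> \<alpha> \<le> Im z \<and> Im z \<le> \<beta>}"

lemma strip_sets:
  assumes "0 < \<alpha>" "A \<in> sets borel"
  shows "strip \<alpha> \<beta> A \<in> sets borel" "strip \<alpha> \<beta> A \<in> sets dA" "strip \<alpha> \<beta> A \<subseteq> upper_half_plane"
proof -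
  show sub: "strip \<alpha> \<beta> A \<subseteq> upper_half_plane" using assms(1) by (auto simp: strip_def upper_half_plane_def)
  have [measurable]: "Re \<in> borel_measurable borel" "Im \<in> borel_measurable borel" "A \<in> sets borel"
    using assms(2) by auto
  have "{z \<in> space borel. Re z \<in> A \<and> \<alpha> \<le> Im z \<and> Im z \<le> \<beta>} \<in> sets (borel :: complex measure)"
    by measurable
  then show b: "strip \<alpha> \<beta> A \<in> sets borel" by (simp add: strip_def)
  then show "strip \<alpha> \<beta> A \<in> sets dA"
    using sub open_upper_half_plane by (simp add: sets_dA sets_restrict_space_iff)
qed

text \<open>The lower bound \<alpha> > 0 on heights keeps the strip off the real axis and \<beta>
  bounds it above, so over a bounded A it sits in a closed rectangle. This supplies the compact sets
  on which configurations are finite.\<close>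

lemma strip_compact:
  assumes "0 < \<alpha>" "bounded A"
  obtains C where "compact C" "C \<subseteq> upper_half_plane" "strip \<alpha> \<beta> A \<subseteq> C"
proof -
  obtain r where r: "\<And>x. x \<in> A \<Longrightarrow> \<bar>x\<bar> \<le> r" using assms(2) by (auto simp: bounded_iff)
  show thesis
  proof (rule that)
    show "compact (cbox (Complex (- r) \<alpha>) (Complex r \<beta>))" by (rule compact_cbox)
    show "cbox (Complex (- r) \<alpha>) (Complex r \<beta>) \<subseteq> upper_half_plane"
      using assms(1) by (auto simp: in_cbox_complex_iff upper_half_plane_def)
    show "strip \<alpha> \<beta> A \<subseteq> cbox (Complex (- r) \<alpha>) (Complex r \<beta>)"
      using r by (force simp: strip_def in_cbox_complex_iff abs_le_iff)
  qed
qed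

lemma finite_atoms_strip:
  assumes "\<xi> \<in> simple_configs upper_half_plane" "0 < \<alpha>" "bounded A"
  shows "finite (atoms \<xi> \<inter> strip \<alpha> \<beta> A)"
proof -
  obtain C where "compact C" "C \<subseteq> upper_half_plane" "strip \<alpha> \<beta> A \<subseteq> C"
    by (rule strip_compact[OF assms(2,3)])
  then show ?thesis
    using simple_configsE(3)[OF assms(1)] by (meson Int_mono finite_subset order_refl)
qed

lemma emeasure_dA_strip_finite:
  assumes "0 < \<alpha>" "bounded A" "A \<in> sets borel"
  shows "emeasure dA (strip \<alpha> \<beta> A) < \<infinity>"
proof -
  obtain C where C: "compact C" "C \<subseteq> upper_half_plane" "strip \<alpha> \<beta> A \<subseteq> C"
    by (rule strip_compact[OF assms(1,2)])
  have "emeasure dA (strip \<alpha> \<beta> A) = emeasure lborel (strip \<alpha> \<beta> A)"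
    unfolding dA_def using strip_sets[OF assms(1,3)] open_upper_half_plane by (intro emeasure_restrict_space) auto
  also have "\<dots> \<le> emeasure lborel C"
    using C by (intro emeasure_mono) (auto simp: borel_compact)
  also have "\<dots> < \<infinity>" using C(1) by (rule emeasure_compact_finite)
  finally show ?thesis .
qed

section \<open>Projection to the real line\<close>

definition proj_config :: "complex measure \<Rightarrow> real measure" where
  "proj_config \<xi> = (if proj_Re \<xi> \<in> simple_configs UNIV then proj_Re \<xi> else null_measure borel)"

lemma emeasure_proj_Re:
  assumes xi: "\<xi> \<in> simple_configs upper_half_plane" and A: "A \<in> sets borel"
  shows "emeasure (proj_Re \<xi>) A = emeasure (count_space UNIV) (atoms \<xi> \<inter> Re -` A)"
    "emeasure (proj_Re \<xi>) A = emeasure \<xi> (Re -` A \<inter> upper_half_plane)"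
    "Re -` A \<inter> upper_half_plane \<in> sets (restrict_space borel upper_half_plane)"
proof -
  have Re: "Re \<in> measurable (restrict_space borel upper_half_plane) borel"
    by (rule measurable_restrict_space1) simp
  show s: "Re -` A \<inter> upper_half_plane \<in> sets (restrict_space borel upper_half_plane)"
    using measurable_sets[OF Re A] by (simp add: space_restrict_space)
  have "Re \<in> measurable \<xi> borel"
    using Re by (simp cong: measurable_cong_sets add: simple_configsE(5)[OF xi])
  then show e: "emeasure (proj_Re \<xi>) A = emeasure \<xi> (Re -` A \<inter> upper_half_plane)"
    unfolding proj_Re_def using A by (simp add: emeasure_distr simple_configsE(4)[OF xi])
  have "atoms \<xi> \<inter> (Re -` A \<inter> upper_half_plane) = atoms \<xi> \<inter> Re -` A"
    using simple_configsE(1)[OF xi] by auto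
  then show "emeasure (proj_Re \<xi>) A = emeasure (count_space UNIV) (atoms \<xi> \<inter> Re -` A)"
    unfolding e using emeasure_simple_configs[OF xi s] by simp
qed

lemma restrict_space_UNIV_borel: "restrict_space borel (UNIV :: real set) = borel"
  by (rule measure_eqI) (auto simp: sets_restrict_space emeasure_restrict_space)

lemma null_measure_config: "null_measure borel = point_measure_on UNIV ({} :: real set)"
  "null_measure (borel :: real measure) \<in> simple_configs UNIV"
proof -
  show eq: "null_measure borel = point_measure_on UNIV ({} :: real set)"
    by (rule measure_eqI) (auto simp: restrict_space_UNIV_borel emeasure_point_measure_on)
  show "null_measure (borel :: real measure) \<in> simple_configs UNIV"
    unfolding eq by (rule point_measure_on_in_simple_configs) auto
qed

lemma proj_Re_eq:
  assumes xi: "\<xi> \<in> simple_configs upper_half_plane" and inj: "inj_on Re (atoms \<xi>)"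
  shows "proj_Re \<xi> = point_measure_on UNIV (Re ` atoms \<xi>)"
proof (rule measure_eqI)
  show "sets (proj_Re \<xi>) = sets (point_measure_on UNIV (Re ` atoms \<xi>))"
    by (simp add: proj_Re_def restrict_space_UNIV_borel)
  fix A assume "A \<in> sets (proj_Re \<xi>)"
  then have A: "A \<in> sets borel" by (simp add: proj_Re_def)
  have "inj_on Re (atoms \<xi> \<inter> Re -` A)" using inj by (rule inj_on_subset) auto
  moreover have "Re ` (atoms \<xi> \<inter> Re -` A) = Re ` atoms \<xi> \<inter> A" by auto
  ultimately have bij: "bij_betw Re (atoms \<xi> \<inter> Re -` A) (Re ` atoms \<xi> \<inter> A)" by (simp add: bij_betw_def)
  have "emeasure (count_space UNIV) (atoms \<xi> \<inter> Re -` A) = emeasure (count_space UNIV) (Re ` atoms \<xi> \<inter> A)"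
    using bij_betw_same_card[OF bij] bij_betw_finite[OF bij] by (simp add: emeasure_count_space)
  also have "\<dots> = emeasure (point_measure_on UNIV (Re ` atoms \<xi>)) A"
    using A by (subst emeasure_point_measure_on) (auto simp: restrict_space_UNIV_borel emeasure_count_space)
  finally show "emeasure (proj_Re \<xi>) A = emeasure (point_measure_on UNIV (Re ` atoms \<xi>)) A"
    by (simp add: emeasure_proj_Re(1)[OF xi A])
qed

text \<open>Two atoms on one vertical line would give the projection mass 2 at a point, and the
  intervals [-n, n] exhaust the compact sets. The point of this form is that both conditions are
  measurable in \<xi>.\<close>

lemma proj_Re_simple_iff:
  assumes xi: "\<xi> \<in> simple_configs upper_half_plane"
  shows "proj_Re \<xi> \<in> simple_configs UNIV \<longleftrightarrow>
    inj_on Re (atoms \<xi>) \<and> (\<forall>n::nat. emeasure \<xi> (Re -` {- real n..real n} \<inter> upper_half_plane) < \<infinity>)"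
proof
  assume p: "proj_Re \<xi> \<in> simple_configs UNIV"
  show "inj_on Re (atoms \<xi>) \<and> (\<forall>n::nat. emeasure \<xi> (Re -` {- real n..real n} \<inter> upper_half_plane) < \<infinity>)"
  proof
    show "inj_on Re (atoms \<xi>)"
    proof (rule inj_onI, rule ccontr)
      fix u v assume uv: "u \<in> atoms \<xi>" "v \<in> atoms \<xi>" "Re u = Re v" "u \<noteq> v"
      have "(2::ennreal) = emeasure (count_space UNIV) {u, v}"
        using uv(4) by (simp add: emeasure_count_space_finite)
      also have "\<dots> \<le> emeasure (count_space UNIV) (atoms \<xi> \<inter> Re -` {Re u})"
        using uv by (intro emeasure_mono) auto
      also have "\<dots> = emeasure (proj_Re \<xi>) {Re u}" by (simp add: emeasure_proj_Re(1)[OF xi])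
      also have "\<dots> = emeasure (count_space UNIV) (atoms (proj_Re \<xi>) \<inter> {Re u})"
        by (rule emeasure_simple_configs[OF p]) (simp add: restrict_space_UNIV_borel)
      also have "\<dots> \<le> emeasure (count_space UNIV) {Re u}" by (intro emeasure_mono) auto
      also have "\<dots> = 1" by (simp add: emeasure_count_space_finite)
      finally show False by simp
    qed
    show "\<forall>n::nat. emeasure \<xi> (Re -` {- real n..real n} \<inter> upper_half_plane) < \<infinity>"
    proof
      fix n :: nat
      have "emeasure (proj_Re \<xi>) {- real n..real n} < \<infinity>"
        using emeasure_simple_configs_compact(2)[OF p, of "{- real n..real n}" "{- real n..real n}"]
        by (simp add: restrict_space_UNIV_borel less_top[symmetric])
      then show "emeasure \<xi> (Re -` {- real n..real n} \<inter> upper_half_plane) < \<infinity>"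
        using emeasure_proj_Re(2)[OF xi, of "{- real n..real n}"] by simp
    qed
  qed
next
  assume r: "inj_on Re (atoms \<xi>) \<and> (\<forall>n::nat. emeasure \<xi> (Re -` {- real n..real n} \<inter> upper_half_plane) < \<infinity>)"
  have "finite (Re ` atoms \<xi> \<inter> C)" if cC: "compact C" for C
  proof -
    obtain b where b: "\<And>x. x \<in> C \<Longrightarrow> \<bar>x\<bar> \<le> b" using compact_imp_bounded[OF cC] by (auto simp: bounded_iff)
    obtain n :: nat where n: "b \<le> real n" using real_arch_simple by blast
    have "emeasure (count_space UNIV) (atoms \<xi> \<inter> Re -` {- real n..real n}) < \<infinity>"
      using r emeasure_proj_Re[OF xi, of "{- real n..real n}"] by (metis atLeastAtMost_borel)
    then have "finite (atoms \<xi> \<inter> Re -` {- real n..real n})"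
      by (simp add: emeasure_count_space split: if_splits)
    moreover have "Re ` atoms \<xi> \<inter> C \<subseteq> Re ` (atoms \<xi> \<inter> Re -` {- real n..real n})"
      using b n by (fastforce simp: abs_le_iff)
    ultimately show ?thesis by (meson finite_imageI finite_subset)
  qed
  then show "proj_Re \<xi> \<in> simple_configs UNIV"
    using r by (simp add: proj_Re_eq[OF xi] point_measure_on_in_simple_configs)
qed

text \<open>As a vanishing sum over pairs, injectivity is measurable in the configuration and is
  controlled by the second factorial moment.\<close>

lemma inj_on_Re_iff:
  "inj_on Re S \<longleftrightarrow> (\<integral>\<^sup>+z. indicator {z. Re (z 0) = Re (z 1)} z \<partial>count_space (distinct_tuples 2 S)) = 0"
proof
  assume inj: "inj_on Re S"
  have "Re (z 0) \<noteq> Re (z 1)" if "z \<in> distinct_tuples 2 S" for z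
  proof
    assume eq: "Re (z 0) = Re (z 1)"
    have zS: "z i \<in> S" if "i < 2" for i
      using \<open>z \<in> distinct_tuples 2 S\<close> that unfolding distinct_tuples_def by (blast intro: PiE_mem)
    have zinj: "inj_on z {..<2}" using that unfolding distinct_tuples_def by blast
    have "z 0 = z 1" by (rule inj_onD[OF inj eq]) (rule zS, simp)+
    then show False using inj_onD[OF zinj, of 0 1] by simp
  qed
  then show "(\<integral>\<^sup>+z. indicator {z. Re (z 0) = Re (z 1)} z \<partial>count_space (distinct_tuples 2 S)) = 0"
    by (simp add: nn_integral_0_iff_AE AE_count_space)
next
  assume "(\<integral>\<^sup>+z. indicator {z. Re (z 0) = Re (z 1)} z \<partial>count_space (distinct_tuples 2 S)) = 0"
  then have *: "Re (z 0) \<noteq> Re (z 1)" if "z \<in> distinct_tuples 2 S" for z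
    using that by (auto simp: nn_integral_0_iff_AE AE_count_space)
  show "inj_on Re S"
  proof (rule inj_onI, rule ccontr)
    fix u v assume uv: "u \<in> S" "v \<in> S" "Re u = Re v" "u \<noteq> v"
    then have "(\<lambda>i\<in>{..<2::nat}. if i = 0 then u else v) \<in> distinct_tuples 2 S"
      by (auto simp: distinct_tuples_def inj_on_def)
    from *[OF this] show False using uv by simp
  qed
qed

lemma measurable_Re_diag: "(\<lambda>z. indicator {z. Re (z 0) = Re (z 1)} z :: ennreal) \<in> borel_measurable (dA_power 2)"
proof -
  have "{z \<in> space (dA_power 2). Re (z 0) = Re (z 1)} \<in> sets (dA_power 2)"
    by (intro borel_measurable_eq measurable_dA_component measurable_dA_Re) auto
  then have "(\<lambda>z. indicator {z \<in> space (dA_power 2). Re (z 0) = Re (z 1)} z :: ennreal) \<in> borel_measurable (dA_power 2)"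
    by (rule borel_measurable_indicator)
  then show ?thesis
    by (rule measurable_cong[THEN iffD1, rotated]) (simp add: indicator_def)
qed

lemma measurable_Re_vimage: "A \<in> sets borel \<Longrightarrow> Re -` A \<inter> upper_half_plane \<in> sets (restrict_space borel upper_half_plane)"
  using measurable_sets[OF measurable_dA_Re, of A] by (simp add: sets_dA)

lemma measurable_proj_simple: "Measurable.pred N_H (\<lambda>\<xi>. proj_Re \<xi> \<in> simple_configs UNIV)"
proof -
  have [measurable]: "(\<lambda>\<xi>. emeasure \<xi> (Re -` A \<inter> upper_half_plane)) \<in> borel_measurable N_H" if "A \<in> sets borel" for A
    by (intro measurable_config_emeasure open_upper_half_plane measurable_Re_vimage that)
  have [measurable]: "(\<lambda>\<xi>. \<integral>\<^sup>+z. indicator {z. Re (z 0) = Re (z 1)} z \<partial>count_space (distinct_tuples 2 (atoms \<xi>))) \<in> borel_measurable N_H"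
    by (rule measurable_distinct_tuple_sum_dA[OF measurable_Re_diag])
  have "Measurable.pred N_H (\<lambda>\<xi>. (\<integral>\<^sup>+z. indicator {z. Re (z 0) = Re (z 1)} z \<partial>count_space (distinct_tuples 2 (atoms \<xi>))) = 0
      \<and> (\<forall>n::nat. emeasure \<xi> (Re -` {- real n..real n} \<inter> upper_half_plane) < \<infinity>))"
    by measurable
  then show ?thesis
    by (rule measurable_cong[THEN iffD1, rotated]) (simp add: proj_Re_simple_iff inj_on_Re_iff)
qed

lemma measurable_proj_config: "proj_config \<in> measurable N_H N_R"
proof (rule measurable_sigma_sets[OF sets_config_space_void_events[OF open_UNIV] void_events_subset])
  show "proj_config \<in> space N_H \<rightarrow> simple_configs UNIV"
    using null_measure_config(2) by (auto simp: proj_config_def)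
  note [measurable] = measurable_proj_simple
  fix y :: "real measure set" assume "y \<in> void_events UNIV"
  then obtain A where A: "y = {\<xi> \<in> simple_configs UNIV. emeasure \<xi> A = 0}" "A \<in> sets borel"
    unfolding void_events_def by blast
  have [measurable]: "(\<lambda>\<xi>. emeasure \<xi> (Re -` A \<inter> upper_half_plane)) \<in> borel_measurable N_H"
    by (intro measurable_config_emeasure open_upper_half_plane measurable_Re_vimage A)
  \<comment> \<open>Configurations with a bad projection are sent to the null measure, which is void
    on every A; hence the implication.\<close>
  have "proj_config -` y \<inter> space N_H = {\<xi> \<in> space N_H. proj_Re \<xi> \<in> simple_configs UNIV \<longrightarrow>
      emeasure \<xi> (Re -` A \<inter> upper_half_plane) = 0}"
    using null_measure_config(2) emeasure_proj_Re(2)[OF _ A(2)] by (auto simp: proj_config_def A(1))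
  also have "\<dots> \<in> sets N_H"
    by measurable
  finally show "proj_config -` y \<inter> space N_H \<in> sets N_H" .
qed

section \<open>Almost sure regularity of the thinned laws\<close>

lemma thinned_law_AE_strip:
  assumes P: "thinned_law w K P" and w: "w \<in> weights \<alpha> \<beta>"
  shows "AE \<xi> in P. atoms \<xi> \<subseteq> strip \<alpha> \<beta> UNIV"
proof -
  have [measurable]: "(\<lambda>z. Im (z 0)) \<in> borel_measurable (dA_power 1)"
    by (intro measurable_dA_component measurable_dA_Im) simp
  have f: "(\<lambda>z. if \<alpha> \<le> Im (z 0) \<and> Im (z 0) \<le> \<beta> then 0 else 1 :: ennreal) \<in> borel_measurable (dA_power 1)"
    by (intro measurable_If pred_intros_logic borel_measurable_const) measurable
  have "AE \<xi> in P. \<forall>z\<in>distinct_tuples 1 (atoms \<xi>). (if \<alpha> \<le> Im (z 0) \<and> Im (z 0) \<le> \<beta> then 0 else 1 :: ennreal) = 0"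
  proof (rule thinned_law_AE[OF P f])
    \<comment> \<open>At heights outside [\<alpha>, \<beta>] the weight is 0, and with it the first
      moment density.\<close>
    have "(if \<alpha> \<le> Im (z 0) \<and> Im (z 0) \<le> \<beta> then 0 else 1 :: ennreal) * (\<Prod>i<1. ennreal (w (Im (z i)))) * ennreal (Re (kernel_det K 1 z)) = 0"
      if "z \<in> space (dA_power 1)" for z
    proof -
      have "Im (z 0) > 0" using that by (auto simp: space_PiM PiE_iff upper_half_plane_def)
      then show ?thesis using weights_bounds(3)[OF w, of "Im (z 0)"] by auto
    qed
    then show "(\<integral>\<^sup>+z. (if \<alpha> \<le> Im (z 0) \<and> Im (z 0) \<le> \<beta> then 0 else 1 :: ennreal) * (\<Prod>i<1. ennreal (w (Im (z i)))) * ennreal (Re (kernel_det K 1 z)) \<partial>dA_power 1) = 0"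
      by (subst nn_integral_cong[where v = "\<lambda>_. 0"]) auto
  qed
  then show ?thesis
  proof eventually_elim
    case (elim \<xi>)
    show ?case
    proof
      fix a assume "a \<in> atoms \<xi>"
      then have "(\<lambda>i\<in>{..<1::nat}. a) \<in> distinct_tuples 1 (atoms \<xi>)"
        by (auto simp: distinct_tuples_def inj_on_def)
      from elim[rule_format, OF this] show "a \<in> strip \<alpha> \<beta> UNIV"
        by (simp add: strip_def split: if_splits)
    qed
  qed
qed

lemma emeasure_dA_vertical_line: "(\<integral>\<^sup>+v. indicator {v. Re v = x} v \<partial>dA) = 0"
proof -
  note [measurable] = measurable_dA_Re
  have "(\<lambda>v. if Re v = x then 1 else 0 :: ennreal) \<in> borel_measurable dA" by measurable
  then have m: "(\<lambda>v. indicator {v. Re v = x} v :: ennreal) \<in> borel_measurable dA"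
    by (simp add: indicator_def)
  have "(\<integral>\<^sup>+v. indicator {v. Re v = x} v \<partial>dA) =
      (\<integral>\<^sup>+a. (\<integral>\<^sup>+b. indicator {v. Re v = x} (Complex a b) * indicator {0<..} b \<partial>lborel) \<partial>lborel)"
    by (rule nn_integral_dA[OF m])
  also have "\<dots> = (\<integral>\<^sup>+a. 0 \<partial>(lborel :: real measure))"
    using AE_lborel_singleton[of x] by (intro nn_integral_cong_AE) (auto elim!: eventually_mono)
  finally show ?thesis by simp
qed

text \<open>Vertical lines have area 0, so pairs on a common vertical line are null for the product
  measure and no second moment density can charge them.\<close>

lemma thinned_law_AE_inj:
  assumes P: "thinned_law w K P"
  shows "AE \<xi> in P. inj_on Re (atoms \<xi>)"
proof -
  have two: "{..<2::nat} = {0, 1}" by auto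
  note [measurable] = measurable_dA_Re
  have "(\<lambda>p. if Re (fst p) = Re (snd p) then 1 else 0 :: ennreal) \<in> borel_measurable (dA \<Otimes>\<^sub>M dA)" by measurable
  then have m: "(\<lambda>p. indicator {v. Re v = Re (fst p)} (snd p) :: ennreal) \<in> borel_measurable (dA \<Otimes>\<^sub>M dA)"
    by (rule measurable_cong[THEN iffD1, rotated]) (auto simp: indicator_def)
  have "(\<integral>\<^sup>+z. indicator {z. Re (z 0) = Re (z 1)} z \<partial>dA_power 2) =
      (\<integral>\<^sup>+z. indicator {v. Re v = Re (z 0)} (z 1) \<partial>PiM {0, 1::nat} (\<lambda>_. dA))"
    unfolding two by (intro nn_integral_cong) (auto simp: indicator_def)
  also have "\<dots> = (\<integral>\<^sup>+p. indicator {v. Re v = Re (fst p)} (snd p) \<partial>(dA \<Otimes>\<^sub>M dA))"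
    using m by (intro dA.product_nn_integral_pair[where f = "\<lambda>u. indicator {v. Re v = Re u}"])
      (auto simp: case_prod_beta)
  also have "\<dots> = (\<integral>\<^sup>+u. (\<integral>\<^sup>+v. indicator {v. Re v = Re u} v \<partial>dA) \<partial>dA)"
    using m by (subst sigma_finite_measure.nn_integral_fst[OF sigma_finite_dA, symmetric]) auto
  also have "\<dots> = 0" by (simp add: emeasure_dA_vertical_line)
  finally have "AE z in dA_power 2. indicator {z. Re (z 0) = Re (z 1)} z = (0::ennreal)"
    using measurable_Re_diag by (subst (asm) nn_integral_0_iff_AE) auto
  then have "(\<integral>\<^sup>+z. indicator {z. Re (z 0) = Re (z 1)} z * (\<Prod>i<2. ennreal (w (Im (z i)))) * ennreal (Re (kernel_det K 2 z)) \<partial>dA_power 2) =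
      (\<integral>\<^sup>+z. 0 \<partial>dA_power 2)"
    by (intro nn_integral_cong_AE) (auto elim!: eventually_mono)
  then have "AE \<xi> in P. \<forall>z\<in>distinct_tuples 2 (atoms \<xi>). indicator {z. Re (z 0) = Re (z 1)} z = (0::ennreal)"
    by (intro thinned_law_AE[OF P measurable_Re_diag]) simp
  then show ?thesis
    by eventually_elim (simp add: inj_on_Re_iff nn_integral_0_iff_AE AE_count_space)
qed

text \<open>Over a bounded interval all atoms lie in a bounded strip, hence are finitely many;
  injectivity keeps their projections simple.\<close>

lemma proj_Re_regular:
  assumes xi: "\<xi> \<in> simple_configs upper_half_plane" and "0 < \<alpha>"
    and strip: "atoms \<xi> \<subseteq> strip \<alpha> \<beta> UNIV" and inj: "inj_on Re (atoms \<xi>)"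
  shows "proj_Re \<xi> \<in> simple_configs UNIV" "proj_config \<xi> = point_measure_on UNIV (Re ` atoms \<xi>)"
proof -
  have "emeasure \<xi> (Re -` {- real n..real n} \<inter> upper_half_plane) < \<infinity>" for n
  proof -
    have "emeasure \<xi> (Re -` {- real n..real n} \<inter> upper_half_plane) =
        emeasure (count_space UNIV) (atoms \<xi> \<inter> Re -` {- real n..real n})"
      using emeasure_proj_Re[OF xi, of "{- real n..real n}"] by simp
    moreover have "atoms \<xi> \<inter> Re -` {- real n..real n} = atoms \<xi> \<inter> strip \<alpha> \<beta> {- real n..real n}"
      using strip by (auto simp: strip_def)
    ultimately show ?thesis
      using finite_atoms_strip[OF xi \<open>0 < \<alpha>\<close>, of "{- real n..real n}" \<beta>] by (simp add: less_top[symmetric])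
  qed
  then show s: "proj_Re \<xi> \<in> simple_configs UNIV"
    using inj by (simp add: proj_Re_simple_iff[OF xi])
  show "proj_config \<xi> = point_measure_on UNIV (Re ` atoms \<xi>)"
    using s by (simp add: proj_config_def proj_Re_eq[OF xi inj])
qed

section \<open>Moments of the projected process\<close>

lemma measurable_K_H:
  assumes [measurable]: "f \<in> borel_measurable M" "g \<in> borel_measurable M"
  shows "(\<lambda>x. K_H (f x) (g x)) \<in> borel_measurable M"
proof -
  have "cnj \<in> borel_measurable borel"
    by (intro borel_measurable_continuous_onI continuous_intros)
  then have [measurable]: "(\<lambda>x. cnj (g x)) \<in> borel_measurable M"
    by (rule measurable_compose[rotated]) fact
  show ?thesis unfolding K_H_def by measurable
qed

lemma measurable_palm_K_H:
  assumes "f \<in> borel_measurable M" "g \<in> borel_measurable M" "a \<in> borel_measurable M"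
  shows "(\<lambda>x. palm_kernel K_H (a x) (f x) (g x)) \<in> borel_measurable M"
  unfolding palm_kernel_def
  by (intro borel_measurable_diff borel_measurable_divide borel_measurable_times measurable_K_H assms)

lemma measurable_dA_id: "(\<lambda>z. z) \<in> borel_measurable dA"
  unfolding measurable_cong_sets[OF sets_dA refl] by (rule measurable_restrict_space1) simp

definition moment_density :: "(real \<Rightarrow> real) \<Rightarrow> (complex \<Rightarrow> complex \<Rightarrow> complex) \<Rightarrow> nat \<Rightarrow> (nat \<Rightarrow> complex) \<Rightarrow> ennreal" where
  "moment_density w K k z = (\<Prod>i<k. ennreal (w (Im (z i)))) * ennreal (Re (kernel_det K k z))"

text \<open>Hadamard reduces the determinant to its diagonal, which is dominated by that of
  \<open>K_H\<close>, at most 1 / (4 pi \<alpha>^2) on the strip. The same bound thus serves the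
  Palm kernels at all heights.\<close>

lemma moment_density_le:
  assumes K: "psd_kernel_on upper_half_plane K" "\<And>z. z \<in> upper_half_plane \<Longrightarrow> Re (K z z) \<le> Re (K_H z z)"
    and w: "w \<in> weights \<alpha> \<beta>" and \<alpha>: "0 < \<alpha>" and z: "z \<in> PiE {..<k} (\<lambda>_. strip \<alpha> \<beta> UNIV)"
  shows "moment_density w K k z \<le> ennreal ((1 / (4 * pi * \<alpha>\<^sup>2)) ^ k)"
proof -
  have zi: "\<alpha> \<le> Im (z i)" "Im (z i) > 0" "z i \<in> upper_half_plane" if "i < k" for i
  proof -
    have "z i \<in> strip \<alpha> \<beta> UNIV" using z that by (blast intro: PiE_mem)
    then show "\<alpha> \<le> Im (z i)" "Im (z i) > 0" "z i \<in> upper_half_plane"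
      using \<alpha> by (auto simp: strip_def upper_half_plane_def)
  qed
  have "(\<Prod>i<k. ennreal (w (Im (z i)))) = ennreal (\<Prod>i<k. w (Im (z i)))"
    using zi weights_bounds(1)[OF w] by (intro prod_ennreal) auto
  also have "\<dots> \<le> 1"
    using zi weights_bounds(1,2)[OF w] by (subst ennreal_le_1) (intro prod_le_1, auto)
  finally have 1: "(\<Prod>i<k. ennreal (w (Im (z i)))) \<le> 1" .
  have "Re (kernel_det K k z) \<le> (\<Prod>i<k. Re (K (z i) (z i)))"
    using kernel_det_hadamard[OF K(1), of k z] zi by auto
  also have "\<dots> \<le> (\<Prod>i<k. 1 / (4 * pi * \<alpha>\<^sup>2))"
  proof (intro prod_mono conjI)
    fix i assume "i \<in> {..<k}"
    then have i: "i < k" by simp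
    show "0 \<le> Re (K (z i) (z i))"
      using psd_kernel_on_diag[OF K(1) zi(3)[OF i]] by (simp add: complex_nonneg_Reals_iff)
    have "Re (K (z i) (z i)) \<le> 1 / (4 * pi * (Im (z i))\<^sup>2)"
      using K(2)[OF zi(3)[OF i]] by (simp add: K_H_diag del: of_real_divide)
    also have "\<dots> \<le> 1 / (4 * pi * \<alpha>\<^sup>2)"
      using zi(1)[OF i] \<alpha> by (intro divide_left_mono mult_left_mono power_mono mult_pos_pos) auto
    finally show "Re (K (z i) (z i)) \<le> 1 / (4 * pi * \<alpha>\<^sup>2)" .
  qed
  finally have 2: "Re (kernel_det K k z) \<le> (1 / (4 * pi * \<alpha>\<^sup>2)) ^ k" by simp
  have "moment_density w K k z \<le> 1 * ennreal ((1 / (4 * pi * \<alpha>\<^sup>2)) ^ k)"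
    unfolding moment_density_def by (intro mult_mono 1 ennreal_leI 2) auto
  then show ?thesis by simp
qed

lemma moment_bound:
  assumes K: "psd_kernel_on upper_half_plane K" "\<And>z. z \<in> upper_half_plane \<Longrightarrow> Re (K z z) \<le> Re (K_H z z)"
    and w: "w \<in> weights \<alpha> \<beta>" and \<alpha>: "0 < \<alpha>" and I: "I \<in> sets borel" "bounded I"
    and Q: "Q \<subseteq> PiE {..<k} (\<lambda>_. strip \<alpha> \<beta> I)"
  shows "(\<integral>\<^sup>+z. indicator Q z * moment_density w K k z \<partial>dA_power k) \<le>
    ennreal ((1 / (4 * pi * \<alpha>\<^sup>2) * measure dA (strip \<alpha> \<beta> I)) ^ k)"
proof -
  have "(\<integral>\<^sup>+z. indicator Q z * moment_density w K k z \<partial>dA_power k) \<le>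
      (\<integral>\<^sup>+z. ennreal ((1 / (4 * pi * \<alpha>\<^sup>2)) ^ k) * indicator (PiE {..<k} (\<lambda>_. strip \<alpha> \<beta> I)) z \<partial>dA_power k)"
  proof (rule nn_integral_mono)
    fix z assume "z \<in> space (dA_power k)"
    show "indicator Q z * moment_density w K k z \<le>
        ennreal ((1 / (4 * pi * \<alpha>\<^sup>2)) ^ k) * indicator (PiE {..<k} (\<lambda>_. strip \<alpha> \<beta> I)) z"
    proof (cases "z \<in> Q")
      case True
      then have z: "z \<in> PiE {..<k} (\<lambda>_. strip \<alpha> \<beta> I)" using Q by auto
      moreover have "PiE {..<k} (\<lambda>_. strip \<alpha> \<beta> I) \<subseteq> PiE {..<k} (\<lambda>_. strip \<alpha> \<beta> UNIV)"
        by (intro PiE_mono) (auto simp: strip_def)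
      ultimately have "moment_density w K k z \<le> ennreal ((1 / (4 * pi * \<alpha>\<^sup>2)) ^ k)"
        by (intro moment_density_le[OF K w \<alpha>]) auto
      then show ?thesis using True z by simp
    qed simp
  qed
  also have "\<dots> = ennreal ((1 / (4 * pi * \<alpha>\<^sup>2)) ^ k) * emeasure (dA_power k) (PiE {..<k} (\<lambda>_. strip \<alpha> \<beta> I))"
    using strip_sets(2)[OF \<alpha> I(1)] by (intro nn_integral_cmult_indicator sets_PiM_I_finite) auto
  also have "emeasure (dA_power k) (PiE {..<k} (\<lambda>_. strip \<alpha> \<beta> I)) = (\<Prod>i<k. emeasure dA (strip \<alpha> \<beta> I))"
    using strip_sets(2)[OF \<alpha> I(1)] by (intro dA.emeasure_PiM) auto
  also have "\<dots> = ennreal (measure dA (strip \<alpha> \<beta> I) ^ k)"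
    using emeasure_dA_strip_finite[OF \<alpha> I(2,1), of \<beta>] by (simp add: emeasure_eq_ennreal_measure ennreal_power)
  finally show ?thesis
    by (simp add: power_mult_distrib power_divide flip: ennreal_mult)
qed

lemma nn_integral_indicator_count_space:
  assumes "finite (X \<inter> Y)"
  shows "(\<integral>\<^sup>+z. indicator X z \<partial>count_space Y) = of_nat (card (X \<inter> Y))"
proof -
  have "(\<integral>\<^sup>+z. indicator X z \<partial>count_space Y) = (\<integral>\<^sup>+z. indicator X z * indicator Y z \<partial>count_space UNIV)"
    by (rule nn_integral_count_space_indicator) simp
  also have "\<dots> = (\<integral>\<^sup>+z. indicator (X \<inter> Y) z \<partial>count_space UNIV)"
    by (simp only: indicator_inter_arith)
  finally show ?thesis using assms by (simp add: emeasure_count_space_finite)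
qed

text \<open>\<open>B k\<close> counts the distinct k-tuples of atoms in the strip.
  Inclusion-exclusion holds for every single configuration, and
  \<open>alternating_expectation\<close> integrates it.\<close>

lemma void_probability:
  assumes P: "thinned_law w K P"
    and K: "psd_kernel_on upper_half_plane K" "\<And>z. z \<in> upper_half_plane \<Longrightarrow> Re (K z z) \<le> Re (K_H z z)"
    and w: "w \<in> weights \<alpha> \<beta>" and \<alpha>: "0 < \<alpha>" and A: "A \<in> sets borel" "bounded A"
  shows "(\<lambda>k. (-1) ^ k / fact k *
      enn2real (\<integral>\<^sup>+z. indicator (PiE {..<k} (\<lambda>_. strip \<alpha> \<beta> A)) z * moment_density w K k z \<partial>dA_power k))
    sums measure P {\<xi> \<in> simple_configs upper_half_plane. atoms \<xi> \<inter> strip \<alpha> \<beta> A = {}}"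
proof -
  interpret prob_space P by (rule thinned_lawD(1)[OF P])
  note P_space = thinned_lawD(3)[OF P]
  let ?X = "\<lambda>k::nat. PiE {..<k} (\<lambda>_. strip \<alpha> \<beta> A)"
  define B where "B k \<xi> = (\<integral>\<^sup>+z. indicator (?X k) z \<partial>count_space (distinct_tuples k (atoms \<xi>)))"
    for k and \<xi> :: "complex measure"
  have X: "(\<lambda>z. indicator (?X k) z) \<in> borel_measurable (dA_power k)" for k
    using strip_sets(2)[OF \<alpha> A(1)] by (intro borel_measurable_indicator sets_PiM_I_finite) auto
  have fin: "finite (atoms \<xi> \<inter> strip \<alpha> \<beta> A)" if "\<xi> \<in> space P" for \<xi>
    using finite_atoms_strip[OF _ \<alpha> A(2)] that P_space by simp
  have Bcard: "B k \<xi> = of_nat (card (distinct_tuples k (atoms \<xi> \<inter> strip \<alpha> \<beta> A)))" if "\<xi> \<in> space P" for k \<xi>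
  proof -
    have "?X k \<inter> distinct_tuples k (atoms \<xi>) = distinct_tuples k (atoms \<xi> \<inter> strip \<alpha> \<beta> A)"
      unfolding distinct_tuples_def
      using PiE_Int[of "{..<k}" "\<lambda>_. strip \<alpha> \<beta> A" "\<lambda>_. atoms \<xi>"] by (auto simp: Int_commute)
    then show ?thesis
      unfolding B_def using finite_distinct_tuples[OF fin[OF that]]
      by (subst nn_integral_indicator_count_space) auto
  qed
  have intB: "(\<integral>\<^sup>+\<xi>. B k \<xi> \<partial>P) = (\<integral>\<^sup>+z. indicator (?X k) z * moment_density w K k z \<partial>dA_power k)" for k
    unfolding B_def thinned_lawD(4)[OF P X] moment_density_def by (simp add: mult.assoc)
  have *: "(\<lambda>k. (-1) ^ k / fact k * enn2real (\<integral>\<^sup>+\<xi>. B k \<xi> \<partial>P)) sums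
      (\<integral>\<xi>. (if atoms \<xi> \<inter> strip \<alpha> \<beta> A = {} then 1 else 0 :: real) \<partial>P) \<and>
    (\<lambda>\<xi>. if atoms \<xi> \<inter> strip \<alpha> \<beta> A = {} then 1 else 0 :: real) \<in> borel_measurable P"
  proof (rule alternating_expectation, goal_cases)
    show "B k \<in> borel_measurable P" for k
      unfolding B_def using measurable_distinct_tuple_sum_dA[OF X]
      by (simp cong: measurable_cong_sets add: thinned_lawD(2)[OF P])
  next
    fix k \<xi> assume "\<xi> \<in> space P"
    then show "B k \<xi> < \<infinity>" by (simp add: Bcard less_top[symmetric])
  next
    fix \<xi> assume xi: "\<xi> \<in> space P"
    show "summable (\<lambda>k. enn2real (B k \<xi>) / fact k)"
      using fin[OF xi] by (intro summable_finite[of "{..card (atoms \<xi> \<inter> strip \<alpha> \<beta> A)}"])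
        (auto simp: Bcard[OF xi] card_distinct_tuples binomial_eq_0 not_le)
    show "(\<lambda>k. (- 1) ^ k / fact k * enn2real (B k \<xi>)) sums (if atoms \<xi> \<inter> strip \<alpha> \<beta> A = {} then 1 else 0)"
      using void_inclusion_exclusion[OF fin[OF xi]] by (simp add: Bcard[OF xi])
  next
    show "(\<integral>\<^sup>+\<xi>. B k \<xi> \<partial>P) \<le> ennreal (1 * (1 / (4 * pi * \<alpha>\<^sup>2) * measure dA (strip \<alpha> \<beta> A)) ^ k)" for k
      unfolding intB using moment_bound[OF K w \<alpha> A] by simp
  qed auto
  have set: "{\<xi> \<in> space P. atoms \<xi> \<inter> strip \<alpha> \<beta> A = {}} \<in> sets P"
  proof -
    have "(\<lambda>\<xi>. if atoms \<xi> \<inter> strip \<alpha> \<beta> A = {} then 1 else 0 :: real) -` {1} \<inter> space P \<in> sets P"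
      by (rule measurable_sets[OF conjunct2[OF *]]) simp
    also have "(\<lambda>\<xi>. if atoms \<xi> \<inter> strip \<alpha> \<beta> A = {} then 1 else 0 :: real) -` {1} \<inter> space P =
        {\<xi> \<in> space P. atoms \<xi> \<inter> strip \<alpha> \<beta> A = {}}" by (auto split: if_split_asm)
    finally show ?thesis .
  qed
  have "(\<integral>\<xi>. (if atoms \<xi> \<inter> strip \<alpha> \<beta> A = {} then 1 else 0 :: real) \<partial>P) =
      (\<integral>\<xi>. indicator {\<xi> \<in> space P. atoms \<xi> \<inter> strip \<alpha> \<beta> A = {}} \<xi> \<partial>P)"
    by (intro Bochner_Integration.integral_cong) (auto simp: indicator_def)
  also have "\<dots> = measure P {\<xi> \<in> space P. atoms \<xi> \<inter> strip \<alpha> \<beta> A = {}}"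
    using set by simp
  finally show ?thesis
    using * by (simp add: intB P_space)
qed

section \<open>Tuples around a marked point\<close>

lemma palm_window:
  assumes "bounded A"
  obtains I :: "real set" where "I \<in> sets borel" "bounded I" "{0..1} \<subseteq> I"
    "\<And>x t. x \<in> {0..1} \<Longrightarrow> t - x \<in> A \<Longrightarrow> t \<in> I"
proof -
  obtain r where r: "\<And>x. x \<in> A \<Longrightarrow> \<bar>x\<bar> \<le> r" using assms by (auto simp: bounded_iff)
  show thesis
  \<comment> \<open>The absolute value is taken because for empty A the bound r may be negative, and
    the window must still contain [0, 1].\<close>
  proof (rule that[of "{- \<bar>r\<bar>..\<bar>r\<bar> + 1}"])
    fix x t :: real assume "x \<in> {0..1}" "t - x \<in> A"
    then show "t \<in> {- \<bar>r\<bar>..\<bar>r\<bar> + 1}" using r[of "t - x"] by (auto simp: abs_le_iff)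
  qed auto
qed

text \<open>The Palm point is the last coordinate, so that its factor of the product measure can be split off.\<close>

definition palm_tuples :: "real \<Rightarrow> real \<Rightarrow> real set \<Rightarrow> nat \<Rightarrow> (nat \<Rightarrow> complex) set" where
  "palm_tuples \<alpha> \<beta> A k = {z \<in> space (dA_power (Suc k)). z k \<in> strip \<alpha> \<beta> {0..1} \<and>
     (\<forall>i<k. z i \<in> strip \<alpha> \<beta> UNIV \<and> Re (z i) - Re (z k) \<in> A)}"

text \<open>Excluding a itself reflects the Dirac mass removed in the reduced Palm
  distribution.\<close>

definition palm_neighbours :: "real \<Rightarrow> real \<Rightarrow> real set \<Rightarrow> complex set \<Rightarrow> complex \<Rightarrow> complex set" where
  "palm_neighbours \<alpha> \<beta> A S a = {z \<in> S. z \<noteq> a \<and> z \<in> strip \<alpha> \<beta> UNIV \<and> Re z - Re a \<in> A}"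

lemma measurable_strip_mem:
  assumes "0 < \<alpha>" "A \<in> sets borel" "i < k"
  shows "Measurable.pred (dA_power k) (\<lambda>z. z i \<in> strip \<alpha> \<beta> A)"
  using strip_sets(1)[OF assms(1,2)] by (intro pred_sets2[OF _ measurable_dA_component[OF measurable_dA_id assms(3)]]) auto

lemma palm_tuples_sets:
  assumes \<alpha>: "0 < \<alpha>" and A: "A \<in> sets borel"
  shows "palm_tuples \<alpha> \<beta> A k \<in> sets (dA_power (Suc k))"
proof -
  have [measurable]: "Measurable.pred (dA_power (Suc k)) (\<lambda>z. z i \<in> strip \<alpha> \<beta> C)" if "i < Suc k" "C \<in> sets borel" for i C
    using measurable_strip_mem[OF \<alpha> that(2,1)] .
  have "(\<lambda>z. Re (z i) - Re (z k)) \<in> borel_measurable (dA_power (Suc k))" if "i < k" for i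
    using that by (intro borel_measurable_diff measurable_dA_component measurable_dA_Re) auto
  then have [measurable]: "Measurable.pred (dA_power (Suc k)) (\<lambda>z. Re (z i) - Re (z k) \<in> A)" if "i < k" for i
    using A that by (intro pred_sets2) auto
  have "Measurable.pred (dA_power (Suc k)) (\<lambda>z. z k \<in> strip \<alpha> \<beta> {0..1} \<and>
     (\<forall>i\<in>{..<k}. z i \<in> strip \<alpha> \<beta> UNIV \<and> Re (z i) - Re (z k) \<in> A))"
    by measurable
  then show ?thesis by (simp add: palm_tuples_def pred_def Ball_def)
qed

lemma palm_tuples_subset:
  assumes "\<And>x t. x \<in> {0..1} \<Longrightarrow> t - x \<in> A \<Longrightarrow> t \<in> I" "{0..1} \<subseteq> I"
  shows "palm_tuples \<alpha> \<beta> A k \<subseteq> PiE {..<Suc k} (\<lambda>_. strip \<alpha> \<beta> I)"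
proof
  fix z assume z: "z \<in> palm_tuples \<alpha> \<beta> A k"
  have "z i \<in> strip \<alpha> \<beta> I" if "i < Suc k" for i
    using z that assms(1)[of "Re (z k)" "Re (z i)"] assms(2)
    by (cases "i = k") (auto simp: palm_tuples_def strip_def)
  then show "z \<in> PiE {..<Suc k} (\<lambda>_. strip \<alpha> \<beta> I)"
    using z by (auto simp: palm_tuples_def space_PiM PiE_iff)
qed

text \<open>Grouping by the last coordinate a leaves the distinct k-tuples of neighbours of a, to
  which inclusion-exclusion in k applies. All points involved lie over one bounded window, which
  gives finiteness.\<close>

lemma palm_tuples_count:
  assumes S: "S \<subseteq> upper_half_plane" and fin: "\<And>C. bounded C \<Longrightarrow> finite (S \<inter> strip \<alpha> \<beta> C)" and A: "bounded A"
  shows "finite (palm_tuples \<alpha> \<beta> A k \<inter> distinct_tuples (Suc k) S)"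
    "card (palm_tuples \<alpha> \<beta> A k \<inter> distinct_tuples (Suc k) S) =
      (\<Sum>a\<in>S \<inter> strip \<alpha> \<beta> {0..1}. card (distinct_tuples k (palm_neighbours \<alpha> \<beta> A S a)))"
    "\<And>a. a \<in> S \<inter> strip \<alpha> \<beta> {0..1} \<Longrightarrow> finite (palm_neighbours \<alpha> \<beta> A S a)"
proof -
  obtain I where I: "I \<in> sets borel" "bounded I" "{0..1} \<subseteq> I" "\<And>x t. x \<in> {0..1} \<Longrightarrow> t - x \<in> A \<Longrightarrow> t \<in> I"
    using palm_window[OF A] by blast
  show nb: "finite (palm_neighbours \<alpha> \<beta> A S a)" if "a \<in> S \<inter> strip \<alpha> \<beta> {0..1}" for a
  proof (rule finite_subset[OF _ fin[OF I(2)]])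
    show "palm_neighbours \<alpha> \<beta> A S a \<subseteq> S \<inter> strip \<alpha> \<beta> I"
      using that I(4)[of "Re a"] by (auto simp: palm_neighbours_def strip_def)
  qed
  have eq: "palm_tuples \<alpha> \<beta> A k \<inter> distinct_tuples (Suc k) S =
      {z \<in> distinct_tuples (Suc k) S. z k \<in> S \<inter> strip \<alpha> \<beta> {0..1} \<and> (\<forall>i<k. z i \<in> palm_neighbours \<alpha> \<beta> A S (z k))}"
    (is "?L = ?R")
  proof (rule Set.set_eqI)
    fix z
    show "z \<in> ?L \<longleftrightarrow> z \<in> ?R"
    proof (cases "z \<in> distinct_tuples (Suc k) S")
      case True
      then have zS: "z i \<in> S" if "i < Suc k" for i
        using that unfolding distinct_tuples_def by (blast intro: PiE_mem)
      have "z \<in> space (dA_power (Suc k))"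
        using True S unfolding distinct_tuples_def by (auto simp: space_PiM PiE_iff)
      \<comment> \<open>\<open>palm_tuples\<close> itself permits z i = z k; the distinctness of the
        tuple makes z i a neighbour other than the marked point.\<close>
      moreover have "z i \<noteq> z k" if "i < k" for i
      proof
        have inj: "inj_on z {..<Suc k}" using True unfolding distinct_tuples_def by blast
        assume "z i = z k"
        then have "i = k" by (rule inj_onD[OF inj]) (use that in auto)
        then show False using that by simp
      qed
      ultimately show ?thesis
        using True zS by (auto simp: palm_tuples_def palm_neighbours_def)
    qed auto
  qed
  have bij: "bij_betw (\<lambda>(a, z). z(k := a)) (SIGMA a:S \<inter> strip \<alpha> \<beta> {0..1}. distinct_tuples k (palm_neighbours \<alpha> \<beta> A S a)) ?R"
    by (rule distinct_tuples_Suc_bij) (auto simp: palm_neighbours_def)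
  have fs: "finite (S \<inter> strip \<alpha> \<beta> {0..1})" by (rule fin) simp
  have "finite (SIGMA a:S \<inter> strip \<alpha> \<beta> {0..1}. distinct_tuples k (palm_neighbours \<alpha> \<beta> A S a))"
    using fs nb by (intro finite_SigmaI finite_distinct_tuples)
  then show "finite ?L" unfolding eq using bij_betw_finite[OF bij] by simp
  show "card ?L = (\<Sum>a\<in>S \<inter> strip \<alpha> \<beta> {0..1}. card (distinct_tuples k (palm_neighbours \<alpha> \<beta> A S a)))"
    unfolding eq bij_betw_same_card[OF bij, symmetric]
    using fs nb by (intro card_SigmaI) (auto intro: finite_distinct_tuples)
qed

text \<open>The Palm sum over [0, 1] for the event of being void on A, read off from the points in
  the half-plane instead of their projections.\<close>

definition isolated_count :: "real \<Rightarrow> real \<Rightarrow> real set \<Rightarrow> complex set \<Rightarrow> real" where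
  "isolated_count \<alpha> \<beta> A S = (\<Sum>a\<in>S \<inter> strip \<alpha> \<beta> {0..1}. if palm_neighbours \<alpha> \<beta> A S a = {} then 1 else 0)"

text \<open>Inclusion-exclusion is applied around each marked point and the results are added, so
  the (k + 1)-point density carries the weight 1 / k! and not 1 / (k + 1)!. The moment bound is
  exported because the integral over heights reuses it.\<close>

lemma isolated_count_expectation:
  assumes P: "thinned_law w K_H P"
    and w: "w \<in> weights \<alpha> \<beta>" and \<alpha>: "0 < \<alpha>" and A: "A \<in> sets borel" "bounded A"
  shows "(\<lambda>k. (-1) ^ k / fact k *
      enn2real (\<integral>\<^sup>+z. indicator (palm_tuples \<alpha> \<beta> A k) z * moment_density w K_H (Suc k) z \<partial>dA_power (Suc k)))
    sums (\<integral>\<xi>. isolated_count \<alpha> \<beta> A (atoms \<xi>) \<partial>P)"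
    and "(\<lambda>\<xi>. isolated_count \<alpha> \<beta> A (atoms \<xi>)) \<in> borel_measurable P"
    and "\<exists>C V. 0 \<le> C \<and> 0 \<le> V \<and> (\<forall>k. (\<integral>\<^sup>+z. indicator (palm_tuples \<alpha> \<beta> A k) z * moment_density w K_H (Suc k) z \<partial>dA_power (Suc k)) \<le> ennreal (C * V ^ k))"
proof -
  interpret prob_space P by (rule thinned_lawD(1)[OF P])
  note P_space = thinned_lawD(3)[OF P]
  obtain I where I: "I \<in> sets borel" "bounded I" "{0..1} \<subseteq> I" "\<And>x t. x \<in> {0..1} \<Longrightarrow> t - x \<in> A \<Longrightarrow> t \<in> I"
    using palm_window[OF A(2)] by blast
  define V where "V = 1 / (4 * pi * \<alpha>\<^sup>2) * measure dA (strip \<alpha> \<beta> I)"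
  have V: "V \<ge> 0" by (simp add: V_def)
  let ?X = "\<lambda>k. palm_tuples \<alpha> \<beta> A k"
  define B where "B k \<xi> = (\<integral>\<^sup>+z. indicator (?X k) z \<partial>count_space (distinct_tuples (Suc k) (atoms \<xi>)))"
    for k and \<xi> :: "complex measure"
  have X: "(\<lambda>z. indicator (?X k) z) \<in> borel_measurable (dA_power (Suc k))" for k
    using palm_tuples_sets[OF \<alpha> A(1)] by (rule borel_measurable_indicator)
  have fin: "finite (atoms \<xi> \<inter> strip \<alpha> \<beta> C)" if "\<xi> \<in> space P" "bounded C" for \<xi> C
    using finite_atoms_strip[OF _ \<alpha> that(2)] that P_space by simp
  have sub: "atoms \<xi> \<subseteq> upper_half_plane" if "\<xi> \<in> space P" for \<xi>
    using that P_space simple_configsE(1) by auto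
  note count = palm_tuples_count[OF sub fin A(2)]
  have Bcard: "B k \<xi> = of_nat (\<Sum>a\<in>atoms \<xi> \<inter> strip \<alpha> \<beta> {0..1}. card (distinct_tuples k (palm_neighbours \<alpha> \<beta> A (atoms \<xi>) a)))"
    if "\<xi> \<in> space P" for k \<xi>
    unfolding B_def using nn_integral_indicator_count_space[OF count(1)[OF that that], of k] count(2)[OF that that, of k] by simp
  have intB: "(\<integral>\<^sup>+\<xi>. B k \<xi> \<partial>P) = (\<integral>\<^sup>+z. indicator (?X k) z * moment_density w K_H (Suc k) z \<partial>dA_power (Suc k))" for k
    unfolding B_def thinned_lawD(4)[OF P X] moment_density_def by (simp only: mult.assoc)
  \<comment> \<open>The separate factor V belongs to the marked point, which lies in the same window
    as its neighbours.\<close>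
  have bound: "(\<integral>\<^sup>+z. indicator (?X k) z * moment_density w K_H (Suc k) z \<partial>dA_power (Suc k)) \<le> ennreal (V * V ^ k)" for k
  proof -
    have "palm_tuples \<alpha> \<beta> A k \<subseteq> PiE {..<Suc k} (\<lambda>_. strip \<alpha> \<beta> I)"
      by (rule palm_tuples_subset[OF I(4,3)])
    from moment_bound[OF psd_K_H order_refl w \<alpha> I(1,2) this] show ?thesis by (simp add: V_def)
  qed
  show "\<exists>C V. 0 \<le> C \<and> 0 \<le> V \<and> (\<forall>k. (\<integral>\<^sup>+z. indicator (palm_tuples \<alpha> \<beta> A k) z * moment_density w K_H (Suc k) z \<partial>dA_power (Suc k)) \<le> ennreal (C * V ^ k))"
    using bound V by blast
  have *: "(\<lambda>k. (-1) ^ k / fact k * enn2real (\<integral>\<^sup>+\<xi>. B k \<xi> \<partial>P)) sums (\<integral>\<xi>. isolated_count \<alpha> \<beta> A (atoms \<xi>) \<partial>P) \<and>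
    (\<lambda>\<xi>. isolated_count \<alpha> \<beta> A (atoms \<xi>)) \<in> borel_measurable P"
  proof (rule alternating_expectation, goal_cases)
    show "B k \<in> borel_measurable P" for k
      unfolding B_def using measurable_distinct_tuple_sum_dA[OF X]
      by (simp cong: measurable_cong_sets add: thinned_lawD(2)[OF P])
  next
    fix k \<xi> assume "\<xi> \<in> space P"
    then show "B k \<xi> < \<infinity>" by (simp add: Bcard less_top[symmetric] del: of_nat_sum)
  next
    fix \<xi> assume xi: "\<xi> \<in> space P"
    have Breal: "enn2real (B k \<xi>) = (\<Sum>a\<in>atoms \<xi> \<inter> strip \<alpha> \<beta> {0..1}. real (card (distinct_tuples k (palm_neighbours \<alpha> \<beta> A (atoms \<xi>) a))))" for k
      by (simp add: Bcard[OF xi] del: of_nat_sum) simp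
    have "summable (\<lambda>k. (\<Sum>a\<in>atoms \<xi> \<inter> strip \<alpha> \<beta> {0..1}. real (card (distinct_tuples k (palm_neighbours \<alpha> \<beta> A (atoms \<xi>) a)) ) / fact k))"
    proof (rule summable_sum)
      fix a assume "a \<in> atoms \<xi> \<inter> strip \<alpha> \<beta> {0..1}"
      then show "summable (\<lambda>k. real (card (distinct_tuples k (palm_neighbours \<alpha> \<beta> A (atoms \<xi>) a))) / fact k)"
        using count(3)[OF xi xi] by (intro summable_finite[of "{..card (palm_neighbours \<alpha> \<beta> A (atoms \<xi>) a)}"])
          (auto simp: card_distinct_tuples binomial_eq_0 not_le)
    qed
    then show "summable (\<lambda>k. enn2real (B k \<xi>) / fact k)"
      by (simp add: Breal sum_divide_distrib)
    have "(\<lambda>k. \<Sum>a\<in>atoms \<xi> \<inter> strip \<alpha> \<beta> {0..1}. (- 1) ^ k / fact k * real (card (distinct_tuples k (palm_neighbours \<alpha> \<beta> A (atoms \<xi>) a))))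
        sums isolated_count \<alpha> \<beta> A (atoms \<xi>)"
      unfolding isolated_count_def using count(3)[OF xi xi] by (intro sums_sum void_inclusion_exclusion)
    then show "(\<lambda>k. (- 1) ^ k / fact k * enn2real (B k \<xi>)) sums isolated_count \<alpha> \<beta> A (atoms \<xi>)"
      by (simp add: Breal sum_distrib_left)
  next
    show "(\<integral>\<^sup>+\<xi>. B k \<xi> \<partial>P) \<le> ennreal (V * V ^ k)" for k
      unfolding intB by (rule bound)
  qed (use V in auto)
  then show "(\<lambda>k. (-1) ^ k / fact k *
      enn2real (\<integral>\<^sup>+z. indicator (palm_tuples \<alpha> \<beta> A k) z * moment_density w K_H (Suc k) z \<partial>dA_power (Suc k)))
    sums (\<integral>\<xi>. isolated_count \<alpha> \<beta> A (atoms \<xi>) \<partial>P)"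
    "(\<lambda>\<xi>. isolated_count \<alpha> \<beta> A (atoms \<xi>)) \<in> borel_measurable P"
    by (simp_all add: intB)
qed

section \<open>Disintegration of the Campbell measure\<close>

text \<open>The k-th factorial moment over A of the projected Palm law at height y, written without
  reference to that law, so that measurability in y can be read off the formula.\<close>

definition void_moment :: "real \<Rightarrow> real \<Rightarrow> (real \<Rightarrow> real) \<Rightarrow> real set \<Rightarrow> nat \<Rightarrow> real \<Rightarrow> ennreal" where
  "void_moment \<alpha> \<beta> w A k y = (\<integral>\<^sup>+z. indicator (PiE {..<k} (\<lambda>_. strip \<alpha> \<beta> A)) z *
     moment_density w (palm_kernel K_H (\<i> * of_real y)) k z \<partial>dA_power k)"

lemma weights_measurable_dA: "w \<in> weights \<alpha> \<beta> \<Longrightarrow> (\<lambda>z. w (Im z)) \<in> borel_measurable dA"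
  unfolding measurable_cong_sets[OF sets_dA refl] by (rule weights_measurable)

lemma measurable_Re_kernel_det:
  assumes "\<And>i j. i < k \<Longrightarrow> j < k \<Longrightarrow> (\<lambda>\<omega>. K \<omega> (z \<omega> i) (z \<omega> j)) \<in> borel_measurable M"
  shows "(\<lambda>\<omega>. Re (kernel_det (K \<omega>) k (z \<omega>))) \<in> borel_measurable M"
proof -
  have "Re \<in> borel_measurable borel" by simp
  from measurable_compose[OF borel_measurable_kernel_det[of k K z M, OF assms] this] show ?thesis .
qed

lemma measurable_moment_density:
  assumes w: "w \<in> weights \<alpha> \<beta>" and z: "z \<in> measurable M (dA_power k)"
    and K: "\<And>i j. i < k \<Longrightarrow> j < k \<Longrightarrow> (\<lambda>\<omega>. K \<omega> (z \<omega> i) (z \<omega> j)) \<in> borel_measurable M"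
  shows "(\<lambda>\<omega>. moment_density w (K \<omega>) k (z \<omega>)) \<in> borel_measurable M"
proof -
  have [measurable]: "(\<lambda>\<omega>. w (Im (z \<omega> i))) \<in> borel_measurable M" if "i < k" for i
    using measurable_compose[OF z measurable_dA_component[OF weights_measurable_dA[OF w] that]] .
  have [measurable]: "(\<lambda>\<omega>. Re (kernel_det (K \<omega>) k (z \<omega>))) \<in> borel_measurable M"
    by (rule measurable_Re_kernel_det[of k K z M, OF K])
  show ?thesis unfolding moment_density_def
    by (intro borel_measurable_times_ennreal borel_measurable_prod_ennreal) auto
qed

lemma measurable_component_id:
  assumes "z \<in> measurable M (dA_power k)" "i < k"
  shows "(\<lambda>\<omega>. z \<omega> i) \<in> borel_measurable M"
  using measurable_compose[OF assms(1) measurable_dA_component[OF measurable_dA_id assms(2)]] .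

lemma measurable_void_moment:
  assumes w: "w \<in> weights \<alpha> \<beta>" and \<alpha>: "0 < \<alpha>" and A: "A \<in> sets borel"
  shows "void_moment \<alpha> \<beta> w A k \<in> borel_measurable borel"
proof -
  have X: "PiE {..<k} (\<lambda>_. strip \<alpha> \<beta> A) \<in> sets (dA_power k)"
    using strip_sets(2)[OF \<alpha> A] by (intro sets_PiM_I_finite) auto
  have snd: "snd \<in> measurable (borel \<Otimes>\<^sub>M dA_power k) (dA_power k)" by (rule measurable_snd)
  have "(\<lambda>p. \<i> * complex_of_real (fst p)) \<in> borel_measurable (borel \<Otimes>\<^sub>M dA_power k)" by measurable
  then have "(\<lambda>p. indicator (PiE {..<k} (\<lambda>_. strip \<alpha> \<beta> A)) (snd p) * moment_density w (palm_kernel K_H (\<i> * of_real (fst p))) k (snd p))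
      \<in> borel_measurable (borel \<Otimes>\<^sub>M dA_power k)"
    by (intro borel_measurable_times_ennreal measurable_compose[OF snd borel_measurable_indicator[OF X]]
      measurable_moment_density[OF w snd] measurable_palm_K_H measurable_component_id[OF snd])
  then have "case_prod (\<lambda>y z. indicator (PiE {..<k} (\<lambda>_. strip \<alpha> \<beta> A)) z * moment_density w (palm_kernel K_H (\<i> * of_real y)) k z)
      \<in> borel_measurable (borel \<Otimes>\<^sub>M dA_power k)"
    by (simp add: case_prod_beta')
  then show ?thesis
    unfolding void_moment_def[abs_def]
    by (rule sigma_finite_measure.borel_measurable_nn_integral[OF dA.sigma_finite[OF finite_lessThan]])
qed

text \<open>With the Palm point a fixed, the pivot K(a, a) and the weight of a come out of the
  integral. The other points enter relative to Re a, and translating them back changes neither area,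
  kernel nor weights. So Re a survives only in the indicator.\<close>

lemma palm_tuples_inner:
  assumes w: "w \<in> weights \<alpha> \<beta>" and \<alpha>: "0 < \<alpha>" and A: "A \<in> sets borel" and a: "a \<in> upper_half_plane"
  shows "(\<integral>\<^sup>+z. indicator (palm_tuples \<alpha> \<beta> A k) (z(k := a)) * moment_density w K_H (Suc k) (z(k := a)) \<partial>dA_power k) =
    indicator (strip \<alpha> \<beta> {0..1}) a * ennreal (w (Im a) / (4 * pi * (Im a)\<^sup>2)) * void_moment \<alpha> \<beta> w A k (Im a)"
proof -
  define b where "b = \<i> * complex_of_real (Im a)"
  have ab: "a = b + of_real (Re a)" by (simp add: b_def complex_eq_iff)
  have pos: "Im a > 0" using a by (simp add: upper_half_plane_def)
  define T where "T = {z \<in> space (dA_power k). \<forall>i<k. z i \<in> strip \<alpha> \<beta> UNIV \<and> Re (z i) - Re a \<in> A}"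
  define c where "c = ennreal (w (Im a) / (4 * pi * (Im a)\<^sup>2))"
  have id: "(\<lambda>z. z) \<in> measurable (dA_power k) (dA_power k)" by simp
  have T: "T \<in> sets (dA_power k)"
  proof -
    have [measurable]: "Measurable.pred (dA_power k) (\<lambda>z. z i \<in> strip \<alpha> \<beta> UNIV)" if "i < k" for i
      using measurable_strip_mem[OF \<alpha> _ that] by simp
    have "(\<lambda>z. Re (z i) - Re a) \<in> borel_measurable (dA_power k)" if "i < k" for i
      using that by (intro borel_measurable_diff measurable_dA_component measurable_dA_Re) auto
    then have [measurable]: "Measurable.pred (dA_power k) (\<lambda>z. Re (z i) - Re a \<in> A)" if "i < k" for i
      using A that by (intro pred_sets2) auto
    have "Measurable.pred (dA_power k) (\<lambda>z. \<forall>i\<in>{..<k}. z i \<in> strip \<alpha> \<beta> UNIV \<and> Re (z i) - Re a \<in> A)"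
      by measurable
    then show ?thesis by (simp add: T_def pred_def Ball_def)
  qed
  define f where "f z = indicator T z * moment_density w (palm_kernel K_H a) k z" for z
  have f: "f \<in> borel_measurable (dA_power k)"
    unfolding f_def
    by (intro borel_measurable_times_ennreal borel_measurable_indicator T
      measurable_moment_density[OF w id] measurable_palm_K_H measurable_component_id[OF id] borel_measurable_const)
  have "(\<integral>\<^sup>+z. indicator (palm_tuples \<alpha> \<beta> A k) (z(k := a)) * moment_density w K_H (Suc k) (z(k := a)) \<partial>dA_power k) =
      (\<integral>\<^sup>+z. (indicator (strip \<alpha> \<beta> {0..1}) a * c) * f z \<partial>dA_power k)"
  proof (rule nn_integral_cong)
    fix z assume z: "z \<in> space (dA_power k)"
    have "z(k := a) \<in> space (dA_power (Suc k))"
      using z a by (auto simp: space_PiM PiE_iff extensional_def less_Suc_eq)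
    then have "z(k := a) \<in> palm_tuples \<alpha> \<beta> A k \<longleftrightarrow> a \<in> strip \<alpha> \<beta> {0..1} \<and> z \<in> T"
      using z by (simp add: palm_tuples_def T_def)
    then have 1: "indicator (palm_tuples \<alpha> \<beta> A k) (z(k := a)) = indicator (strip \<alpha> \<beta> {0..1}) a * (indicator T z :: ennreal)"
      by (simp add: indicator_def)
    have "kernel_det K_H (Suc k) (z(k := a)) = of_real (1 / (4 * pi * (Im a)\<^sup>2)) * kernel_det (palm_kernel K_H a) k z"
      using pos by (subst kernel_det_Suc) (auto simp: K_H_diag)
    then have "Re (kernel_det K_H (Suc k) (z(k := a))) = 1 / (4 * pi * (Im a)\<^sup>2) * Re (kernel_det (palm_kernel K_H a) k z)"
      by (simp del: of_real_divide)
    then have m1: "ennreal (Re (kernel_det K_H (Suc k) (z(k := a)))) =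
        ennreal (1 / (4 * pi * (Im a)\<^sup>2)) * ennreal (Re (kernel_det (palm_kernel K_H a) k z))"
      by (simp only:) (rule ennreal_mult', simp)
    have m2: "(\<Prod>i<Suc k. ennreal (w (Im ((z(k := a)) i)))) = (\<Prod>i<k. ennreal (w (Im (z i)))) * ennreal (w (Im a))"
      by simp
    have m3: "ennreal (w (Im a)) * ennreal (1 / (4 * pi * (Im a)\<^sup>2)) = c"
      unfolding c_def using weights_bounds(1)[OF w pos] by (subst ennreal_mult[symmetric]) auto
    have "moment_density w K_H (Suc k) (z(k := a)) = c * moment_density w (palm_kernel K_H a) k z"
      unfolding moment_density_def m1 m2 m3[symmetric] by (simp only: mult_ac)
    then show "indicator (palm_tuples \<alpha> \<beta> A k) (z(k := a)) * moment_density w K_H (Suc k) (z(k := a)) =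
        (indicator (strip \<alpha> \<beta> {0..1}) a * c) * f z"
      by (simp add: 1 f_def mult_ac)
  qed
  also have "\<dots> = (indicator (strip \<alpha> \<beta> {0..1}) a * c) * (\<integral>\<^sup>+z. f z \<partial>dA_power k)"
    by (rule nn_integral_cmult[OF f])
  also have "(\<integral>\<^sup>+z. f z \<partial>dA_power k) = (\<integral>\<^sup>+z. f (\<lambda>i\<in>{..<k}. z i + of_real (Re a)) \<partial>dA_power k)"
    by (rule nn_integral_dA_power_translate[OF f])
  also have "\<dots> = void_moment \<alpha> \<beta> w A k (Im a)"
    unfolding void_moment_def b_def[symmetric]
  proof (rule nn_integral_cong)
    fix z assume z: "z \<in> space (dA_power k)"
    let ?z = "\<lambda>i\<in>{..<k}. z i + complex_of_real (Re a)"
    have "?z \<in> space (dA_power k)"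
      using z by (auto simp: space_PiM PiE_iff upper_half_plane_def)
    then have "?z \<in> T \<longleftrightarrow> z \<in> PiE {..<k} (\<lambda>_. strip \<alpha> \<beta> A)"
      using z by (auto simp: T_def strip_def PiE_iff space_PiM)
    moreover have "moment_density w (palm_kernel K_H a) k ?z = moment_density w (palm_kernel K_H b) k z"
      unfolding moment_density_def
    proof (intro arg_cong2[where f = "(*)"] prod.cong refl arg_cong[where f = ennreal] arg_cong[where f = Re] kernel_det_cong)
      fix i j assume "i < k" "j < k"
      then show "palm_kernel K_H a (?z i) (?z j) = palm_kernel K_H b (z i) (z j)"
        using palm_K_H_translate[of b "Re a" "z i" "z j"] by (simp add: ab[symmetric])
    qed simp
    ultimately show "f ?z = indicator (PiE {..<k} (\<lambda>_. strip \<alpha> \<beta> A)) z * moment_density w (palm_kernel K_H b) k z"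
      by (simp add: f_def indicator_def)
  qed
  finally show ?thesis unfolding c_def .
qed

text \<open>The values of w outside the positive half-line are arbitrary, so it is the cut-off
  function that is Borel on the whole line.\<close>

lemma weights_indicator_measurable:
  assumes "w \<in> weights \<alpha> \<beta>"
  shows "(\<lambda>y. indicator {0<..} y * w y) \<in> borel_measurable borel"
  using assms borel_measurable_restrict_space_iff[of "{0<..}" borel w]
  by (simp add: weights_def)

text \<open>The inner integral depends on Re a only through the indicator of [0, 1], which has
  length 1, so integrating over a leaves an integral over heights.\<close>

lemma palm_tuples_moment:
  assumes w: "w \<in> weights \<alpha> \<beta>" and \<alpha>: "0 < \<alpha>" and A: "A \<in> sets borel"
  shows "(\<integral>\<^sup>+z. indicator (palm_tuples \<alpha> \<beta> A k) z * moment_density w K_H (Suc k) z \<partial>dA_power (Suc k)) =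
    (\<integral>\<^sup>+y. ennreal (w y / (4 * pi * y\<^sup>2)) * void_moment \<alpha> \<beta> w A k y \<partial>restrict_space lborel {0<..})"
proof -
  define g where "g z = indicator (palm_tuples \<alpha> \<beta> A k) z * moment_density w K_H (Suc k) z" for z
  define h where "h y = ennreal (w y / (4 * pi * y\<^sup>2)) * void_moment \<alpha> \<beta> w A k y" for y
  have id: "(\<lambda>z. z) \<in> measurable (dA_power (Suc k)) (dA_power (Suc k))" by simp
  have g: "g \<in> borel_measurable (PiM (insert k {..<k}) (\<lambda>_. dA))"
    unfolding g_def lessThan_Suc[symmetric]
    by (intro borel_measurable_times_ennreal borel_measurable_indicator palm_tuples_sets[OF \<alpha> A]
      measurable_moment_density[OF w id] measurable_K_H measurable_component_id[OF id])
  note [measurable] = measurable_void_moment[OF w \<alpha> A] weights_indicator_measurable[OF w]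
  have h [measurable]: "(\<lambda>y. h y * indicator {0<..} y) \<in> borel_measurable borel"
  proof -
    have "h y * indicator {0<..} y = ennreal ((indicator {0<..} y * w y) / (4 * pi * y\<^sup>2)) * void_moment \<alpha> \<beta> w A k y" for y
      by (simp add: h_def indicator_def)
    moreover have "(\<lambda>y. ennreal ((indicator {0<..} y * w y) / (4 * pi * y\<^sup>2)) * void_moment \<alpha> \<beta> w A k y) \<in> borel_measurable borel"
      by measurable
    ultimately show ?thesis by simp
  qed
  \<comment> \<open>This absorbs the height condition of the strip: where it fails, the weight is 0
    already.\<close>
  have h0: "h y = 0" if "y > 0" "y \<notin> {\<alpha>..\<beta>}" for y
    using weights_bounds(3)[OF w that] by (simp add: h_def)
  have hm: "(\<lambda>a. indicator (strip \<alpha> \<beta> {0..1}) a * h (Im a)) \<in> borel_measurable dA"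
  proof -
    have "(\<lambda>a. indicator (strip \<alpha> \<beta> {0..1}) a * (h (Im a) * indicator {0<..} (Im a))) \<in> borel_measurable dA"
      by (intro borel_measurable_times_ennreal borel_measurable_indicator strip_sets(2)[OF \<alpha>]
        measurable_compose[OF measurable_dA_Im h]) auto
    also have "(\<lambda>a. indicator (strip \<alpha> \<beta> {0..1}) a * (h (Im a) * indicator {0<..} (Im a))) =
        (\<lambda>a. indicator (strip \<alpha> \<beta> {0..1}) a * h (Im a))"
      using \<alpha> by (auto simp: fun_eq_iff indicator_def strip_def)
    finally show ?thesis .
  qed
  have "(\<integral>\<^sup>+z. g z \<partial>dA_power (Suc k)) = (\<integral>\<^sup>+a. (\<integral>\<^sup>+z. g (z(k := a)) \<partial>dA_power k) \<partial>dA)"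
    unfolding lessThan_Suc by (rule dA.product_nn_integral_insert_rev[OF _ _ g]) auto
  also have "\<dots> = (\<integral>\<^sup>+a. indicator (strip \<alpha> \<beta> {0..1}) a * h (Im a) \<partial>dA)"
    unfolding g_def h_def
    by (intro nn_integral_cong) (simp add: palm_tuples_inner[OF w \<alpha> A] mult.assoc)
  also have "\<dots> = (\<integral>\<^sup>+x. (\<integral>\<^sup>+y. indicator (strip \<alpha> \<beta> {0..1}) (Complex x y) * h y * indicator {0<..} y \<partial>lborel) \<partial>lborel)"
    by (subst nn_integral_dA[OF hm]) simp
  also have "\<dots> = (\<integral>\<^sup>+x. (\<integral>\<^sup>+y. indicator {0..1::real} x * (h y * indicator {0<..} y) \<partial>lborel) \<partial>lborel)"
  proof (intro nn_integral_cong)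
    fix x y :: real
    show "indicator (strip \<alpha> \<beta> {0..1}) (Complex x y) * h y * indicator {0<..} y =
        indicator {0..1::real} x * (h y * indicator {0<..} y)"
      using h0[of y] by (auto simp: indicator_def strip_def)
  qed
  also have "\<dots> = (\<integral>\<^sup>+x. indicator {0..1::real} x * (\<integral>\<^sup>+y. h y * indicator {0<..} y \<partial>lborel) \<partial>lborel)"
    using h by (intro nn_integral_cong nn_integral_cmult) simp
  also have "\<dots> = (\<integral>\<^sup>+y. h y * indicator {0<..} y \<partial>lborel)"
    by (subst nn_integral_multc) auto
  also have "\<dots> = (\<integral>\<^sup>+y. h y \<partial>restrict_space lborel {0<..})"
    by (subst nn_integral_restrict_space) auto
  finally show ?thesis by (simp add: g_def h_def)
qed

text \<open>Both sides are sums of one alternating series, so they agree without any direct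
  comparison of the processes. Measurability of v in y is a by-product, obtained although
  \<open>PM\<close> is an arbitrary choice of one law per height.\<close>

lemma isolated_count_mixture:
  assumes P: "thinned_law w K_H P"
    and PM: "\<And>y. y > 0 \<Longrightarrow> thinned_law w (palm_kernel K_H (\<i> * of_real y)) (PM y)"
    and w: "w \<in> weights \<alpha> \<beta>" and \<alpha>: "0 < \<alpha>" and A: "A \<in> sets borel" "bounded A"
  defines "v \<equiv> \<lambda>y. measure (PM y) {\<xi> \<in> simple_configs upper_half_plane. atoms \<xi> \<inter> strip \<alpha> \<beta> A = {}}"
  shows "v \<in> borel_measurable (restrict_space lborel {0<..})"
    and "(\<integral>\<xi>. isolated_count \<alpha> \<beta> A (atoms \<xi>) \<partial>P) = (\<integral>y. w y / (4 * pi * y\<^sup>2) * v y \<partial>restrict_space lborel {0<..})"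
proof -
  let ?R = "restrict_space lborel {0::real<..}"
  define D where "D = density ?R (\<lambda>y. ennreal (w y / (4 * pi * y\<^sup>2)))"
  have wR [measurable]: "w \<in> borel_measurable ?R"
    using w by (simp add: weights_def cong: measurable_cong_sets sets_restrict_space_cong[OF sets_lborel])
  have idR [measurable]: "(\<lambda>y. y) \<in> borel_measurable ?R"
    by (rule measurable_restrict_space1) simp
  have spR: "space ?R = {0<..}" "space D = {0<..}" by (auto simp: D_def space_restrict_space)
  have vm: "void_moment \<alpha> \<beta> w A k \<in> borel_measurable ?R" for k
    using measurable_void_moment[OF w \<alpha> A(1)] by (intro measurable_restrict_space1) simp
  have psd: "psd_kernel_on upper_half_plane (palm_kernel K_H (\<i> * of_real y))"
    "\<And>z. z \<in> upper_half_plane \<Longrightarrow> Re (palm_kernel K_H (\<i> * of_real y) z z) \<le> Re (K_H z z)" if "y > 0" for y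
  proof -
    have "\<i> * of_real y \<in> upper_half_plane" using that by (simp add: upper_half_plane_def)
    then show "psd_kernel_on upper_half_plane (palm_kernel K_H (\<i> * of_real y))"
      "\<And>z. z \<in> upper_half_plane \<Longrightarrow> Re (palm_kernel K_H (\<i> * of_real y) z z) \<le> Re (K_H z z)"
      using psd_kernel_on_palm[OF psd_K_H] palm_kernel_diag_le[OF psd_K_H] by auto
  qed
  define V where "V = 1 / (4 * pi * \<alpha>\<^sup>2) * measure dA (strip \<alpha> \<beta> A)"
  have V: "V \<ge> 0" by (simp add: V_def)
  have bd: "void_moment \<alpha> \<beta> w A k y \<le> ennreal (V ^ k)" if "y > 0" for k y
    unfolding void_moment_def V_def by (rule moment_bound[OF psd[OF that] w \<alpha> A order_refl])
  \<comment> \<open>Integrating the height-y moments against the unnormalised weight returns the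
    moments around a marked point. This identifies the two series and also transfers the bound
    needed for the exchange.\<close>
  have int: "(\<integral>\<^sup>+y. void_moment \<alpha> \<beta> w A k y \<partial>D) =
      (\<integral>\<^sup>+z. indicator (palm_tuples \<alpha> \<beta> A k) z * moment_density w K_H (Suc k) z \<partial>dA_power (Suc k))" for k
    unfolding D_def palm_tuples_moment[OF w \<alpha> A(1)] using vm by (intro nn_integral_density) auto
  obtain C V' where C: "0 \<le> C" "0 \<le> V'"
    "\<And>k. (\<integral>\<^sup>+z. indicator (palm_tuples \<alpha> \<beta> A k) z * moment_density w K_H (Suc k) z \<partial>dA_power (Suc k)) \<le> ennreal (C * V' ^ k)"
    using isolated_count_expectation(3)[OF P w \<alpha> A] by blast
  have *: "(\<lambda>k. (-1) ^ k / fact k * enn2real (\<integral>\<^sup>+y. void_moment \<alpha> \<beta> w A k y \<partial>D)) sums (\<integral>y. v y \<partial>D) \<and>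
      v \<in> borel_measurable D"
  proof (rule alternating_expectation)
    show "void_moment \<alpha> \<beta> w A k \<in> borel_measurable D" for k
      using vm by (simp add: D_def)
    fix y assume "y \<in> space D"
    then have y: "y > 0" by (simp add: spR)
    show fin: "void_moment \<alpha> \<beta> w A k y < \<infinity>" for k
      using bd[OF y, of k] by (rule order_le_less_trans) simp
    show "summable (\<lambda>k. enn2real (void_moment \<alpha> \<beta> w A k y) / fact k)"
    proof (rule summable_comparison_test')
      show "summable (\<lambda>k. inverse (fact k) * V ^ k)" by (rule summable_exp)
      fix k :: nat
      have "enn2real (void_moment \<alpha> \<beta> w A k y) \<le> V ^ k"
        using bd[OF y, of k] V by (intro enn2real_leI) auto
      then show "norm (enn2real (void_moment \<alpha> \<beta> w A k y) / fact k) \<le> inverse (fact k) * V ^ k"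
        by (simp add: divide_simps)
    qed
    show "(\<lambda>k. (- 1) ^ k / fact k * enn2real (void_moment \<alpha> \<beta> w A k y)) sums v y"
      unfolding void_moment_def v_def by (rule void_probability[OF PM[OF y] psd[OF y] w \<alpha> A])
  next
    show "(\<integral>\<^sup>+y. void_moment \<alpha> \<beta> w A k y \<partial>D) \<le> ennreal (C * V' ^ k)" for k
      unfolding int by (rule C)
  qed (use C in auto)
  then show v: "v \<in> borel_measurable ?R" by (simp add: D_def)
  have "(\<integral>\<xi>. isolated_count \<alpha> \<beta> A (atoms \<xi>) \<partial>P) = (\<integral>y. v y \<partial>D)"
    using sums_unique2[OF isolated_count_expectation(1)[OF P w \<alpha> A] conjunct1[OF *, unfolded int]] .
  also have "\<dots> = (\<integral>y. (w y / (4 * pi * y\<^sup>2)) *\<^sub>R v y \<partial>?R)"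
    unfolding D_def using v weights_bounds(1)[OF w] by (intro integral_density AE_I2) (auto simp: spR)
  finally show "(\<integral>\<xi>. isolated_count \<alpha> \<beta> A (atoms \<xi>) \<partial>P) = (\<integral>y. w y / (4 * pi * y\<^sup>2) * v y \<partial>?R)"
    by simp
qed

section \<open>The reduced Palm distribution\<close>

text \<open>\<open>diff_measure\<close> subtracts masses set by set. As x is an atom, no subtraction
  is truncated at 0, and infinite counts stay infinite after losing one point.\<close>

lemma diff_measure_return:
  assumes mu: "\<mu> \<in> simple_configs (UNIV :: real set)" and x: "x \<in> atoms \<mu>"
  shows "diff_measure \<mu> (return borel x) = point_measure_on UNIV (atoms \<mu> - {x})"
proof -
  let ?N = "point_measure_on UNIV (atoms \<mu> - {x})"
  have sp: "space \<mu> = UNIV" "sets \<mu> = sets borel"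
    using simple_configsE(4,5)[OF mu] by (simp_all add: restrict_space_UNIV_borel)
  have eq: "emeasure \<mu> B - emeasure (return borel x) B = emeasure ?N B" if B: "B \<in> sets borel" for B
  proof -
    have "emeasure \<mu> B = emeasure (count_space UNIV) (atoms \<mu> \<inter> B)"
      using B by (intro emeasure_simple_configs[OF mu]) (simp add: restrict_space_UNIV_borel)
    moreover have "emeasure ?N B = emeasure (count_space UNIV) ((atoms \<mu> - {x}) \<inter> B)"
      using B by (subst emeasure_point_measure_on) (auto simp: restrict_space_UNIV_borel emeasure_count_space)
    moreover have "emeasure (count_space UNIV) (atoms \<mu> \<inter> B) - indicator B x =
        emeasure (count_space UNIV) ((atoms \<mu> - {x}) \<inter> B)"
    proof (cases "x \<in> B")
      case True
      then have "(atoms \<mu> - {x}) \<inter> B = (atoms \<mu> \<inter> B) - {x}" by auto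
      then show ?thesis
        using True x emeasure_Diff[of "count_space UNIV" "{x}" "atoms \<mu> \<inter> B"]
        by (simp add: emeasure_count_space_finite)
    next
      case False
      then have "(atoms \<mu> - {x}) \<inter> B = atoms \<mu> \<inter> B" by auto
      then show ?thesis using False by simp
    qed
    ultimately show ?thesis using B by simp
  qed
  have "diff_measure \<mu> (return borel x) = measure_of UNIV (sets borel) (\<lambda>B. emeasure \<mu> B - emeasure (return borel x) B)"
    by (simp add: diff_measure_def sp)
  also have "\<dots> = measure_of UNIV (sets borel) (emeasure ?N)"
  proof (rule measure_of_eq)
    fix B :: "real set" assume "B \<in> sigma_sets UNIV (sets borel)"
    then have "B \<in> sets borel" using sets.sigma_sets_eq[of "borel :: real measure"] by (simp only: space_borel)
    then show "emeasure \<mu> B - emeasure (return borel x) B = emeasure ?N B" by (rule eq)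
  qed simp
  also have "\<dots> = ?N"
    using measure_of_of_measure[of ?N] by (simp add: restrict_space_UNIV_borel)
  finally show ?thesis .
qed

section \<open>The Palm identity tested on void events\<close>

definition void_indicator :: "real set \<Rightarrow> real measure \<Rightarrow> real" where
  "void_indicator A \<mu> = (if emeasure \<mu> A = 0 then 1 else 0)"

lemma bounded_functional_void_indicator:
  assumes "A \<in> sets borel"
  shows "bounded_functional (void_indicator A)"
proof -
  have "(\<lambda>\<mu>. emeasure \<mu> A) \<in> borel_measurable N_R"
    using assms by (intro measurable_config_emeasure) (auto simp: restrict_space_UNIV_borel)
  then have "void_indicator A \<in> borel_measurable N_R"
    unfolding void_indicator_def[abs_def] by measurable
  moreover have "bounded (void_indicator A ` simple_configs UNIV)"
    by (rule boundedI[of _ 1]) (auto simp: void_indicator_def)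
  ultimately show ?thesis by (simp add: bounded_functional_def)
qed

lemma void_indicator_shift:
  assumes mu: "\<mu> \<in> simple_configs UNIV" and x: "x \<in> atoms \<mu>" and A: "A \<in> sets borel"
  shows "void_indicator A (shift x (diff_measure \<mu> (return borel x))) =
    (if \<forall>t\<in>atoms \<mu>. t \<noteq> x \<longrightarrow> t - x \<notin> A then 1 else 0)"
proof -
  let ?N = "point_measure_on UNIV (atoms \<mu> - {x})"
  have m: "(\<lambda>t. t - x) \<in> measurable ?N borel"
    by (simp cong: measurable_cong_sets add: restrict_space_UNIV_borel)
  have B: "(\<lambda>t. t - x) -` A \<in> sets borel"
    using measurable_sets[OF m A] by (simp add: restrict_space_UNIV_borel)
  have "emeasure (shift x (diff_measure \<mu> (return borel x))) A = emeasure ?N ((\<lambda>t. t - x) -` A)"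
    unfolding shift_def diff_measure_return[OF mu x] using A by (simp add: emeasure_distr[OF m])
  also have "\<dots> = emeasure (count_space (atoms \<mu> - {x})) ((atoms \<mu> - {x}) \<inter> (\<lambda>t. t - x) -` A)"
    using B by (intro emeasure_point_measure_on) (auto simp: restrict_space_UNIV_borel)
  finally have "emeasure (shift x (diff_measure \<mu> (return borel x))) A = 0 \<longleftrightarrow>
      (atoms \<mu> - {x}) \<inter> (\<lambda>t. t - x) -` A = {}"
    by (simp add: emeasure_count_space_eq_0)
  also have "\<dots> \<longleftrightarrow> (\<forall>t\<in>atoms \<mu>. t \<noteq> x \<longrightarrow> t - x \<notin> A)" by auto
  finally show ?thesis by (simp add: void_indicator_def)
qed

definition palm_sum :: "real set \<Rightarrow> real measure \<Rightarrow> real" where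
  "palm_sum A \<mu> = (\<Sum>x\<in>atoms \<mu> \<inter> {0..1}. void_indicator A (shift x (diff_measure \<mu> (return borel x))))"

lemma palm_sum_eq:
  assumes mu: "\<mu> \<in> simple_configs UNIV" and A: "A \<in> sets borel"
  shows "palm_sum A \<mu> = (\<Sum>x\<in>atoms \<mu> \<inter> {0..1}. if \<forall>t\<in>atoms \<mu>. t \<noteq> x \<longrightarrow> t - x \<notin> A then 1 else 0)"
  unfolding palm_sum_def using void_indicator_shift[OF mu _ A] by (intro sum.cong) auto

text \<open>The sum ranges over atoms x subject to a condition on all other atoms. Written as two
  nested integrals against \<mu>, the inner one with x as a parameter, it is measurable by
  \<open>nn_integral_config_measurable\<close> applied twice.\<close>

lemma measurable_palm_sum:
  assumes A [measurable]: "A \<in> sets borel"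
  shows "palm_sum A \<in> borel_measurable N_R"
proof -
  define f where "f p = (if snd p \<noteq> snd (fst p) \<and> snd p - snd (fst p) \<in> A then 1 else 0 :: ennreal)"
    for p :: "(real measure \<times> real) \<times> real"
  have f: "f \<in> borel_measurable ((N_R \<Otimes>\<^sub>M borel) \<Otimes>\<^sub>M restrict_space borel UNIV)"
    unfolding f_def restrict_space_UNIV_borel by measurable
  have fst: "fst \<in> measurable (N_R \<Otimes>\<^sub>M borel) N_R" by (rule measurable_fst)
  have inner: "(\<lambda>\<omega>. \<integral>\<^sup>+t. f (\<omega>, t) \<partial>fst \<omega>) \<in> borel_measurable (N_R \<Otimes>\<^sub>M borel)"
    by (rule nn_integral_config_measurable[OF open_UNIV fst f])
  define g where "g \<omega> = (if snd \<omega> \<in> {0..1} \<and> (\<integral>\<^sup>+t. f (\<omega>, t) \<partial>fst \<omega>) = 0 then 1 else 0 :: ennreal)"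
    for \<omega> :: "real measure \<times> real"
  have g: "g \<in> borel_measurable (N_R \<Otimes>\<^sub>M restrict_space borel UNIV)"
    unfolding g_def restrict_space_UNIV_borel using inner by measurable
  have id: "(\<lambda>\<mu>. \<mu>) \<in> measurable N_R N_R" by simp
  have "(\<lambda>\<mu>. enn2real (\<integral>\<^sup>+x. g (\<mu>, x) \<partial>\<mu>)) \<in> borel_measurable N_R"
    using nn_integral_config_measurable[OF open_UNIV id g] by measurable
  moreover have "enn2real (\<integral>\<^sup>+x. g (\<mu>, x) \<partial>\<mu>) = palm_sum A \<mu>" if mu: "\<mu> \<in> simple_configs UNIV" for \<mu>
  proof -
    have fin: "finite (atoms \<mu> \<inter> {0..1})" by (rule simple_configsE(3)[OF mu]) auto
    have fx: "(\<lambda>t. f ((\<mu>, x), t)) \<in> borel_measurable (restrict_space borel UNIV)" for x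
      unfolding f_def restrict_space_UNIV_borel by simp
    have zero: "(\<integral>\<^sup>+t. f ((\<mu>, x), t) \<partial>\<mu>) = 0 \<longleftrightarrow> (\<forall>t\<in>atoms \<mu>. t \<noteq> x \<longrightarrow> t - x \<notin> A)" for x
      unfolding nn_integral_simple_configs[OF mu fx]
      by (auto simp: nn_integral_0_iff_AE AE_count_space f_def split: if_splits)
    have geq: "g (\<mu>, x) = (if x \<in> {0..1} \<and> (\<forall>t\<in>atoms \<mu>. t \<noteq> x \<longrightarrow> t - x \<notin> A) then 1 else 0)" for x
      unfolding g_def fst_conv snd_conv zero ..
    have gm: "(\<lambda>x. g (\<mu>, x)) \<in> borel_measurable (restrict_space borel UNIV)"
      using measurable_compose[OF measurable_Pair1' g] mu by simp
    have "(\<integral>\<^sup>+x. g (\<mu>, x) \<partial>\<mu>) = (\<integral>\<^sup>+x. g (\<mu>, x) \<partial>count_space (atoms \<mu>))"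
      by (rule nn_integral_simple_configs[OF mu gm])
    also have "\<dots> = (\<Sum>x\<in>atoms \<mu> \<inter> {0..1}. g (\<mu>, x))"
      using fin by (intro nn_integral_count_space') (auto simp: geq)
    also have "\<dots> = (\<Sum>x\<in>atoms \<mu> \<inter> {0..1}. ennreal (if \<forall>t\<in>atoms \<mu>. t \<noteq> x \<longrightarrow> t - x \<notin> A then 1 else 0))"
      by (intro sum.cong) (auto simp: geq)
    also have "\<dots> = ennreal (palm_sum A \<mu>)"
      unfolding palm_sum_eq[OF mu A] by (intro sum_ennreal) auto
    finally show ?thesis
      by (simp add: palm_sum_eq[OF mu A] sum_nonneg)
  qed
  ultimately show ?thesis
    by (subst measurable_cong[symmetric]) auto
qed

text \<open>Since Re is injective on the atoms, real atoms correspond to half-plane atoms, and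
  differing from the marked point means the same before and after projection.\<close>

lemma palm_sum_regular:
  assumes S: "\<xi> \<in> simple_configs upper_half_plane" "atoms \<xi> \<subseteq> strip \<alpha> \<beta> UNIV" "inj_on Re (atoms \<xi>)"
    and \<alpha>: "0 < \<alpha>" and A: "A \<in> sets borel"
  shows "palm_sum A (proj_config \<xi>) = isolated_count \<alpha> \<beta> A (atoms \<xi>)"
proof -
  have at: "atoms (proj_config \<xi>) = Re ` atoms \<xi>"
    using proj_Re_regular(2)[OF S(1) \<alpha> S(2,3)] by simp
  have mem: "proj_config \<xi> \<in> simple_configs UNIV"
    using proj_Re_regular(1)[OF S(1) \<alpha> S(2,3)] by (simp add: proj_config_def)
  have im: "Re ` atoms \<xi> \<inter> {0..1} = Re ` (atoms \<xi> \<inter> strip \<alpha> \<beta> {0..1})"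
    using S(2) by (auto simp: strip_def)
  have inj: "inj_on Re (atoms \<xi> \<inter> strip \<alpha> \<beta> {0..1})"
    using S(3) by (rule inj_on_subset) auto
  have "palm_sum A (proj_config \<xi>) =
      (\<Sum>a\<in>atoms \<xi> \<inter> strip \<alpha> \<beta> {0..1}. if \<forall>t\<in>Re ` atoms \<xi>. t \<noteq> Re a \<longrightarrow> t - Re a \<notin> A then 1 else 0)"
    unfolding palm_sum_eq[OF mem A] at im sum.reindex[OF inj] by simp
  also have "\<dots> = isolated_count \<alpha> \<beta> A (atoms \<xi>)"
    unfolding isolated_count_def
  proof (rule sum.cong)
    fix a assume a: "a \<in> atoms \<xi> \<inter> strip \<alpha> \<beta> {0..1}"
    have "Re z \<noteq> Re a \<longleftrightarrow> z \<noteq> a" if "z \<in> atoms \<xi>" for z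
      using inj_on_eq_iff[OF S(3) that, of a] a by simp
    then have "(\<forall>t\<in>Re ` atoms \<xi>. t \<noteq> Re a \<longrightarrow> t - Re a \<notin> A) \<longleftrightarrow> palm_neighbours \<alpha> \<beta> A (atoms \<xi>) a = {}"
      using S(2) unfolding palm_neighbours_def by blast
    then show "(if \<forall>t\<in>Re ` atoms \<xi>. t \<noteq> Re a \<longrightarrow> t - Re a \<notin> A then 1 else 0 :: real) =
        (if palm_neighbours \<alpha> \<beta> A (atoms \<xi>) a = {} then 1 else 0)" by simp
  qed simp
  finally show ?thesis .
qed

lemma void_event_sets:
  assumes "A \<in> sets borel"
  shows "{\<mu> \<in> simple_configs UNIV. emeasure \<mu> A = 0} \<in> sets N_R"
proof -
  have "(\<lambda>\<mu>. emeasure \<mu> A) \<in> borel_measurable N_R"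
    using assms by (intro measurable_config_emeasure) (auto simp: restrict_space_UNIV_borel)
  then have "{\<mu> \<in> space N_R. emeasure \<mu> A = 0} \<in> sets N_R" by measurable
  then show ?thesis by simp
qed

text \<open>The Palm identity is applied with B = [0, 1] and a void indicator. Configurations where
  the projection is irregular form a null set, so the expectation can be computed in the
  half-plane.\<close>

lemma reduced_palm_void:
  assumes P: "determinantal_law K_H PZ" and w: "w \<in> weights \<alpha> \<beta>" and \<alpha>: "0 < \<alpha>"
    and Q: "reduced_palm (law_X w PZ) l Q" and A: "A \<in> sets borel" and Ab: "bounded A"
  shows "l * measure Q {\<mu> \<in> simple_configs UNIV. emeasure \<mu> A = 0} =
    (\<integral>\<xi>. isolated_count \<alpha> \<beta> A (atoms \<xi>) \<partial>law_M w PZ)"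
proof -
  have L: "thinned_law w K_H (law_M w PZ)" by (rule thinned_law_law_M[OF P w])
  have pc: "proj_config \<in> measurable (law_M w PZ) N_R"
    using measurable_proj_config by (simp cong: measurable_cong_sets add: thinned_lawD(2)[OF L])
  have Qs: "sets Q = sets N_R" "space Q = simple_configs UNIV"
    using Q sets_eq_imp_space_eq[of Q N_R] by (auto simp: reduced_palm_def)
  have "(\<integral>\<mu>. palm_sum A \<mu> \<partial>law_X w PZ) = measure lborel {0..1::real} * l * (\<integral>\<mu>. void_indicator A \<mu> \<partial>Q)"
    unfolding palm_sum_def using Q bounded_functional_void_indicator[OF A]
    unfolding reduced_palm_def by (elim conjE allE[of _ "{0..1}"] allE[of _ "void_indicator A"]) auto
  also have "(\<integral>\<mu>. void_indicator A \<mu> \<partial>Q) = (\<integral>\<mu>. indicator {\<mu> \<in> simple_configs UNIV. emeasure \<mu> A = 0} \<mu> \<partial>Q)"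
    by (intro Bochner_Integration.integral_cong) (auto simp: void_indicator_def Qs)
  also have "\<dots> = measure Q {\<mu> \<in> simple_configs UNIV. emeasure \<mu> A = 0}"
    using void_event_sets[OF A] by (auto simp: Qs intro!: arg_cong[where f = "measure Q"])
  finally have "l * measure Q {\<mu> \<in> simple_configs UNIV. emeasure \<mu> A = 0} = (\<integral>\<mu>. palm_sum A \<mu> \<partial>law_X w PZ)"
    by simp
  also have "\<dots> = (\<integral>\<xi>. palm_sum A (proj_config \<xi>) \<partial>law_M w PZ)"
    unfolding law_X_def proj_config_def[symmetric]
    by (rule integral_distr[OF pc measurable_palm_sum[OF A]])
  also have "\<dots> = (\<integral>\<xi>. isolated_count \<alpha> \<beta> A (atoms \<xi>) \<partial>law_M w PZ)"
  proof (rule integral_cong_AE)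
    show "(\<lambda>\<xi>. palm_sum A (proj_config \<xi>)) \<in> borel_measurable (law_M w PZ)"
      by (rule measurable_compose[OF pc measurable_palm_sum[OF A]])
    show "(\<lambda>\<xi>. isolated_count \<alpha> \<beta> A (atoms \<xi>)) \<in> borel_measurable (law_M w PZ)"
      by (rule isolated_count_expectation(2)[OF L w \<alpha> A Ab])
    show "AE \<xi> in law_M w PZ. palm_sum A (proj_config \<xi>) = isolated_count \<alpha> \<beta> A (atoms \<xi>)"
      using thinned_law_AE_strip[OF L w] thinned_law_AE_inj[OF L] AE_space
      by eventually_elim (simp add: palm_sum_regular[OF _ _ _ \<alpha> A] thinned_lawD(3)[OF L])
  qed
  finally show ?thesis .
qed

section \<open>Mixing over heights\<close>

text \<open>On [\<alpha>, \<beta>] the function w / y^2 lies between w / \<beta>^2 and 1 /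
  \<alpha>^2. The first bound transfers positivity from the integral of w, the second gives
  integrability.\<close>

lemma weights_integral:
  assumes "0 < \<alpha>" "\<alpha> < \<beta>" and w: "w \<in> weights \<alpha> \<beta>"
  shows "(LINT u:{0<..}|lborel. w u / u\<^sup>2) > 0"
    and "(\<integral>\<^sup>+y. ennreal (w y / y\<^sup>2) \<partial>restrict_space lborel {0<..}) = ennreal (LINT u:{0<..}|lborel. w u / u\<^sup>2)"
proof -
  note [measurable] = weights_indicator_measurable[OF w]
  define u where "u y = indicator {0<..} y * w y / y\<^sup>2" for y :: real
  define v where "v y = indicator {\<alpha>..\<beta>} y * (indicator {0<..} y * w y)" for y :: real
  have um: "u \<in> borel_measurable borel" and vm: "v \<in> borel_measurable borel"
    unfolding u_def v_def by measurable
  have u0: "0 \<le> u y" for y using weights_bounds(1)[OF w, of y] by (simp add: u_def indicator_def)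
  have ub: "u y \<le> indicator {\<alpha>..\<beta>} y * (1 / \<alpha>\<^sup>2)" for y
  proof (cases "y \<in> {\<alpha>..\<beta>}")
    case True
    then have y: "y > 0" using assms(1) by auto
    have "w y / y\<^sup>2 \<le> 1 / \<alpha>\<^sup>2"
      using True y weights_bounds[OF w y] assms(1) by (intro frac_le power_mono) auto
    then show ?thesis using True y by (simp add: u_def)
  next
    case False
    then show ?thesis using weights_bounds(3)[OF w, of y] by (simp add: u_def indicator_def)
  qed
  have v0: "0 \<le> v y" "v y \<le> indicator {\<alpha>..\<beta>} y * 1" for y
    using weights_bounds(1,2)[OF w, of y] by (auto simp: v_def indicator_def)
  have vu: "v y / \<beta>\<^sup>2 \<le> u y" for y
  proof (cases "y \<in> {\<alpha>..\<beta>}")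
    case True
    then have y: "y > 0" using assms(1) by auto
    have "w y / \<beta>\<^sup>2 \<le> w y / y\<^sup>2"
      using True y weights_bounds(1)[OF w y] by (intro divide_left_mono power_mono) auto
    then show ?thesis using True y by (simp add: u_def v_def)
  next
    case False
    then show ?thesis using u0[of y] by (simp add: v_def)
  qed
  have I: "integrable lborel (\<lambda>y. indicator {\<alpha>..\<beta>} y * c)" for c :: real
    using emeasure_compact_finite[OF compact_Icc, of \<alpha> \<beta>]
    by (intro integrable_mult_left integrable_real_indicator) auto
  have ui: "integrable lborel u"
    by (rule Bochner_Integration.integrable_bound[OF I[of "1 / \<alpha>\<^sup>2"]]) (use um u0 ub in \<open>auto intro!: AE_I2\<close>)
  have vi: "integrable lborel v"
    by (rule Bochner_Integration.integrable_bound[OF I[of 1]]) (use vm v0 in \<open>auto intro!: AE_I2\<close>)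
  have "(LINT y:{\<alpha>..\<beta>}|lborel. w y) = (\<integral>y. v y \<partial>lborel)"
    unfolding set_lebesgue_integral_def using assms(1)
    by (intro Bochner_Integration.integral_cong) (auto simp: v_def indicator_def)
  then have "0 < (\<integral>y. v y \<partial>lborel)" using w by (simp add: weights_def)
  then have "0 < (\<integral>y. v y / \<beta>\<^sup>2 \<partial>lborel)" using assms(1,2) by simp
  also have "\<dots> \<le> (\<integral>y. u y \<partial>lborel)"
    using vi ui vu by (intro integral_mono) auto
  finally have pos: "0 < (\<integral>y. u y \<partial>lborel)" .
  have Z: "(LINT u:{0<..}|lborel. w u / u\<^sup>2) = (\<integral>y. u y \<partial>lborel)"
    unfolding set_lebesgue_integral_def
    by (intro Bochner_Integration.integral_cong) (auto simp: u_def)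
  show "(LINT u:{0<..}|lborel. w u / u\<^sup>2) > 0" using pos by (simp add: Z)
  have "(\<integral>\<^sup>+y. ennreal (w y / y\<^sup>2) \<partial>restrict_space lborel {0<..}) =
      (\<integral>\<^sup>+y. ennreal (w y / y\<^sup>2) * indicator {0<..} y \<partial>lborel)"
    by (rule nn_integral_restrict_space) simp
  also have "\<dots> = (\<integral>\<^sup>+y. ennreal (u y) \<partial>lborel)"
    by (intro nn_integral_cong) (auto simp: u_def indicator_def)
  also have "\<dots> = ennreal (\<integral>y. u y \<partial>lborel)"
    using ui u0 by (intro nn_integral_eq_integral) auto
  finally show "(\<integral>\<^sup>+y. ennreal (w y / y\<^sup>2) \<partial>restrict_space lborel {0<..}) = ennreal (LINT u:{0<..}|lborel. w u / u\<^sup>2)"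
    by (simp add: Z)
qed

text \<open>The intensity is the normalising constant of \<open>height_law\<close> divided by 4 pi,
  so the weight w / (4 pi y^2) is the intensity times the density of
  \<open>height_law\<close>.\<close>

lemma height_law_props:
  assumes "0 < \<alpha>" "\<alpha> < \<beta>" and w: "w \<in> weights \<alpha> \<beta>"
  shows "prob_space (height_law w)" "space (height_law w) = {0<..}"
    "sets (height_law w) = sets (restrict_space lborel {0<..})"
    "\<And>v. v \<in> borel_measurable (restrict_space lborel {0<..}) \<Longrightarrow>
      (\<integral>y. w y / (4 * pi * y\<^sup>2) * v y \<partial>restrict_space lborel {0<..}) = intensity w * (\<integral>y. v y \<partial>height_law w)"
    "intensity w > 0"
proof -
  let ?R = "restrict_space lborel {0::real<..}"
  define Z where "Z = (LINT u:{0<..}|lborel. w u / u\<^sup>2)"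
  have Z: "Z > 0" using weights_integral(1)[OF assms] by (simp add: Z_def)
  have wR [measurable]: "w \<in> borel_measurable ?R"
    using w by (simp add: weights_def cong: measurable_cong_sets sets_restrict_space_cong[OF sets_lborel])
  have idR [measurable]: "(\<lambda>y. y) \<in> borel_measurable ?R"
    by (rule measurable_restrict_space1) simp
  have spR: "space ?R = {0<..}" by (simp add: space_restrict_space)
  have h: "height_law w = density ?R (\<lambda>y. ennreal (w y / y\<^sup>2 / Z))"
    by (simp add: height_law_def Z_def)
  show "space (height_law w) = {0<..}" "sets (height_law w) = sets ?R"
    by (simp_all add: h spR)
  have "emeasure (height_law w) (space (height_law w)) = (\<integral>\<^sup>+y. ennreal (w y / y\<^sup>2 / Z) \<partial>?R)"
    using sets.top[of ?R] unfolding h by (subst emeasure_density) (auto intro!: nn_integral_cong simp: spR)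
  also have "\<dots> = (\<integral>\<^sup>+y. ennreal (w y / y\<^sup>2) * ennreal (1 / Z) \<partial>?R)"
    using Z by (intro nn_integral_cong) (simp flip: ennreal_mult'')
  also have "\<dots> = ennreal Z * ennreal (1 / Z)"
    using weights_integral(2)[OF assms] by (subst nn_integral_multc) (auto simp: Z_def)
  also have "\<dots> = 1" using Z by (simp flip: ennreal_mult)
  finally show "prob_space (height_law w)" by (rule prob_spaceI)
  show "intensity w > 0" using Z by (simp add: intensity_def Z_def)
  fix v :: "real \<Rightarrow> real" assume v: "v \<in> borel_measurable ?R"
  have "(\<integral>y. v y \<partial>height_law w) = (\<integral>y. (w y / y\<^sup>2 / Z) *\<^sub>R v y \<partial>?R)"
    unfolding h using v Z weights_bounds(1)[OF w] by (intro integral_density AE_I2) (auto simp: spR)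
  then have "intensity w * (\<integral>y. v y \<partial>height_law w) = intensity w * (\<integral>y. (w y / y\<^sup>2 / Z) *\<^sub>R v y \<partial>?R)"
    by (simp only:)
  also have "\<dots> = (\<integral>y. intensity w * ((w y / y\<^sup>2 / Z) *\<^sub>R v y) \<partial>?R)"
    by (rule integral_mult_right_zero[symmetric])
  also have "\<dots> = (\<integral>y. w y / (4 * pi * y\<^sup>2) * v y \<partial>?R)"
    using Z by (intro Bochner_Integration.integral_cong) (auto simp: intensity_def Z_def[symmetric])
  finally show "(\<integral>y. w y / (4 * pi * y\<^sup>2) * v y \<partial>?R) = intensity w * (\<integral>y. v y \<partial>height_law w)" ..
qed

text \<open>Almost surely all atoms have heights in [\<alpha>, \<beta>], so the projection avoids A
  exactly when the strip over A is empty.\<close>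

lemma thinned_law_proj_void:
  assumes P: "thinned_law w K P" and w: "w \<in> weights \<alpha> \<beta>" and \<alpha>: "0 < \<alpha>" and A: "A \<in> sets borel"
  shows "prob_space (distr P N_R proj_config)"
    and "emeasure (distr P N_R proj_config) {\<mu> \<in> simple_configs UNIV. emeasure \<mu> A = 0} =
      ennreal (measure P {\<xi> \<in> simple_configs upper_half_plane. atoms \<xi> \<inter> strip \<alpha> \<beta> A = {}})"
proof -
  interpret prob_space P by (rule thinned_lawD(1)[OF P])
  have pc: "proj_config \<in> measurable P N_R"
    using measurable_proj_config by (simp cong: measurable_cong_sets add: thinned_lawD(2)[OF P])
  show "prob_space (distr P N_R proj_config)" by (rule prob_space_distr[OF pc])
  have S: "strip \<alpha> \<beta> A \<in> sets (restrict_space borel upper_half_plane)"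
    using strip_sets(2)[OF \<alpha> A] by (simp add: sets_dA)
  have void: "{\<xi> \<in> simple_configs upper_half_plane. atoms \<xi> \<inter> strip \<alpha> \<beta> A = {}} \<in> sets P"
  proof -
    have "{\<xi> \<in> space N_H. emeasure \<xi> (strip \<alpha> \<beta> A) = 0} \<in> sets N_H"
      using measurable_config_emeasure[OF open_upper_half_plane S] by measurable
    also have "{\<xi> \<in> space N_H. emeasure \<xi> (strip \<alpha> \<beta> A) = 0} =
        {\<xi> \<in> simple_configs upper_half_plane. atoms \<xi> \<inter> strip \<alpha> \<beta> A = {}}"
      using emeasure_simple_configs_eq_0[OF _ strip_sets(1,3)[OF \<alpha> A]] by auto
    finally show ?thesis by (simp add: thinned_lawD(2)[OF P])
  qed
  have "emeasure (distr P N_R proj_config) {\<mu> \<in> simple_configs UNIV. emeasure \<mu> A = 0} =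
      emeasure P (proj_config -` {\<mu> \<in> simple_configs UNIV. emeasure \<mu> A = 0} \<inter> space P)"
    by (rule emeasure_distr[OF pc void_event_sets[OF A]])
  also have "\<dots> = emeasure P {\<xi> \<in> simple_configs upper_half_plane. atoms \<xi> \<inter> strip \<alpha> \<beta> A = {}}"
  proof (rule emeasure_eq_AE)
    show "AE \<xi> in P. \<xi> \<in> proj_config -` {\<mu> \<in> simple_configs UNIV. emeasure \<mu> A = 0} \<inter> space P \<longleftrightarrow>
        \<xi> \<in> {\<xi> \<in> simple_configs upper_half_plane. atoms \<xi> \<inter> strip \<alpha> \<beta> A = {}}"
      using thinned_law_AE_strip[OF P w] thinned_law_AE_inj[OF P] AE_space
    proof eventually_elim
      case (elim \<xi>)
      then have xi: "\<xi> \<in> simple_configs upper_half_plane" by (simp add: thinned_lawD(3)[OF P])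
      note r = proj_Re_regular[OF xi \<alpha> elim(1,2)]
      have mem: "proj_config \<xi> \<in> simple_configs UNIV" using r(1) by (simp add: proj_config_def)
      have at: "atoms (proj_config \<xi>) = Re ` atoms \<xi>" using r(2) by simp
      have "emeasure (proj_config \<xi>) A = 0 \<longleftrightarrow> Re ` atoms \<xi> \<inter> A = {}"
        using emeasure_simple_configs_eq_0[OF mem A] at by simp
      also have "\<dots> \<longleftrightarrow> atoms \<xi> \<inter> strip \<alpha> \<beta> A = {}"
        using elim(1) by (fastforce simp: strip_def)
      finally show ?case using xi elim(3) mem by simp
    qed
    show "proj_config -` {\<mu> \<in> simple_configs UNIV. emeasure \<mu> A = 0} \<inter> space P \<in> sets P"
      by (rule measurable_sets[OF pc void_event_sets[OF A]])
  qed (rule void)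
  finally show "emeasure (distr P N_R proj_config) {\<mu> \<in> simple_configs UNIV. emeasure \<mu> A = 0} =
      ennreal (measure P {\<xi> \<in> simple_configs upper_half_plane. atoms \<xi> \<inter> strip \<alpha> \<beta> A = {}})"
    by (simp add: emeasure_eq_measure)
qed

text \<open>At an irregular projection \<open>on_proj\<close> takes the value 0 and
  \<open>proj_config\<close> gives F of the empty configuration. The two conventions differ only on
  a null set.\<close>

lemma thinned_law_on_proj:
  assumes P: "thinned_law w K P" and w: "w \<in> weights \<alpha> \<beta>" and \<alpha>: "0 < \<alpha>" and F: "bounded_functional F"
  shows "(\<integral>\<xi>. on_proj F \<xi> \<partial>P) = (\<integral>\<mu>. F \<mu> \<partial>distr P N_R proj_config)"
proof -
  have pc: "proj_config \<in> measurable P N_R"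
    using measurable_proj_config by (simp cong: measurable_cong_sets add: thinned_lawD(2)[OF P])
  have Fm: "F \<in> borel_measurable N_R" using F by (simp add: bounded_functional_def)
  have Fp [measurable]: "(\<lambda>\<xi>. F (proj_config \<xi>)) \<in> borel_measurable P"
    by (rule measurable_compose[OF pc Fm])
  have [measurable]: "Measurable.pred P (\<lambda>\<xi>. proj_Re \<xi> \<in> simple_configs UNIV)"
    unfolding measurable_cong_sets[OF thinned_lawD(2)[OF P] refl] by (rule measurable_proj_simple)
  have "(\<lambda>\<xi>. if proj_Re \<xi> \<in> simple_configs UNIV then F (proj_config \<xi>) else 0) \<in> borel_measurable P"
    by measurable
  then have m: "on_proj F \<in> borel_measurable P"
    by (rule measurable_cong[THEN iffD1, rotated]) (simp add: on_proj_def proj_config_def)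
  have "(\<integral>\<xi>. on_proj F \<xi> \<partial>P) = (\<integral>\<xi>. F (proj_config \<xi>) \<partial>P)"
  proof (rule integral_cong_AE[OF m Fp])
    show "AE \<xi> in P. on_proj F \<xi> = F (proj_config \<xi>)"
      using thinned_law_AE_strip[OF P w] thinned_law_AE_inj[OF P] AE_space
    proof eventually_elim
      case (elim \<xi>)
      then have xi: "\<xi> \<in> simple_configs upper_half_plane" by (simp add: thinned_lawD(3)[OF P])
      show ?case
        using proj_Re_regular(1)[OF xi \<alpha> elim(1,2)] by (simp add: on_proj_def proj_config_def)
    qed
  qed
  also have "\<dots> = (\<integral>\<mu>. F \<mu> \<partial>distr P N_R proj_config)"
    by (rule integral_distr[OF pc Fm, symmetric])
  finally show ?thesis .
qed

theorem theorem1p1: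
  fixes \<alpha> \<beta> :: real and w :: "real \<Rightarrow> real"
    and PZ :: "complex measure measure"
    and Palm_X :: "real measure measure"
    and Palm_M :: "real \<Rightarrow> complex measure measure"
    and F :: "real measure \<Rightarrow> real"
  assumes "0 < \<alpha>" and "\<alpha> < \<beta>" and "w \<in> weights \<alpha> \<beta>"
    and "determinantal_law K_H PZ"
    and "reduced_palm (law_X w PZ) (intensity w) Palm_X"
    and "\<And>y. y > 0 \<Longrightarrow> determinantal_law (thinned_palm_kernel w y) (Palm_M y)"
    and "bounded_functional F"
  shows "(\<integral>\<mu>. F \<mu> \<partial>Palm_X) =
           (\<integral>y. (\<integral>\<xi>. on_proj F \<xi> \<partial>Palm_M y) \<partial>height_law w)"
proof -
  note \<alpha> = assms(1) and w = assms(3) and F = assms(7)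
  have L: "thinned_law w K_H (law_M w PZ)" by (rule thinned_law_law_M[OF assms(4) w])
  have PM: "thinned_law w (palm_kernel K_H (\<i> * of_real y)) (Palm_M y)" if "y > 0" for y
    by (rule thinned_law_palm[OF assms(6)[OF that] w])
  note H = height_law_props[OF assms(1-3)]
  interpret H: prob_space "height_law w" by (rule H(1))
  have Qs: "prob_space Palm_X" "sets Palm_X = sets N_R" "space Palm_X = simple_configs UNIV"
    using assms(5) sets_eq_imp_space_eq[of Palm_X N_R] by (auto simp: reduced_palm_def)
  interpret Q: prob_space Palm_X by (rule Qs(1))
  define \<kappa> where "\<kappa> y = distr (Palm_M y) N_R proj_config" for y
  define v where "v A y = measure (Palm_M y) {\<xi> \<in> simple_configs upper_half_plane. atoms \<xi> \<inter> strip \<alpha> \<beta> A = {}}" for A y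
  have \<kappa>_void: "emeasure (\<kappa> y) {\<mu> \<in> simple_configs UNIV. emeasure \<mu> A = 0} = ennreal (v A y)"
    if "y > 0" "A \<in> sets borel" for A y
    unfolding \<kappa>_def v_def by (rule thinned_law_proj_void(2)[OF PM[OF that(1)] w \<alpha> that(2)])
  have v_meas: "v A \<in> borel_measurable (height_law w)"
    and v_int: "measure Palm_X {\<mu> \<in> simple_configs UNIV. emeasure \<mu> A = 0} = (\<integral>y. v A y \<partial>height_law w)"
    if A: "A \<in> sets borel" "bounded A" for A
  proof -
    have vR: "v A \<in> borel_measurable (restrict_space lborel {0<..})"
      unfolding v_def by (rule isolated_count_mixture(1)[OF L PM w \<alpha> A])
    then show "v A \<in> borel_measurable (height_law w)"
      by (simp cong: measurable_cong_sets add: H(3))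
    \<comment> \<open>Both sides equal the expected number of points over [0, 1] that are isolated
      with respect to A; the positive intensity then cancels.\<close>
    have "intensity w * measure Palm_X {\<mu> \<in> simple_configs UNIV. emeasure \<mu> A = 0} = intensity w * (\<integral>y. v A y \<partial>height_law w)"
      unfolding reduced_palm_void[OF assms(4) w \<alpha> assms(5) A] H(4)[OF vR, symmetric]
      unfolding v_def by (rule isolated_count_mixture(2)[OF L PM w \<alpha> A])
    then show "measure Palm_X {\<mu> \<in> simple_configs UNIV. emeasure \<mu> A = 0} = (\<integral>y. v A y \<partial>height_law w)"
      using H(5) by simp
  qed
  have void: "\<exists>A. a = {\<mu> \<in> simple_configs UNIV. emeasure \<mu> A = 0} \<and> A \<in> sets borel \<and> bounded A"
    if "a \<in> void_events (UNIV :: real set)" for a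
    using that unfolding void_events_def by (auto dest: compact_imp_bounded intro: bounded_subset)
  note gen = sets_config_space_void_events[OF open_UNIV, where ?'a = real]
  \<comment> \<open>Measurability of y \<mapsto> \<open>Palm_M y\<close> is not among the
    assumptions. For the projected laws it follows from the void probabilities, because void events
    form an intersection-stable generator.\<close>
  have \<kappa>_prob: "\<kappa> \<in> measurable (height_law w) (prob_algebra N_R)"
  proof (rule measurable_prob_algebra_generated[OF gen Int_stable_void_events void_events_subset])
    fix y assume "y \<in> space (height_law w)"
    then have "y > 0" by (simp add: H(2))
    then show "prob_space (\<kappa> y)"
      unfolding \<kappa>_def by (intro thinned_law_proj_void(1)[OF PM w \<alpha>, of _ "{}"]) auto
    show "sets (\<kappa> y) = sets N_R" by (simp add: \<kappa>_def)
  next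
    fix a assume "a \<in> void_events (UNIV :: real set)"
    then obtain A where A: "a = {\<mu> \<in> simple_configs UNIV. emeasure \<mu> A = 0}" "A \<in> sets borel" "bounded A"
      using void by blast
    have "(\<lambda>y. ennreal (v A y)) \<in> borel_measurable (height_law w)"
      using v_meas[OF A(2,3)] by measurable
    then show "(\<lambda>y. emeasure (\<kappa> y) a) \<in> borel_measurable (height_law w)"
      by (rule measurable_cong[THEN iffD1, rotated]) (simp add: A(1) H(2) \<kappa>_void[OF _ A(2)])
  qed
  have \<kappa>_sub: "\<kappa> \<in> measurable (height_law w) (subprob_algebra N_R)"
    by (rule measurable_prob_algebraD[OF \<kappa>_prob])
  have "Palm_X = height_law w \<bind> \<kappa>"
  proof (rule measure_eqI_generator_eq[OF Int_stable_void_events void_events_subset])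
    show "sets Palm_X = sigma_sets (simple_configs UNIV) (void_events UNIV)"
      by (simp add: Qs(2) gen)
    show "sets (height_law w \<bind> \<kappa>) = sigma_sets (simple_configs UNIV) (void_events UNIV)"
      by (subst sets_bind[of _ _ N_R]) (auto simp: \<kappa>_def gen H.not_empty)
    \<comment> \<open>The whole space is the void event of A = {}, so a constant sequence exhausts
      it.\<close>
    show "range (\<lambda>_::nat. simple_configs (UNIV :: real set)) \<subseteq> void_events UNIV"
      by (auto simp: void_events_def intro!: exI[of _ "{}"])
    show "emeasure Palm_X a = emeasure (height_law w \<bind> \<kappa>) a" if a: "a \<in> void_events UNIV" for a
    proof -
      obtain A where A: "a = {\<mu> \<in> simple_configs UNIV. emeasure \<mu> A = 0}" "A \<in> sets borel" "bounded A"
        using void[OF a] by blast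
      have v01: "0 \<le> v A y" "v A y \<le> 1" if "y > 0" for y
        using prob_space.prob_le_1[OF thinned_lawD(1)[OF PM[OF that]]] by (auto simp: v_def)
      have "emeasure (height_law w \<bind> \<kappa>) a = (\<integral>\<^sup>+y. emeasure (\<kappa> y) a \<partial>height_law w)"
        using void_event_sets[OF A(2)] by (intro emeasure_bind[OF H.not_empty \<kappa>_sub]) (simp add: A(1))
      also have "\<dots> = (\<integral>\<^sup>+y. ennreal (v A y) \<partial>height_law w)"
        by (intro nn_integral_cong) (simp add: A(1) H(2) \<kappa>_void[OF _ A(2)])
      also have "\<dots> = ennreal (\<integral>y. v A y \<partial>height_law w)"
      proof (rule nn_integral_eq_integral)
        show "integrable (height_law w) (v A)"
          using v01 v_meas[OF A(2,3)] by (intro H.integrable_const_bound[of _ 1] AE_I2) (auto simp: H(2))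
        show "AE y in height_law w. 0 \<le> v A y" using v01 by (intro AE_I2) (auto simp: H(2))
      qed
      also have "\<dots> = emeasure Palm_X a"
        by (simp add: A(1) v_int[OF A(2,3), symmetric] Q.emeasure_eq_measure)
      finally show ?thesis ..
    qed
  qed (use Q.emeasure_finite in auto)
  then have "(\<integral>\<mu>. F \<mu> \<partial>Palm_X) = (\<integral>\<mu>. F \<mu> \<partial>(height_law w \<bind> \<kappa>))" by simp
  also have "\<dots> = (\<integral>y. (\<integral>\<mu>. F \<mu> \<partial>\<kappa> y) \<partial>height_law w)"
  proof -
    obtain B where B: "\<And>\<mu>. \<mu> \<in> simple_configs UNIV \<Longrightarrow> \<bar>F \<mu>\<bar> \<le> B"
      using F by (auto simp: bounded_functional_def bounded_iff)
    have "AE y in height_law w. emeasure (\<kappa> y) (space (\<kappa> y)) \<le> ennreal 1"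
    proof (rule AE_I2)
      fix y assume "y \<in> space (height_law w)"
      then have "prob_space (\<kappa> y)"
        using measurable_space[OF \<kappa>_prob] by (simp add: space_prob_algebra)
      then show "emeasure (\<kappa> y) (space (\<kappa> y)) \<le> ennreal 1"
        by (simp add: prob_space.emeasure_space_1)
    qed
    then show ?thesis
      using F B by (intro integral_bind[OF _ _ \<kappa>_sub H.finite_measure_axioms, where B = B and B' = 1])
        (auto simp: bounded_functional_def)
  qed
  also have "\<dots> = (\<integral>y. (\<integral>\<xi>. on_proj F \<xi> \<partial>Palm_M y) \<partial>height_law w)"
    unfolding \<kappa>_def
    by (intro Bochner_Integration.integral_cong refl thinned_law_on_proj[OF PM w \<alpha> F, symmetric]) (simp add: H(2))
  finally show ?thesis .
qed

end
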